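(* The point functor $P_{b_p^\infty}$, which assigns to each graph $E$ the set of vertices with pure infinite bifurcations $$P_{b_p^\infty}(E)=\{v\in E^0 \;\vert\; v\not\ge P_l(E)\cup P_c(E)\cup P_{ec}(E)\},$$ is invariant under isomorphism; that is, for all graphs $E,F$ and every ring isomorphism $f\colon L_K(E)\to L_K(F)$ one has $f\big(I(P_{b_p^\infty}(E))\big)=I(P_{b_p^\infty}(F))$.
   Context: Graphs are directed graphs $E=(E^0,E^1,r,s)$ ($r$ = range, $s$ = source) and are row-finite: $s^{-1}(v)$ is finite for every $v\in E^0$. $K$ is a field. $L_K(E)$ is the Leavitt path algebra: the $K$-algebra generated by $E^0\cup E^1\cup\{e^*: e\in E^1\}$ with relations $vw=\delta_{v,w}v$, $s(e)e=e=e\,r(e)$, $r(e)e^*=e^*=e^*s(e)$, $e^*f=\delta_{e,f}r(e)$, and $v=\sum_{s(e)=v}ee^*$ for each regular vertex $v$ (a vertex with $0<|s^{-1}(v)|<\infty$). For $X\subseteq E^0$, $I(X)$ is the two-sided ideal of $L_K(E)$ generated by $X$. For vertices $u,v$ write $u\ge v$ if there is a path (possibly of length $0$) from $u$ to $v$; for $X\subseteq E^0$ write $u\ge X$ if $u\ge x$ for some $x\in X$. $T(v)=\{w: v\ge w\}$ is the tree of $v$. A bifurcation is a vertex $u$ with $|s^{-1}(u)|\ge2$. $P_l(E)$ is the set of line points: vertices $v$ such that there are neither bifurcations nor cycles at any vertex of $T(v)$. An exit of a path $e_1\cdots e_n$ is an edge $e$ with $s(e)=s(e_i)$ and $e\ne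 e_i$ for some $i$. $P_c(E)$ is the set of vertices lying on cycles without exits. A cycle $c$ (with vertex set $c^0$) is extreme if it has exits and for every path $\lambda$ starting at a vertex of $c^0$ there is a path $\mu$ with $\lambda\mu\neq 0$ (i.e. composable) and $r(\lambda\mu)\in c^0$; $P_{ec}(E)$ is the set of vertices lying on extreme cycles. A point functor is a functor $H$ from the category of graphs (morphisms: graph isomorphisms) to sets with $H(E)\subseteq E^0$ for every $E$, a subfunctor of $E\mapsto E^0$. *)

theory Defs
  imports
    "Graph_Theory.Graph_Theory"
    "HOL-Algebra.QuotRing"
    "HOL-Library.Poly_Mapping"
begin

section \<open>Rings without identity\<close>

text \<open>
  Leavitt path algebras of graphs with infinitely many vertices have no identity, so the library
  locales \<^locale>\<open>ring\<close> and \<^locale>\<open>ideal\<close> do not apply to them. Rings without identity are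
  represented by the library's ring records; the field \<^term>\<open>one\<close> is never used and need not lie
  in the carrier. An ideal is the library notion with the assumption of an identity dropped.
\<close>

definition rng_ideal :: "'a set \<Rightarrow> ('a, 'm) ring_scheme \<Rightarrow> bool" where
  "rng_ideal I R \<longleftrightarrow> additive_subgroup I R \<and>
     (\<forall>a\<in>I. \<forall>x\<in>carrier R. x \<otimes>\<^bsub>R\<^esub> a \<in> I \<and> a \<otimes>\<^bsub>R\<^esub> x \<in> I)"

definition rng_genideal :: "('a, 'm) ring_scheme \<Rightarrow> 'a set \<Rightarrow> 'a set" where
  "rng_genideal R S = \<Inter>{I. rng_ideal I R \<and> S \<subseteq> I}"

definition rng_iso :: "('a, 'm) ring_scheme \<Rightarrow> ('b, 'n) ring_scheme \<Rightarrow> ('a \<Rightarrow> 'b) set" where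
  "rng_iso R S = iso R S \<inter> iso (add_monoid R) (add_monoid S)"

lemma rng_iso_iff:
  "f \<in> rng_iso R S \<longleftrightarrow> bij_betw f (carrier R) (carrier S) \<and>
     (\<forall>x\<in>carrier R. \<forall>y\<in>carrier R.
        f (x \<oplus>\<^bsub>R\<^esub> y) = f x \<oplus>\<^bsub>S\<^esub> f y \<and> f (x \<otimes>\<^bsub>R\<^esub> y) = f x \<otimes>\<^bsub>S\<^esub> f y)"
  unfolding rng_iso_def iso_def hom_def by (auto dest: bij_betwE)


section \<open>Words and free algebras\<close>

text \<open>
  The free monoid, written additively because \<^typ>\<open>'a \<Rightarrow>\<^sub>0 'b\<close> is given the convolution product
  for an additive monoid of exponents.
\<close>

datatype 'a word = Word (letters: "'a list")

instantiation word :: (type) monoid_add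
begin

definition zero_word :: "'a word" where "zero_word = Word []"

definition plus_word :: "'a word \<Rightarrow> 'a word \<Rightarrow> 'a word" where
  "plus_word u w = Word (letters u @ letters w)"

instance by standard (auto simp: zero_word_def plus_word_def)

end

datatype ('v, 'e) lpa_gen = Vertex 'v | Edge 'e | Ghost 'e

type_synonym ('v, 'e, 'k) free_alg = "('v, 'e) lpa_gen word \<Rightarrow>\<^sub>0 'k"

abbreviation monomial :: "'a \<Rightarrow> 'a word \<Rightarrow>\<^sub>0 'k::field" where
  "monomial x \<equiv> Poly_Mapping.single (Word [x]) 1"

definition lpa_gens :: "('v, 'e) pre_digraph \<Rightarrow> ('v, 'e) lpa_gen set" where
  "lpa_gens E = Vertex ` verts E \<union> Edge ` arcs E \<union> Ghost ` arcs E"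

text \<open>
  The free algebra without identity on \<^term>\<open>lpa_gens E\<close>: combinations of nonempty words. The field
  \<^term>\<open>one\<close> is outside the carrier.
\<close>

definition lpa_free :: "('v, 'e) pre_digraph \<Rightarrow> ('v, 'e, 'k::field) free_alg ring" where
  "lpa_free E =
    \<lparr>carrier = {p. \<forall>w\<in>Poly_Mapping.keys p. letters w \<noteq> [] \<and> set (letters w) \<subseteq> lpa_gens E},
     mult = (*), one = 1, zero = 0, add = (+)\<rparr>"


section \<open>Leavitt path algebras\<close>

text \<open>
  A graph \<open>(E\<^sup>0, E\<^sup>1, r, s)\<close> is a \<^locale>\<open>wf_digraph\<close> with \<open>E\<^sup>0\<close> = \<^term>\<open>verts E\<close>, \<open>E\<^sup>1\<close> = \<^term>\<open>arcs E\<close>,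
  \<open>r\<close> = \<^term>\<open>head E\<close>, \<open>s\<close> = \<^term>\<open>tail E\<close>; loops and parallel edges are allowed.
\<close>

locale row_finite_digraph = wf_digraph +
  assumes row_finite: "v \<in> verts G \<Longrightarrow> finite (out_arcs G v)"

text \<open>Each defining relation \<open>a = b\<close> is encoded as the element \<open>a - b\<close>.\<close>

inductive_set lpa_relators ::
    "('v, 'e) pre_digraph \<Rightarrow> ('v, 'e, 'k::field) free_alg set"
  for E :: "('v, 'e) pre_digraph" where
  vertices: "\<lbrakk>v \<in> verts E; w \<in> verts E\<rbrakk> \<Longrightarrow>
    monomial (Vertex v) * monomial (Vertex w) - (if v = w then monomial (Vertex v) else 0)
      \<in> lpa_relators E"
| source_edge: "e \<in> arcs E \<Longrightarrow>
    monomial (Vertex (tail E e)) * monomial (Edge e) - monomial (Edge e) \<in> lpa_relators E"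
| edge_range: "e \<in> arcs E \<Longrightarrow>
    monomial (Edge e) * monomial (Vertex (head E e)) - monomial (Edge e) \<in> lpa_relators E"
| range_ghost: "e \<in> arcs E \<Longrightarrow>
    monomial (Vertex (head E e)) * monomial (Ghost e) - monomial (Ghost e) \<in> lpa_relators E"
| ghost_source: "e \<in> arcs E \<Longrightarrow>
    monomial (Ghost e) * monomial (Vertex (tail E e)) - monomial (Ghost e) \<in> lpa_relators E"
| CK1: "\<lbrakk>e \<in> arcs E; f \<in> arcs E\<rbrakk> \<Longrightarrow>
    monomial (Ghost e) * monomial (Edge f) - (if e = f then monomial (Vertex (head E e)) else 0)
      \<in> lpa_relators E"
| CK2: "\<lbrakk>v \<in> verts E; out_arcs E v \<noteq> {}; finite (out_arcs E v)\<rbrakk> \<Longrightarrow>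
    monomial (Vertex v) - (\<Sum>e\<in>out_arcs E v. monomial (Edge e) * monomial (Ghost e))
      \<in> lpa_relators E"

text \<open>
  In the absence of an identity, closure under multiplication by scalars (here: by constant
  combinations of the empty word) has to be required separately for an ideal of an algebra.
\<close>

definition lpa_relator_ideal :: "('v, 'e) pre_digraph \<Rightarrow> ('v, 'e, 'k::field) free_alg set" where
  "lpa_relator_ideal E = \<Inter>{J. rng_ideal J (lpa_free E) \<and>
     (\<forall>c. \<forall>p\<in>J. Poly_Mapping.single 0 c * p \<in> J) \<and> lpa_relators E \<subseteq> J}"

definition leavitt_path_algebra ::
    "('v, 'e) pre_digraph \<Rightarrow> ('v, 'e, 'k::field) free_alg set ring" where
  "leavitt_path_algebra E = lpa_free E Quot lpa_relator_ideal E"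

definition lpa_class ::
    "('v, 'e) pre_digraph \<Rightarrow> ('v, 'e, 'k::field) free_alg \<Rightarrow> ('v, 'e, 'k) free_alg set" where
  "lpa_class E p = lpa_relator_ideal E +>\<^bsub>lpa_free E\<^esub> p"

definition lpa_ideal ::
    "('v, 'e) pre_digraph \<Rightarrow> 'v set \<Rightarrow> ('v, 'e, 'k::field) free_alg set set" where
  "lpa_ideal E X =
     rng_genideal (leavitt_path_algebra E) ((\<lambda>v. lpa_class E (monomial (Vertex v))) ` X)"


text \<open>
  The relator ideal is an ideal of the free algebra, and the operations on classes are induced by
  those of the free algebra; so the classes of the generators satisfy the defining relations.
\<close>

lemma carrier_lpa_free_scale:
  fixes p :: "('v, 'e, 'k::field) free_alg"
  assumes "p \<in> carrier (lpa_free E)"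
  shows "- p \<in> carrier (lpa_free E)" "Poly_Mapping.single 0 c * p \<in> carrier (lpa_free E)"
proof -
  note k = assms[unfolded lpa_free_def, simplified]
  show "- p \<in> carrier (lpa_free E)"
    using k keys_diff[of 0 p] unfolding lpa_free_def by (fastforce dest: subsetD)
  show "Poly_Mapping.single 0 c * p \<in> carrier (lpa_free E)"
    using k keys_mult[of "Poly_Mapping.single 0 c" p] unfolding lpa_free_def
    by (fastforce split: if_splits dest: subsetD)
qed

lemma carrier_lpa_free_closed:
  fixes p q :: "('v, 'e, 'k::field) free_alg"
  assumes "p \<in> carrier (lpa_free E)" "q \<in> carrier (lpa_free E)"
  shows "p + q \<in> carrier (lpa_free E)" "p - q \<in> carrier (lpa_free E)"
    "p * q \<in> carrier (lpa_free E)"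
proof -
  note k = assms[unfolded lpa_free_def, simplified]
  show "p + q \<in> carrier (lpa_free E)"
    using k Poly_Mapping.keys_add[of p q] unfolding lpa_free_def by (fastforce dest: subsetD)
  show "p - q \<in> carrier (lpa_free E)"
    using k keys_diff[of p q] unfolding lpa_free_def by (fastforce dest: subsetD)
  show "p * q \<in> carrier (lpa_free E)"
    using k keys_mult[of p q] unfolding lpa_free_def by (fastforce simp: plus_word_def dest: subsetD)
qed

lemma abelian_group_lpa_free: "abelian_group (lpa_free E :: ('v, 'e, 'k::field) free_alg ring)"
proof (rule abelian_groupI)
  fix x :: "('v, 'e, 'k) free_alg" assume "x \<in> carrier (lpa_free E)"
  from carrier_lpa_free_scale(1)[OF this]
  show "\<exists>y\<in>carrier (lpa_free E). y \<oplus>\<^bsub>lpa_free E\<^esub> x = \<zero>\<^bsub>lpa_free E\<^esub>"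
    by (intro bexI[of _ "- x"]) (simp add: lpa_free_def)
next
  fix x y :: "('v, 'e, 'k) free_alg" assume "x \<in> carrier (lpa_free E)" "y \<in> carrier (lpa_free E)"
  from carrier_lpa_free_closed(1)[OF this]
  show "x \<oplus>\<^bsub>lpa_free E\<^esub> y \<in> carrier (lpa_free E)" by (simp add: lpa_free_def)
qed (auto simp: lpa_free_def algebra_simps)

lemma monomial_carrier: "x \<in> lpa_gens E \<Longrightarrow> monomial x \<in> carrier (lpa_free E)"
  by (simp add: lpa_free_def)

lemma rng_ideal_iff_lpa_free:
  fixes J :: "('v, 'e, 'k::field) free_alg set"
  shows "rng_ideal J (lpa_free E) \<longleftrightarrow> J \<subseteq> carrier (lpa_free E) \<and> 0 \<in> J \<and>
    (\<forall>a\<in>J. \<forall>b\<in>J. a - b \<in> J) \<and> (\<forall>a\<in>J. \<forall>x\<in>carrier (lpa_free E). x * a \<in> J \<and> a * x \<in> J)" (is "?l = ?r")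
proof -
  interpret A: abelian_group "lpa_free E :: ('v, 'e, 'k) free_alg ring" by (rule abelian_group_lpa_free)
  have minus: "\<ominus>\<^bsub>lpa_free E\<^esub> a = - a" if "a \<in> carrier (lpa_free E)" for a :: "('v, 'e, 'k) free_alg"
    using A.minus_equality[of "- a" a] that carrier_lpa_free_scale(1)[OF that] by (simp add: lpa_free_def)
  have inv: "inv\<^bsub>add_monoid (lpa_free E)\<^esub> a = - a" if "a \<in> carrier (lpa_free E)" for a :: "('v, 'e, 'k) free_alg"
    using minus[OF that] by (simp add: a_inv_def)
  have ops: "x \<otimes>\<^bsub>lpa_free E\<^esub> y = x * y" "x \<oplus>\<^bsub>lpa_free E\<^esub> y = x + y" "\<zero>\<^bsub>lpa_free E\<^esub> = 0"
    for x y :: "('v, 'e, 'k) free_alg" by (simp_all add: lpa_free_def)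
  have sg: "subgroup J (add_monoid (lpa_free E)) \<longleftrightarrow>
      J \<subseteq> carrier (lpa_free E) \<and> 0 \<in> J \<and> (\<forall>a\<in>J. \<forall>b\<in>J. a - b \<in> J)" (is "?s \<longleftrightarrow> ?t")
  proof
    assume s: ?s
    have J: "J \<subseteq> carrier (lpa_free E)" using subgroup.subset[OF s] by simp
    have "a - b \<in> J" if "a \<in> J" "b \<in> J" for a b
      using subgroup.m_closed[OF s that(1) subgroup.m_inv_closed[OF s that(2)]] inv that J
      by (auto simp: ops)
    with J show ?t using subgroup.one_closed[OF s] by (simp add: ops)
  next
    assume t: ?t
    then have n: "- a \<in> J" if "a \<in> J" for a using that by (metis diff_0)
    show ?s
    proof
      fix x y assume "x \<in> J" "y \<in> J"
      then have "x - (- y) \<in> J" using t n by blast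
      then show "x \<otimes>\<^bsub>add_monoid (lpa_free E)\<^esub> y \<in> J" by (simp add: ops)
    next
      fix x assume "x \<in> J"
      then show "inv\<^bsub>add_monoid (lpa_free E)\<^esub> x \<in> J" using n t inv by auto
    qed (use t in \<open>auto simp: ops\<close>)
  qed
  show ?thesis unfolding rng_ideal_def additive_subgroup_def sg unfolding ops(1) by blast
qed

lemma lpa_relators_subset:
  assumes "wf_digraph E"
  shows "lpa_relators E \<subseteq> (carrier (lpa_free E) :: ('v, 'e, 'k::field) free_alg set)"
proof
  interpret wf_digraph E by fact
  have z: "(0 :: ('v, 'e, 'k) free_alg) \<in> carrier (lpa_free E)" by (simp add: lpa_free_def)
  have V: "monomial (Vertex v) \<in> (carrier (lpa_free E) :: ('v, 'e, 'k) free_alg set)" if "v \<in> verts E" for v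
    using that by (intro monomial_carrier) (simp add: lpa_gens_def)
  have A: "monomial (Edge e) \<in> (carrier (lpa_free E) :: ('v, 'e, 'k) free_alg set)"
      "monomial (Ghost e) \<in> (carrier (lpa_free E) :: ('v, 'e, 'k) free_alg set)" if "e \<in> arcs E" for e
    using that by (auto intro!: monomial_carrier simp: lpa_gens_def)
  fix p :: "('v, 'e, 'k) free_alg" assume "p \<in> lpa_relators E"
  then show "p \<in> carrier (lpa_free E)"
  proof cases
    case (CK2 v)
    have sum: "(\<Sum>e\<in>S. monomial (Edge e) * monomial (Ghost e)) \<in> (carrier (lpa_free E) :: ('v, 'e, 'k) free_alg set)"
      if "finite S" "S \<subseteq> arcs E" for S
      using that by (induction S) (auto intro!: carrier_lpa_free_closed A z)
    have "out_arcs E v \<subseteq> arcs E" by auto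
    from carrier_lpa_free_closed(2)[OF V[OF CK2(2)] sum[OF CK2(4) this]]
    show ?thesis by (simp only: CK2(1))
  qed (simp_all add: carrier_lpa_free_closed V A z)
qed

lemma rng_ideal_lpa_relator_ideal:
  assumes "wf_digraph E"
  shows "rng_ideal (lpa_relator_ideal E) (lpa_free E :: ('v, 'e, 'k::field) free_alg ring)"
    and "lpa_relators E \<subseteq> (lpa_relator_ideal E :: ('v, 'e, 'k) free_alg set)"
proof -
  have "rng_ideal (carrier (lpa_free E)) (lpa_free E :: ('v, 'e, 'k) free_alg ring)"
    by (auto simp: rng_ideal_iff_lpa_free intro: carrier_lpa_free_closed) (simp add: lpa_free_def)
  then have "(carrier (lpa_free E) :: ('v, 'e, 'k) free_alg set) \<in> {J. rng_ideal J (lpa_free E) \<and>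
     (\<forall>c. \<forall>p\<in>J. Poly_Mapping.single 0 c * p \<in> J) \<and> lpa_relators E \<subseteq> J}" (is "_ \<in> ?F")
    using lpa_relators_subset[OF assms] by (auto intro: carrier_lpa_free_scale)
  then show "rng_ideal (lpa_relator_ideal E) (lpa_free E :: ('v, 'e, 'k::field) free_alg ring)"
    (is "rng_ideal ?I _")
  proof -
    assume c: "carrier (lpa_free E) \<in> ?F"
    show ?thesis
      unfolding rng_ideal_iff_lpa_free
    proof (intro conjI ballI)
      show "?I \<subseteq> carrier (lpa_free E)" using c unfolding lpa_relator_ideal_def by (rule Inter_lower)
    qed (auto simp: lpa_relator_ideal_def rng_ideal_iff_lpa_free)
  qed
  show "lpa_relators E \<subseteq> (lpa_relator_ideal E :: ('v, 'e, 'k) free_alg set)"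
    unfolding lpa_relator_ideal_def by blast
qed

lemma leavitt_path_algebra_ops:
  fixes p q :: "('v, 'e, 'k::field) free_alg"
  assumes E: "wf_digraph E" and p: "p \<in> carrier (lpa_free E)" and q: "q \<in> carrier (lpa_free E)"
  shows "lpa_class E p \<in> carrier (leavitt_path_algebra E)"
    and "lpa_class E p \<oplus>\<^bsub>leavitt_path_algebra E\<^esub> lpa_class E q = lpa_class E (p + q)"
    and "lpa_class E p \<otimes>\<^bsub>leavitt_path_algebra E\<^esub> lpa_class E q = lpa_class E (p * q)"
    and "lpa_class E p = lpa_class E q \<longleftrightarrow> p - q \<in> lpa_relator_ideal E"
proof -
  define J where "J = (lpa_relator_ideal E :: ('v, 'e, 'k) free_alg set)"
  have J: "J \<subseteq> carrier (lpa_free E)" "0 \<in> J" "\<And>a b. a \<in> J \<Longrightarrow> b \<in> J \<Longrightarrow> a - b \<in> J"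
    "\<And>a x. a \<in> J \<Longrightarrow> x \<in> carrier (lpa_free E) \<Longrightarrow> x * a \<in> J \<and> a * x \<in> J"
    using rng_ideal_lpa_relator_ideal(1)[OF E] by (auto simp: rng_ideal_iff_lpa_free J_def)
  have Jadd: "a + b \<in> J" if "a \<in> J" "b \<in> J" for a b
    using J(3)[OF that(1) J(3)[OF J(2) that(2)]] by simp
  have cls: "lpa_class E x = {y. y - x \<in> J}" for x
  proof -
    have "lpa_class E x = {h + x | h. h \<in> J}"
      unfolding lpa_class_def a_r_coset_def' J_def[symmetric] by (simp add: lpa_free_def) blast
    moreover have "y = (y - x) + x" for y by simp
    moreover have "h + x - x = h" for h by simp
    ultimately show ?thesis by (smt (verit) Collect_cong)
  qed
  have eq: "lpa_class E x = lpa_class E y \<longleftrightarrow> x - y \<in> J" for x y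
  proof
    assume e: "lpa_class E x = lpa_class E y"
    have "x \<in> lpa_class E x" using J(2) by (simp add: cls)
    then have "x \<in> lpa_class E y" by (simp only: e)
    then show "x - y \<in> J" by (simp add: cls)
  next
    assume d: "x - y \<in> J"
    have "z - y \<in> J" if "z - x \<in> J" for z
      using Jadd[OF that d] by simp
    moreover have "z - x \<in> J" if "z - y \<in> J" for z
      using J(3)[OF that d] by simp
    ultimately show "lpa_class E x = lpa_class E y" unfolding cls by blast
  qed
  show "lpa_class E p \<in> carrier (leavitt_path_algebra E)"
    using p by (auto simp: leavitt_path_algebra_def FactRing_def A_RCOSETS_def' lpa_class_def)
  show "lpa_class E p = lpa_class E q \<longleftrightarrow> p - q \<in> lpa_relator_ideal E" by (simp add: eq J_def)
  show "lpa_class E p \<oplus>\<^bsub>leavitt_path_algebra E\<^esub> lpa_class E q = lpa_class E (p + q)"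
  proof -
    have "lpa_class E p \<oplus>\<^bsub>leavitt_path_algebra E\<^esub> lpa_class E q = {a + b | a b. a - p \<in> J \<and> b - q \<in> J}"
      unfolding leavitt_path_algebra_def FactRing_def cls set_add_def' by (simp add: lpa_free_def) blast
    also have "\<dots> = {y. y - (p + q) \<in> J}"
    proof safe
      fix a b assume "a - p \<in> J" "b - q \<in> J"
      from Jadd[OF this] show "a + b - (p + q) \<in> J" by (simp add: algebra_simps)
    next
      fix y assume "y - (p + q) \<in> J"
      with J(2) show "\<exists>a b. y = a + b \<and> a - p \<in> J \<and> b - q \<in> J"
        by (intro exI[of _ p] exI[of _ "y - p"]) (simp add: diff_diff_eq)
    qed
    finally show ?thesis by (simp add: cls)
  qed
  have mult: "lpa_class E (a * b) = lpa_class E (p * q)" if a: "a - p \<in> J" and b: "b - q \<in> J" for a b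
  proof -
    have "(a - p) + p \<in> carrier (lpa_free E)" using a J(1) by (intro carrier_lpa_free_closed(1)[OF _ p]) auto
    then have "a \<in> carrier (lpa_free E)" by simp
    then have "a * (b - q) + (a - p) * q \<in> J"
      using Jadd[OF conjunct1[OF J(4)[OF b]] conjunct2[OF J(4)[OF a q]]] by blast
    moreover have "a * (b - q) + (a - p) * q = a * b - p * q" by (simp add: right_diff_distrib left_diff_distrib)
    ultimately show ?thesis unfolding eq by (simp only:)
  qed
  have "lpa_class E p \<otimes>\<^bsub>leavitt_path_algebra E\<^esub> lpa_class E q
      = (\<Union>a\<in>lpa_class E p. \<Union>b\<in>lpa_class E q. lpa_class E (a * b))"
  proof -
    have m: "x \<otimes>\<^bsub>lpa_free E\<^esub> y = x * y" for x y :: "('v, 'e, 'k) free_alg" by (simp add: lpa_free_def)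
    show ?thesis
      unfolding leavitt_path_algebra_def FactRing_def rcoset_mult_def lpa_class_def m by (simp only: monoid.simps)
  qed
  also have "\<dots> = lpa_class E (p * q)"
  proof -
    have "p \<in> lpa_class E p" "q \<in> lpa_class E q" using J(2) by (auto simp: cls)
    then have ne: "lpa_class E p \<noteq> {}" "lpa_class E q \<noteq> {}" by blast+
    have "lpa_class E (a * b) = lpa_class E (p * q)" if "a \<in> lpa_class E p" "b \<in> lpa_class E q" for a b
      using that mult by (simp add: cls)
    then show ?thesis using ne by simp
  qed
  finally show "lpa_class E p \<otimes>\<^bsub>leavitt_path_algebra E\<^esub> lpa_class E q = lpa_class E (p * q)" .
qed


section \<open>Distinguished sets of vertices\<close>

context pre_digraph
begin

definition tree :: "'a \<Rightarrow> 'a set" where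
  "tree v = {w. v \<rightarrow>\<^sup>* w}"

text \<open>
  The out-degree is a cardinality in the natural numbers, so this is meaningful only for row-finite
  graphs.
\<close>

definition bifurcation :: "'a \<Rightarrow> bool" where
  "bifurcation u \<longleftrightarrow> u \<in> verts G \<and> 2 \<le> out_degree G u"

text \<open>For a cycle \<open>c\<close> this is its vertex set \<open>c\<^sup>0\<close>: every vertex of a cycle is a source of one of its edges.\<close>

definition path_sources :: "'b list \<Rightarrow> 'a set" where
  "path_sources p = tail G ` set p"

definition path_exit :: "'b list \<Rightarrow> 'b \<Rightarrow> bool" where
  "path_exit p e \<longleftrightarrow> e \<in> arcs G \<and> (\<exists>a\<in>set p. tail G e = tail G a \<and> e \<noteq> a)"

definition line_points :: "'a set" where
  "line_points = {v \<in> verts G. \<forall>w\<in>tree v.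
     \<not> bifurcation w \<and> \<not> (\<exists>c. cycle c \<and> w \<in> path_sources c)}"

definition cycle_points :: "'a set" where
  "cycle_points = {v \<in> verts G. \<exists>c. cycle c \<and> \<not> (\<exists>e. path_exit c e) \<and> v \<in> path_sources c}"

definition extreme_cycle :: "'b list \<Rightarrow> bool" where
  "extreme_cycle c \<longleftrightarrow> cycle c \<and> (\<exists>e. path_exit c e) \<and>
     (\<forall>u\<in>path_sources c. \<forall>p w. awalk u p w \<longrightarrow>
        (\<exists>q. \<exists>x\<in>path_sources c. awalk u (p @ q) x))"

definition extreme_cycle_points :: "'a set" where
  "extreme_cycle_points = {v \<in> verts G. \<exists>c. extreme_cycle c \<and> v \<in> path_sources c}"

definition pure_infinite_bifurcations :: "'a set" where
  "pure_infinite_bifurcations = {v \<in> verts G.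
     \<not> (\<exists>x \<in> line_points \<union> cycle_points \<union> extreme_cycle_points. v \<rightarrow>\<^sup>* x)}"

end

context wf_digraph
begin

lemma tree_app_iso:
  assumes h: "digraph_isomorphism h" and v: "v \<in> verts G"
  shows "pre_digraph.tree (app_iso h G) (iso_verts h v) = iso_verts h ` tree v"
proof -
  have iv: "x \<in> verts G" if "a \<rightarrow>\<^sup>*\<^bsub>G\<^esub> x" for a x
    using that by (rule reachable_in_vertsE)
  have Hiv: "x \<in> iso_verts h ` verts G" if "a \<rightarrow>\<^sup>*\<^bsub>app_iso h G\<^esub> x" for a x
    using that by (rule reachable_in_vertsE) simp
  have eq: "iso_verts h v \<rightarrow>\<^sup>*\<^bsub>app_iso h G\<^esub> iso_verts h x \<longleftrightarrow> v \<rightarrow>\<^sup>* x" if "x \<in> verts G" for x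
    using that v h by (subst reachable_app_iso_eq) auto
  show ?thesis
    unfolding pre_digraph.tree_def using iv Hiv eq by blast
qed

lemma cycle_app_iso:
  assumes h: "digraph_isomorphism h" and c: "cycle c"
  shows "pre_digraph.cycle (app_iso h G) (map (iso_arcs h) c)"
proof -
  interpret H: wf_digraph "app_iso h G" using h ..
  from c obtain u where u: "awalk u c u" "distinct (tl (awalk_verts u c))" "c \<noteq> []"
    by (auto simp: cycle_def)
  have "set (awalk_verts u c) \<subseteq> verts G" using u(1) by (meson awalk_conv)
  then have "set (tl (awalk_verts u c)) \<subseteq> verts G" by (cases "awalk_verts u c") auto
  then have "distinct (map (iso_verts h) (tl (awalk_verts u c)))"
    using u(2) digraph_isomorphism_inj_on_verts[OF h] by (auto simp: distinct_map intro: inj_on_subset)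
  then have "distinct (tl (H.awalk_verts (iso_verts h u) (map (iso_arcs h) c)))"
    using awalk_verts_app_iso_eq[OF h u(1)] by (simp add: map_tl)
  with awalk_app_isoI[OF u(1) h] u(3) show ?thesis unfolding H.cycle_def by blast
qed

lemma path_sources_app_iso:
  assumes "digraph_isomorphism h" "set p \<subseteq> arcs G"
  shows "pre_digraph.path_sources (app_iso h G) (map (iso_arcs h) p) = iso_verts h ` path_sources p"
  using assms by (force simp: pre_digraph.path_sources_def iso_verts_tail)

lemma path_exit_app_iso:
  assumes h: "digraph_isomorphism h" and p: "set p \<subseteq> arcs G"
  shows "(\<exists>e. pre_digraph.path_exit (app_iso h G) (map (iso_arcs h) p) e) \<longleftrightarrow> (\<exists>e. path_exit p e)"
proof -
  have "(\<exists>e. pre_digraph.path_exit (app_iso h G) (map (iso_arcs h) p) e) \<longleftrightarrow>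
     (\<exists>e\<in>arcs G. \<exists>a\<in>set p. tail (app_iso h G) (iso_arcs h e) = tail (app_iso h G) (iso_arcs h a) \<and> iso_arcs h e \<noteq> iso_arcs h a)"
    by (auto simp: pre_digraph.path_exit_def)
  also have "\<dots> \<longleftrightarrow> (\<exists>e\<in>arcs G. \<exists>a\<in>set p. tail G e = tail G a \<and> e \<noteq> a)"
  proof -
    have "(tail (app_iso h G) (iso_arcs h e) = tail (app_iso h G) (iso_arcs h a) \<and> iso_arcs h e \<noteq> iso_arcs h a)
      \<longleftrightarrow> (tail G e = tail G a \<and> e \<noteq> a)" if "e \<in> arcs G" "a \<in> set p" for e a
      using that p h by (auto simp: iso_verts_tail subset_iff)
    then show ?thesis by (meson p)
  qed
  also have "\<dots> \<longleftrightarrow> (\<exists>e. path_exit p e)" by (auto simp: path_exit_def)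
  finally show ?thesis .
qed

lemma cycle_arcs: "cycle c \<Longrightarrow> set c \<subseteq> arcs G"
  by (auto simp: cycle_def awalk_def)

lemma path_sources_verts: "cycle c \<Longrightarrow> path_sources c \<subseteq> verts G"
  using cycle_arcs by (force simp: path_sources_def)

lemma extreme_cycle_app_iso:
  assumes h: "digraph_isomorphism h" and c: "extreme_cycle c"
  shows "pre_digraph.extreme_cycle (app_iso h G) (map (iso_arcs h) c)"
proof -
  interpret H: wf_digraph "app_iso h G" using h ..
  from c have cyc: "cycle c" and ex: "\<exists>e. path_exit c e"
    and ret: "\<And>u p w. u \<in> path_sources c \<Longrightarrow> awalk u p w \<Longrightarrow> \<exists>q. \<exists>x\<in>path_sources c. awalk u (p @ q) x"
    by (auto simp: extreme_cycle_def)
  note ps = path_sources_app_iso[OF h cycle_arcs[OF cyc]]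
  have "\<exists>q. \<exists>x\<in>H.path_sources (map (iso_arcs h) c). H.awalk u' (p @ q) x"
    if u': "u' \<in> H.path_sources (map (iso_arcs h) c)" and w: "H.awalk u' p w" for u' p w
  proof -
    from u' ps obtain u where u: "u \<in> path_sources c" "u' = iso_verts h u" by auto
    then have uv: "u \<in> verts G" using path_sources_verts[OF cyc] by auto
    have "awalk u (map (iso_arcs (inv_iso h)) p) (iso_verts (inv_iso h) w)"
      using awalk_app_isoD[OF w h] u uv h by simp
    from ret[OF u(1) this] obtain q x where q: "x \<in> path_sources c"
      "awalk u (map (iso_arcs (inv_iso h)) p @ q) x" by blast
    have "set p \<subseteq> iso_arcs h ` arcs G" using w by (auto simp: H.awalk_def)
    then have "map (iso_arcs h) (map (iso_arcs (inv_iso h)) p) = p"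
      using h by (auto intro!: map_idI)
    with awalk_app_isoI[OF q(2) h] u q(1) ps
    show ?thesis by (metis imageI map_append)
  qed
  with cycle_app_iso[OF h cyc] path_exit_app_iso[OF h cycle_arcs[OF cyc]] ex
  show ?thesis unfolding H.extreme_cycle_def by blast
qed

lemma points_app_iso_subset:
  assumes h: "digraph_isomorphism h"
  shows "iso_verts h ` cycle_points \<subseteq> pre_digraph.cycle_points (app_iso h G)"
    and "iso_verts h ` extreme_cycle_points \<subseteq> pre_digraph.extreme_cycle_points (app_iso h G)"
proof -
  interpret H: wf_digraph "app_iso h G" using h ..
  show "iso_verts h ` cycle_points \<subseteq> H.cycle_points"
    using cycle_app_iso[OF h] path_exit_app_iso[OF h] path_sources_app_iso[OF h] cycle_arcs
    by (auto simp: cycle_points_def H.cycle_points_def) (metis imageI)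
  show "iso_verts h ` extreme_cycle_points \<subseteq> H.extreme_cycle_points"
    using extreme_cycle_app_iso[OF h] path_sources_app_iso[OF h] cycle_arcs
    by (auto simp: extreme_cycle_points_def H.extreme_cycle_points_def extreme_cycle_def) (metis imageI)
qed

lemma line_points_app_iso_subset:
  assumes h: "digraph_isomorphism h"
  shows "iso_verts h ` line_points \<subseteq> pre_digraph.line_points (app_iso h G)"
proof
  interpret H: wf_digraph "app_iso h G" using h ..
  have h': "H.digraph_isomorphism (inv_iso h)" by (rule digraph_isomorphism_invI[OF h])
  fix v' assume "v' \<in> iso_verts h ` line_points"
  then obtain v where v: "v' = iso_verts h v" "v \<in> line_points" by auto
  then have vv: "v \<in> verts G" by (simp add: line_points_def)
  have "\<not> H.bifurcation w' \<and> \<not> (\<exists>c. H.cycle c \<and> w' \<in> H.path_sources c)" if "w' \<in> H.tree v'" for w'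
  proof -
    from that v obtain w where w: "w' = iso_verts h w" "w \<in> tree v"
      by (auto simp: tree_app_iso[OF h vv])
    then have wv: "w \<in> verts G" by (auto simp: tree_def elim: reachable_in_vertsE)
    from w(2) v(2) have nb: "\<not> bifurcation w" and nc: "\<And>c. cycle c \<Longrightarrow> w \<notin> path_sources c"
      by (auto simp: line_points_def)
    have "\<not> H.bifurcation w'"
      using nb w(1) wv out_degree_app_iso_eq[OF h wv] by (simp add: bifurcation_def H.bifurcation_def)
    moreover have False if c: "H.cycle c" "w' \<in> H.path_sources c" for c
    proof -
      have "cycle (map (iso_arcs (inv_iso h)) c)"
        using H.cycle_app_iso[OF h' c(1)] h by simp
      moreover have "path_sources (map (iso_arcs (inv_iso h)) c) = iso_verts (inv_iso h) ` H.path_sources c"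
        using H.path_sources_app_iso[OF h' H.cycle_arcs[OF c(1)]] h by simp
      ultimately show False using nc c(2) w(1) wv h by (metis imageI iso_verts_inv_iso)
    qed
    ultimately show ?thesis by blast
  qed
  then show "v' \<in> H.line_points" using v vv by (simp add: H.line_points_def)
qed

text \<open>Point functors: graph isomorphisms carry the distinguished sets onto each other.\<close>

lemma points_app_iso:
  assumes h: "digraph_isomorphism h"
  shows "pre_digraph.line_points (app_iso h G) = iso_verts h ` line_points"
    and "pre_digraph.cycle_points (app_iso h G) = iso_verts h ` cycle_points"
    and "pre_digraph.extreme_cycle_points (app_iso h G) = iso_verts h ` extreme_cycle_points"
proof -
  interpret H: wf_digraph "app_iso h G" using h ..
  have h': "H.digraph_isomorphism (inv_iso h)" by (rule digraph_isomorphism_invI[OF h])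
  have *: "Y = iso_verts h ` X"
    if "iso_verts h ` X \<subseteq> Y" "iso_verts (inv_iso h) ` Y \<subseteq> X" "Y \<subseteq> verts (app_iso h G)" for X Y
  proof
    show "Y \<subseteq> iso_verts h ` X"
    proof
      fix y assume "y \<in> Y"
      with that h have "iso_verts (inv_iso h) y \<in> X" "y = iso_verts h (iso_verts (inv_iso h) y)"
        by (auto simp del: verts_app_iso)
      then show "y \<in> iso_verts h ` X" by blast
    qed
  qed (fact that(1))
  note inv = app_iso_inv[OF h]
  show "H.line_points = iso_verts h ` line_points"
    using line_points_app_iso_subset[OF h] H.line_points_app_iso_subset[OF h', unfolded inv]
    by (rule *) (auto simp: H.line_points_def)
  show "H.cycle_points = iso_verts h ` cycle_points"
    using points_app_iso_subset(1)[OF h] H.points_app_iso_subset(1)[OF h', unfolded inv]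
    by (rule *) (auto simp: H.cycle_points_def)
  show "H.extreme_cycle_points = iso_verts h ` extreme_cycle_points"
    using points_app_iso_subset(2)[OF h] H.points_app_iso_subset(2)[OF h', unfolded inv]
    by (rule *) (auto simp: H.extreme_cycle_points_def)
qed

lemma pure_infinite_bifurcations_app_iso:
  assumes h: "digraph_isomorphism h"
  shows "pre_digraph.pure_infinite_bifurcations (app_iso h G) = iso_verts h ` pure_infinite_bifurcations"
proof -
  let ?X = "line_points \<union> cycle_points \<union> extreme_cycle_points"
  interpret H: wf_digraph "app_iso h G" using h ..
  have X: "?X \<subseteq> verts G"
    by (auto simp: line_points_def cycle_points_def extreme_cycle_points_def)
  have HX: "H.line_points \<union> H.cycle_points \<union> H.extreme_cycle_points = iso_verts h ` ?X"
    by (simp add: points_app_iso[OF h] image_Un)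
  have reach: "iso_verts h v \<rightarrow>\<^sup>*\<^bsub>app_iso h G\<^esub> iso_verts h x \<longleftrightarrow> v \<rightarrow>\<^sup>* x"
    if "v \<in> verts G" "x \<in> ?X" for v x
    using that X h by (subst reachable_app_iso_eq) auto
  show ?thesis
    unfolding H.pure_infinite_bifurcations_def HX pure_infinite_bifurcations_def verts_app_iso
    using reach by blast
qed

end

end

theory Submission
  imports Defs "Jordan_Normal_Form.Determinant" "HOL-Library.Sublist"
begin

text \<open>
  The vertices with pure infinite bifurcations are those that reach neither a vertex \<open>v\<close> whose tree has no
  bifurcation nor an extreme cycle. Call an element \<open>x\<close> of a ring distinguished if the products
  \<open>x a x\<close> behave as in a domain, or if \<open>x\<close> is a multiple of each of its nonzero products \<open>x a x\<close>.
  Vertices of the first kind are distinguished because their corners embed in \<open>K[x, 1/x]\<close>, vertices on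
  extreme cycles because these generate purely infinite simple ideals. Conversely, a distinguished
  element annihilates every \<open>w\<close> with pure infinite bifurcations: otherwise some vertex \<open>w\<close> of this kind
  would factor through \<open>x\<close>. In the first case a bifurcation below \<open>w\<close> gives two orthogonal
  idempotents. In the second case \<open>w\<close> lies in the ideal of each vertex of its tree; then a cycle below
  \<open>w\<close> would be extreme or without exits, while without cycles the corner at \<open>w\<close> is locally
  matricial and cannot contain a copy of its identity under a proper subprojection. Hence the ideal of
  the vertices with pure infinite bifurcations is the annihilator of the distinguished elements,
  and this set is preserved by every ring isomorphism.
\<close>

section \<open>Linear operators on a free algebra\<close>

text \<open>The ideal is described from outside, through annihilation, because its own vertices show
  no evident corner property, whereas the vertices that they fail to reach do. Distinguished
  elements need not be idempotents, so no correspondence of vertices under the isomorphism is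
  required: a vertex is recovered from \<open>x\<close> as a product \<open>a * x * d\<close>.

  All computations use one normal form. Multiplying by long real paths on the right cancels the
  ghost parts of an element, and multiplying by the ghost of a shortest path on the left leaves
  \<open>k *s V u\<close> with \<open>k\<close> nonzero plus a combination of closed paths of
  positive length at \<open>u\<close>. This remainder is the obstacle. Where bifurcations keep
  occurring below \<open>u\<close>, a further path annihilates it; where there are no bifurcations
  it may persist, and the multiplicativity of \<open>k\<close> has to suffice. That \<open>k\<close>
  is determined by the element at all needs a representation in which degrees are visible. It is
  built relative to a vertex set \<open>W\<close>, so that the same construction also shows that
  certain vertices lie outside a vertex ideal.\<close>

lemma poly_mapping_sum_single: "p = (\<Sum>w\<in>Poly_Mapping.keys p. Poly_Mapping.single w (Poly_Mapping.lookup p w))"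
proof (rule poly_mapping_eqI)
  fix x
  have "Poly_Mapping.lookup (\<Sum>w\<in>Poly_Mapping.keys p. Poly_Mapping.single w (Poly_Mapping.lookup p w)) x
     = (\<Sum>w\<in>Poly_Mapping.keys p. if w = x then Poly_Mapping.lookup p w else 0)"
    unfolding lookup_sum by (intro sum.cong refl) (auto simp: lookup_single when_def)
  then show "Poly_Mapping.lookup p x = Poly_Mapping.lookup (\<Sum>w\<in>Poly_Mapping.keys p. Poly_Mapping.single w (Poly_Mapping.lookup p w)) x"
    by (auto simp: in_keys_iff)
qed

text \<open>The monomial case remembers that \<open>w\<close> is a key of \<open>p\<close>:
  membership in the carrier of a free algebra is a condition on keys, so the induction stays usable
  for elements of a carrier.\<close>

lemma poly_mapping_add_induct [case_names zero single add]:
  fixes p :: "'a \<Rightarrow>\<^sub>0 'b::comm_monoid_add"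
  assumes "P 0" "\<And>w c. w \<in> Poly_Mapping.keys p \<Longrightarrow> P (Poly_Mapping.single w c)" "\<And>p q. P p \<Longrightarrow> P q \<Longrightarrow> P (p + q)"
  shows "P p"
proof -
  have "P (\<Sum>w\<in>S. Poly_Mapping.single w (Poly_Mapping.lookup p w))" if "S \<subseteq> Poly_Mapping.keys p" for S
    using finite_subset[OF that finite_keys] that by (induction S) (auto intro: assms)
  from this[OF order_refl] show ?thesis by (simp only: poly_mapping_sum_single[symmetric])
qed

lemma single_zero_central:
  fixes p :: "'b::monoid_add \<Rightarrow>\<^sub>0 'k::comm_semiring_0"
  shows "p * Poly_Mapping.single 0 c = Poly_Mapping.single 0 c * p"
  by (induction p rule: poly_mapping_add_induct)
    (simp_all add: mult_single mult.commute distrib_left distrib_right)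

lemma single_zero_scale_left:
  fixes p :: "'b::monoid_add \<Rightarrow>\<^sub>0 'k::comm_semiring_0"
  shows "p * (Poly_Mapping.single 0 c * q) = Poly_Mapping.single 0 c * (p * q)"
proof -
  have "p * (Poly_Mapping.single 0 c * q) = p * Poly_Mapping.single 0 c * q" by (simp only: mult.assoc)
  then show ?thesis by (simp only: single_zero_central mult.assoc)
qed

lemma vector_space_free:
  "vector_space (\<lambda>c p. Poly_Mapping.single 0 c * p :: 'b::monoid_add \<Rightarrow>\<^sub>0 'k::field)"
  by standard (simp_all add: distrib_left distrib_right single_add mult_single flip: mult.assoc)

context vector_space
begin

text \<open>A basis of \<open>J\<close> is extended to one of \<open>C\<close>; killing the first
  part gives a linear choice of representatives modulo \<open>J\<close>. This realises the quotient
  inside the original type.\<close>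

lemma projection_along_subspace:
  assumes "subspace J" "J \<subseteq> C" "subspace C"
  obtains \<pi> where "Vector_Spaces.linear scale scale \<pi>" "\<And>x. x \<in> J \<Longrightarrow> \<pi> x = 0"
    "\<And>x. \<pi> x \<in> C" "\<And>x. x \<in> C \<Longrightarrow> \<pi> x - x \<in> J"
proof -
  interpret P: vector_space_pair scale scale by unfold_locales
  obtain B1 where B1: "B1 \<subseteq> J" "independent B1" "J \<subseteq> span B1"
    by (rule maximal_independent_subset)
  have "B1 \<subseteq> C" using B1 assms by blast
  then obtain B2 where B2: "B1 \<subseteq> B2" "B2 \<subseteq> C" "independent B2" "C \<subseteq> span B2"
    by (rule maximal_independent_subset_extend[OF _ B1(2)])
  have sJ: "span B1 = J" using B1 assms(1) by (simp add: span_minimal subset_antisym)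
  have sC: "span B2 = C" using B2 assms(3) by (simp add: span_minimal subset_antisym)
  define f where "f b = (if b \<in> B1 then 0 else b)" for b
  define \<pi> where "\<pi> = P.construct B2 f"
  have lin: "Vector_Spaces.linear scale scale \<pi>"
    unfolding \<pi>_def by (rule P.linear_construct[OF B2(3)])
  interpret l: Vector_Spaces.linear scale scale \<pi> by (fact lin)
  have \<pi>: "\<pi> b = f b" if "b \<in> B2" for b
    unfolding \<pi>_def by (rule P.construct_basis[OF B2(3) that])
  have "\<pi> x = 0" if "x \<in> J" for x
  proof -
    from that have "x \<in> span B1" by (simp add: sJ)
    then show ?thesis
      by (rule l.eq_0_on_span[rotated]) (use B2(1) in \<open>auto simp: \<pi> f_def\<close>)
  qed
  moreover have "\<pi> x \<in> C" for x
  proof -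
    have "\<pi> x \<in> span (f ` B2)" unfolding \<pi>_def by (rule P.construct_in_span[OF B2(3)])
    also have "\<dots> \<subseteq> C"
      using B2(2) assms(3) by (intro span_minimal) (auto simp: f_def subspace_0)
    finally show ?thesis .
  qed
  moreover have "\<pi> x - x \<in> J" if "x \<in> C" for x
  proof -
    from that have "x \<in> span B2" by (simp add: sC)
    then show ?thesis
    proof (induction rule: span_induct_alt)
      case base
      then show ?case using assms(1) by (simp add: subspace_0 l.zero)
    next
      case (step c b y)
      have "\<pi> b - b \<in> J" using \<pi>[OF step(1)] B1(1) assms(1)
        by (auto simp: f_def subspace_0 subspace_neg)
      then have "scale c (\<pi> b - b) + (\<pi> y - y) \<in> J"
        using step assms(1) by (simp add: subspace_add subspace_scale)
      then show ?case by (simp add: l.add l.scale scale_right_diff_distrib algebra_simps)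
    qed
  qed
  ultimately show ?thesis using that lin by blast
qed

end

text \<open>Operators form a ring in the sense of the type class, so elements of a Leavitt path
  algebra can be multiplied without carrier conditions. Linearity over the field, not only
  additivity, is what lets scalars pass through composition from the right factor.\<close>

typedef (overloaded) ('g, 'k) free_op = "{f :: ('g word \<Rightarrow>\<^sub>0 'k::field) \<Rightarrow> ('g word \<Rightarrow>\<^sub>0 'k).
    (\<forall>x y. f (x + y) = f x + f y) \<and> (\<forall>c x. f (Poly_Mapping.single 0 c * x) = Poly_Mapping.single 0 c * f x)}"
  by (intro exI[of _ id]) simp

setup_lifting type_definition_free_op

instantiation free_op :: (type, field) ring
begin

lift_definition zero_free_op :: "('a, 'b) free_op" is "\<lambda>_. 0" by simp
lift_definition plus_free_op :: "('a, 'b) free_op \<Rightarrow> ('a, 'b) free_op \<Rightarrow> ('a, 'b) free_op"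
  is "\<lambda>f g x. f x + g x" by (simp add: algebra_simps)
lift_definition uminus_free_op :: "('a, 'b) free_op \<Rightarrow> ('a, 'b) free_op"
  is "\<lambda>f x. - f x" by simp
lift_definition minus_free_op :: "('a, 'b) free_op \<Rightarrow> ('a, 'b) free_op \<Rightarrow> ('a, 'b) free_op"
  is "\<lambda>f g x. f x - g x" by (simp add: algebra_simps)
lift_definition times_free_op :: "('a, 'b) free_op \<Rightarrow> ('a, 'b) free_op \<Rightarrow> ('a, 'b) free_op"
  is "\<lambda>f g x. f (g x)" by simp

lemmas free_op_simps = Rep_free_op_inject[symmetric] fun_eq_iff zero_free_op.rep_eq plus_free_op.rep_eq
  uminus_free_op.rep_eq minus_free_op.rep_eq times_free_op.rep_eq

instance by standard (use Rep_free_op in \<open>auto simp: free_op_simps algebra_simps\<close>)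

end

lift_definition scale_op :: "'k::field \<Rightarrow> ('g, 'k) free_op \<Rightarrow> ('g, 'k) free_op"
  is "\<lambda>c f x. Poly_Mapping.single 0 c * f x"
  by (simp add: distrib_left) (intro allI single_zero_scale_left)

lemma vector_space_scale_op: "vector_space (scale_op :: 'k::field \<Rightarrow> ('g, 'k) free_op \<Rightarrow> _)"
proof -
  interpret vector_space "\<lambda>c p. Poly_Mapping.single 0 c * p :: 'g word \<Rightarrow>\<^sub>0 'k"
    by (rule vector_space_free)
  show ?thesis
    by standard (simp_all only: free_op_simps scale_op.rep_eq scale_right_distrib scale_left_distrib
      scale_scale scale_one simp_thms)
qed

lemma scale_op_mult_left: "scale_op c x * y = scale_op c (x * y)"
  by (simp only: free_op_simps scale_op.rep_eq simp_thms)

lemma scale_op_mult_right: "x * scale_op c y = scale_op c (x * y)"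
  using Rep_free_op[of x] by (simp only: free_op_simps scale_op.rep_eq mem_Collect_eq simp_thms)

section \<open>Leavitt path algebras as algebras of operators\<close>

text \<open>The interface that replaces cosets by elements of a type-class ring. Since the kernel of
  \<open>cls\<close> is exactly the relator ideal, the image of \<open>cls\<close> is a faithful
  copy of the Leavitt path algebra; every later computation takes place in that image.\<close>

locale leavitt = row_finite_digraph G + vector_space scale
  for G :: "('v, 'e) pre_digraph" and scale :: "'k::field \<Rightarrow> 'r::ring \<Rightarrow> 'r" (infixr \<open>*s\<close> 75) +
  fixes cls :: "('v, 'e, 'k) free_alg \<Rightarrow> 'r"
  assumes scale_mult_left: "c *s x * y = c *s (x * y)"
    and scale_mult_right: "x * c *s y = c *s (x * y)"
    and cls_add: "\<lbrakk>p \<in> carrier (lpa_free G); q \<in> carrier (lpa_free G)\<rbrakk> \<Longrightarrow> cls (p + q) = cls p + cls q"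
    and cls_mult: "\<lbrakk>p \<in> carrier (lpa_free G); q \<in> carrier (lpa_free G)\<rbrakk> \<Longrightarrow> cls (p * q) = cls p * cls q"
    and cls_scale: "p \<in> carrier (lpa_free G) \<Longrightarrow> cls (Poly_Mapping.single 0 c * p) = c *s cls p"
    and cls_eq_0: "p \<in> carrier (lpa_free G) \<Longrightarrow> cls p = 0 \<longleftrightarrow> p \<in> lpa_relator_ideal G"

lemma lpa_relator_ideal_scale:
  "p \<in> lpa_relator_ideal G \<Longrightarrow> Poly_Mapping.single 0 c * p \<in> lpa_relator_ideal G"
  unfolding lpa_relator_ideal_def by blast

text \<open>The regular representation is made faithful by letting the algebra act on its unitization, so
  that no identity in the algebra itself is needed.\<close>

lemma leavitt_ex:
  fixes G :: "('v, 'e) pre_digraph"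
  assumes "row_finite_digraph G"
  shows "\<exists>cls :: ('v, 'e, 'k::field) free_alg \<Rightarrow> (('v, 'e) lpa_gen, 'k) free_op. leavitt G scale_op cls"
proof -
  interpret row_finite_digraph G by fact
  define C where "C = (carrier (lpa_free G) :: ('v, 'e, 'k) free_alg set)"
  define U where "U = {p :: ('v, 'e, 'k) free_alg. \<forall>w\<in>Poly_Mapping.keys p. set (letters w) \<subseteq> lpa_gens G}"
  define J where "J = (lpa_relator_ideal G :: ('v, 'e, 'k) free_alg set)"
  have Jid: "rng_ideal J (lpa_free G)"
    unfolding J_def by (rule rng_ideal_lpa_relator_ideal) unfold_locales
  note Jall = Jid[unfolded rng_ideal_iff_lpa_free, folded C_def]
  have J: "J \<subseteq> C" "0 \<in> J" "\<And>a b. a \<in> J \<Longrightarrow> b \<in> J \<Longrightarrow> a - b \<in> J"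
      "\<And>a x. a \<in> J \<Longrightarrow> x \<in> C \<Longrightarrow> x * a \<in> J" "\<And>a x. a \<in> J \<Longrightarrow> x \<in> C \<Longrightarrow> a * x \<in> J"
    using Jall by simp_all
  have Jadd: "a + b \<in> J" if "a \<in> J" "b \<in> J" for a b
    using J(3)[OF that(1) J(3)[OF J(2) that(2)]] by simp
  have Js: "Poly_Mapping.single 0 c * p \<in> J" if "p \<in> J" for c p
    using that unfolding J_def by (rule lpa_relator_ideal_scale)
  interpret V: vector_space "\<lambda>c p. Poly_Mapping.single 0 c * p :: ('v, 'e, 'k) free_alg"
    by (rule vector_space_free)
  have CU: "C \<subseteq> U" by (auto simp: C_def U_def lpa_free_def)
  have "V.subspace U"
    unfolding V.subspace_def
  proof (intro conjI ballI allI)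
    fix x y c assume x: "x \<in> U" and y: "y \<in> U"
    show "x + y \<in> U" using x y Poly_Mapping.keys_add[of x y] by (auto simp: U_def)
    show "Poly_Mapping.single 0 c * x \<in> U"
      using x keys_mult[of "Poly_Mapping.single 0 c" x] unfolding U_def
      by (fastforce split: if_splits dest: subsetD)
  qed (simp add: U_def)
  moreover have "V.subspace J" unfolding V.subspace_def using J(2) Jadd Js by blast
  ultimately obtain \<pi> where lin: "Vector_Spaces.linear (\<lambda>c p. Poly_Mapping.single 0 c * p) (\<lambda>c p. Poly_Mapping.single 0 c * p) \<pi>"
    and \<pi>J: "\<And>x. x \<in> J \<Longrightarrow> \<pi> x = 0" and \<pi>U: "\<And>x. \<pi> x \<in> U" and \<pi>: "\<And>x. x \<in> U \<Longrightarrow> \<pi> x - x \<in> J"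
    using V.projection_along_subspace[of J U] J(1) CU by blast
  interpret l: Vector_Spaces.linear "\<lambda>c p. Poly_Mapping.single 0 c * p" "\<lambda>c p. Poly_Mapping.single 0 c * p" \<pi> by (fact lin)
  have \<pi>eq: "\<pi> x = \<pi> y" if "x - y \<in> J" for x y using \<pi>J[OF that] by (simp add: l.diff)
  have CUC: "p * z \<in> C" if "p \<in> C" "z \<in> U" for p z
    using that keys_mult[of p z] unfolding C_def U_def lpa_free_def
    by (fastforce simp: plus_word_def dest: subsetD)
  \<comment> \<open>Left multiplication by \<open>p\<close> on the quotient of \<open>U\<close> by
    \<open>J\<close>, transported to the representatives chosen by \<pi>. The inner projection makes
    it defined on the whole free algebra.\<close>
  define op where "op p = Abs_free_op (\<lambda>z. \<pi> (p * \<pi> z))" for p :: "('v, 'e, 'k) free_alg"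
  have Rep: "Rep_free_op (op p) = (\<lambda>z. \<pi> (p * \<pi> z))" for p
  proof -
    have "\<pi> (p * (Poly_Mapping.single 0 c * z)) = Poly_Mapping.single 0 c * \<pi> (p * z)" for c z
      by (simp only: single_zero_scale_left[of p] l.scale)
    then show ?thesis
      unfolding op_def by (intro Abs_free_op_inverse) (simp add: l.add l.scale distrib_left)
  qed
  have "leavitt G scale_op op"
  proof (intro leavitt.intro leavitt_axioms.intro)
    show "row_finite_digraph G" by fact
    show "vector_space scale_op" by (rule vector_space_scale_op)
  next
    fix c and x y :: "(('v, 'e) lpa_gen, 'k) free_op"
    show "scale_op c x * y = scale_op c (x * y)" "x * scale_op c y = scale_op c (x * y)"
      by (rule scale_op_mult_left, rule scale_op_mult_right)
  next
    fix p q :: "('v, 'e, 'k) free_alg" and c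
    assume p: "p \<in> carrier (lpa_free G)"
    then have pC: "p \<in> C" by (simp add: C_def)
    show "op (Poly_Mapping.single 0 c * p) = scale_op c (op p)"
      by (simp add: Rep_free_op_inject[symmetric] scale_op.rep_eq Rep mult.assoc l.scale)
    show "op p = 0 \<longleftrightarrow> p \<in> lpa_relator_ideal G"
    proof
      assume "op p = 0"
      \<comment> \<open>Evaluating at the identity of the unitization gives \<open>p\<close> back
        modulo \<open>J\<close>; this is faithfulness.\<close>
      then have "\<pi> (p * \<pi> 1) = 0" by (metis Rep zero_free_op.rep_eq)
      moreover have "p * \<pi> 1 - p \<in> J"
      proof -
        have "1 \<in> U" by (simp add: U_def zero_word_def)
        from J(4)[OF \<pi>[OF this] pC] show ?thesis by (simp add: right_diff_distrib)
      qed
      ultimately have "\<pi> p = 0" using \<pi>eq by metis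
      then have "- p \<in> J" using \<pi>[of p] pC CU by auto
      then show "p \<in> lpa_relator_ideal G" using J(3)[OF J(2)] unfolding J_def by fastforce
    next
      assume pJ: "p \<in> lpa_relator_ideal G"
      have "p * z \<in> J" if "z \<in> U" for z
      proof (cases "z \<in> C")
        case True
        then show ?thesis using pJ J(5) unfolding J_def by simp
      next
        case False
        \<comment> \<open>\<open>J\<close> absorbs products only with elements of \<open>C\<close>.
          The coefficient of the empty word is split off from \<open>z\<close>; it contributes a
          scalar multiple of \<open>p\<close>, and \<open>J\<close> is closed under scalars.\<close>
        define c0 where "c0 = Poly_Mapping.lookup z 0"
        have "z - Poly_Mapping.single 0 c0 \<in> C"
        proof -
          have k: "w \<in> Poly_Mapping.keys z \<and> w \<noteq> 0" if "w \<in> Poly_Mapping.keys (z - Poly_Mapping.single 0 c0)" for w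
            using that by (auto simp: in_keys_iff lookup_minus lookup_single c0_def when_def split: if_splits)
          have "letters w \<noteq> []" if "w \<noteq> 0" for w :: "('v, 'e) lpa_gen word"
            using that by (cases w) (auto simp: zero_word_def)
          with k \<open>z \<in> U\<close> show ?thesis by (auto simp: C_def U_def lpa_free_def)
        qed
        then have "p * (z - Poly_Mapping.single 0 c0) \<in> J"
          using pJ J(5) unfolding J_def by simp
        from Jadd[OF this Js[of p c0]] pJ show ?thesis
          by (simp add: J_def right_diff_distrib single_zero_central)
      qed
      then have "\<pi> (p * \<pi> z) = 0" for z using \<pi>J \<pi>U by blast
      then show "op p = 0"
        by (simp add: Rep_free_op_inject[symmetric] zero_free_op.rep_eq Rep)
    qed
    assume q: "q \<in> carrier (lpa_free G)"
    show "op (p + q) = op p + op q"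
      by (simp add: Rep_free_op_inject[symmetric] plus_free_op.rep_eq Rep distrib_right l.add)
    show "op (p * q) = op p * op q"
    proof -
      \<comment> \<open>The inner projections change an element of \<open>U\<close> only by an
        element of \<open>J\<close>, and multiplication by \<open>p\<close> on the left preserves
        \<open>J\<close>.\<close>
      have "\<pi> (p * (q * \<pi> z)) = \<pi> (p * \<pi> (\<pi> (q * \<pi> z)))" for z
      proof (rule \<pi>eq)
        have "q * \<pi> z \<in> U" using CUC[of q "\<pi> z"] q CU \<pi>U unfolding C_def by blast
        from Jadd[OF \<pi>[OF \<pi>U[of "q * \<pi> z"]] \<pi>[OF this]]
        have "\<pi> (\<pi> (q * \<pi> z)) - q * \<pi> z \<in> J" by simp
        from J(3)[OF J(2) this] have "q * \<pi> z - \<pi> (\<pi> (q * \<pi> z)) \<in> J" by simp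
        from J(4)[OF this pC] show "p * (q * \<pi> z) - p * \<pi> (\<pi> (q * \<pi> z)) \<in> J" by (simp add: right_diff_distrib)
      qed
      then show ?thesis
        by (simp add: Rep_free_op_inject[symmetric] times_free_op.rep_eq Rep mult.assoc)
    qed
  qed
  then show ?thesis by blast
qed

section \<open>Graded branching representations\<close>

text \<open>Read for the complement of \<open>W\<close>, the last two conditions say that it is
  hereditary and saturated. So its vertices can act as zero without violating the relations at the
  vertices of \<open>W\<close>.\<close>

locale branching = row_finite_digraph G for G :: "('v, 'e) pre_digraph" +
  fixes W :: "'v set"
  assumes W_verts: "W \<subseteq> verts G"
    and W_tail: "\<lbrakk>e \<in> arcs G; head G e \<in> W\<rbrakk> \<Longrightarrow> tail G e \<in> W"
    and W_out: "\<lbrakk>y \<in> W; out_arcs G y \<noteq> {}\<rbrakk> \<Longrightarrow> \<exists>e\<in>out_arcs G y. head G e \<in> W"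
begin

definition W_arcs :: "'v \<Rightarrow> 'e set" where
  "W_arcs y = {e \<in> out_arcs G y. head G e \<in> W}"

definition idx :: "'v \<Rightarrow> 'e \<Rightarrow> nat" where
  "idx y = (SOME h. bij_betw h (W_arcs y) {..<card (W_arcs y)})"

lemma W_arcs_D: "e \<in> W_arcs y \<Longrightarrow> e \<in> arcs G \<and> tail G e = y \<and> head G e \<in> W \<and> y \<in> W \<and> y \<in> verts G"
  using W_tail W_verts by (auto simp: W_arcs_def)

lemma W_arcs_I: "e \<in> arcs G \<Longrightarrow> head G e \<in> W \<Longrightarrow> e \<in> W_arcs (tail G e)"
  by (auto simp: W_arcs_def)

lemma finite_W_arcs: "finite (W_arcs y)"
proof (cases "y \<in> verts G")
  case True
  then show ?thesis unfolding W_arcs_def by (intro finite_subset[OF _ row_finite]) auto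
qed (use W_arcs_D in \<open>force intro: finite_subset[of _ "{}"]\<close>)

lemma bij_idx: "bij_betw (idx y) (W_arcs y) {..<card (W_arcs y)}"
  using ex_bij_betw_finite_nat[OF finite_W_arcs[of y]] unfolding idx_def atLeast0LessThan by (rule someI_ex)

lemma idx_less: "e \<in> W_arcs y \<Longrightarrow> idx y e < card (W_arcs y)"
  using bij_idx by (auto dest: bij_betwE)

lemma idx_inj: "e \<in> W_arcs y \<Longrightarrow> e' \<in> W_arcs y \<Longrightarrow> idx y e = idx y e' \<longleftrightarrow> e = e'"
  using bij_idx[of y] by (auto simp: bij_betw_def inj_on_def)

lemma idx_surj: "i < card (W_arcs y) \<Longrightarrow> \<exists>e\<in>W_arcs y. idx y e = i"
  using bij_betw_imp_surj_on[OF bij_idx[of y]] by (metis imageE lessThan_iff)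

text \<open>A point \<open>(y, m, d)\<close> stands for an infinite path from \<open>y\<close> in degree \<open>d\<close>: its first arc is read off
  from \<open>m\<close> modulo the out-degree of \<open>y\<close>, and the quotient encodes the rest of the path.\<close>

primrec gen_act :: "('v, 'e) lpa_gen \<Rightarrow> ('v \<times> nat \<times> int \<Rightarrow> 'k::field) \<Rightarrow> 'v \<times> nat \<times> int \<Rightarrow> 'k" where
  "gen_act (Vertex v) g = (\<lambda>(y, m, d). if y = v \<and> v \<in> W then g (y, m, d) else 0)"
| "gen_act (Edge e) g = (\<lambda>(y, m, d). if e \<in> W_arcs y \<and> idx y e = m mod card (W_arcs y)
     then g (head G e, m div card (W_arcs y), d + 1) else 0)"
| "gen_act (Ghost e) g = (\<lambda>(y, m, d). if e \<in> arcs G \<and> y = head G e \<and> y \<in> W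
     then g (tail G e, m * card (W_arcs (tail G e)) + idx (tail G e) e, d - 1) else 0)"

definition word_act :: "('v, 'e) lpa_gen word \<Rightarrow> ('v \<times> nat \<times> int \<Rightarrow> 'k::field) \<Rightarrow> 'v \<times> nat \<times> int \<Rightarrow> 'k" where
  "word_act w g = foldr gen_act (letters w) g"

definition act :: "('v, 'e, 'k::field) free_alg \<Rightarrow> ('v \<times> nat \<times> int \<Rightarrow> 'k) \<Rightarrow> 'v \<times> nat \<times> int \<Rightarrow> 'k" where
  "act p g x = (\<Sum>w\<in>Poly_Mapping.keys p. Poly_Mapping.lookup p w * word_act w g x)"

lemma gen_act_linear: "gen_act a (\<lambda>x. c * g x + h x) = (\<lambda>x. c * gen_act a g x + gen_act a h x)"
  by (cases a) (auto simp: fun_eq_iff)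

lemma gen_act_zero: "gen_act a (\<lambda>x. 0) = (\<lambda>x. 0)"
  by (cases a) (auto simp: fun_eq_iff)

lemma word_act_linear: "word_act w (\<lambda>x. c * g x + h x) = (\<lambda>x. c * word_act w g x + word_act w h x)"
proof -
  have "foldr gen_act l (\<lambda>x. c * g x + h x) = (\<lambda>x. c * foldr gen_act l g x + foldr gen_act l h x)" for l
    by (induction l) (simp_all add: gen_act_linear)
  then show ?thesis by (simp add: word_act_def)
qed

lemma word_act_zero: "word_act w (\<lambda>x. 0) = (\<lambda>x. 0)"
proof -
  have "foldr gen_act l (\<lambda>x. 0) = (\<lambda>x. 0)" for l
    by (induction l) (simp_all add: gen_act_zero)
  then show ?thesis by (simp add: word_act_def)
qed

lemma word_act_plus: "word_act (u + w) g = word_act u (word_act w g)"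
  by (simp add: word_act_def plus_word_def)

lemma act_superset:
  assumes "finite S" "Poly_Mapping.keys p \<subseteq> S"
  shows "act p g x = (\<Sum>w\<in>S. Poly_Mapping.lookup p w * word_act w g x)"
  unfolding act_def using assms by (intro sum.mono_neutral_left) (auto simp: in_keys_iff)

lemma act_add: "act (p + q) g = (\<lambda>x. act p g x + act q g x)"
proof
  fix x
  let ?S = "Poly_Mapping.keys p \<union> Poly_Mapping.keys q"
  have "act (p + q) g x = (\<Sum>w\<in>?S. Poly_Mapping.lookup (p + q) w * word_act w g x)"
    using Poly_Mapping.keys_add[of p q] by (intro act_superset) auto
  also have "\<dots> = act p g x + act q g x"
    by (simp add: act_superset[of ?S] lookup_add distrib_right sum.distrib)
  finally show "act (p + q) g x = act p g x + act q g x" .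
qed

lemma act_zero: "act 0 g = (\<lambda>x. 0)"
  by (simp add: act_def fun_eq_iff)

lemma act_single: "act (Poly_Mapping.single w c) g = (\<lambda>x. c * word_act w g x)"
  by (simp add: act_def fun_eq_iff)

lemma act_mult: "act (p * q) g = act p (act q g)"
proof (induction p rule: poly_mapping_add_induct)
  case (single u a)
  show ?case
  proof (induction q rule: poly_mapping_add_induct)
    case zero
    show ?case by (simp add: act_zero act_single word_act_zero)
  next
    case (single w b)
    have "word_act u (\<lambda>x. b * word_act w g x) = (\<lambda>x. b * word_act u (word_act w g) x)"
      using word_act_linear[of u b "word_act w g" "\<lambda>_. 0"] by (simp add: word_act_zero)
    then show ?case
      by (simp add: mult_single act_single word_act_plus mult.assoc)
  next
    case (add q r)
    have "word_act u (\<lambda>x. act q g x + act r g x) = (\<lambda>x. word_act u (act q g) x + word_act u (act r g) x)"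
      using word_act_linear[of u 1 "act q g" "act r g"] by simp
    with add show ?case
      by (simp add: distrib_left act_add act_single)
  qed
next
  case (add p q)
  then show ?case by (simp add: distrib_right act_add)
qed (simp add: act_zero)

lemma act_uminus: "act (- p) g = (\<lambda>x. - act p g x)"
proof
  fix x
  have "act (p + - p) g x = act p g x + act (- p) g x" by (simp only: act_add)
  then have "act p g x + act (- p) g x = 0" by (simp add: act_zero)
  then show "act (- p) g x = - act p g x" by (simp add: eq_neg_iff_add_eq_0 add.commute)
qed

lemma act_diff: "act (p - q) g = (\<lambda>x. act p g x - act q g x)"
proof -
  have "act (p - q) g = act (p + - q) g" by simp
  then show ?thesis by (simp only: act_add act_uminus) simp
qed

lemma act_sum: "act (\<Sum>i\<in>S. p i) g = (\<lambda>x. \<Sum>i\<in>S. act (p i) g x)"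
  by (induction S rule: infinite_finite_induct) (simp_all add: act_zero act_add)

lemma act_monomial: "act (monomial a) g = gen_act a g"
  by (simp add: act_single word_act_def)

definition act_kernel :: "('v, 'e, 'k::field) free_alg set" where
  "act_kernel = {p \<in> carrier (lpa_free G). \<forall>g. act p g = (\<lambda>x. 0)}"

text \<open>The two relations of substance are division with remainder. For \<open>CK1\<close>,
  prepending the digit \<open>idx\<close> of an arc and then reading it off are inverse, because the
  digit is smaller than the divisor. For \<open>CK2\<close>, each \<open>m\<close> has exactly one
  first digit, so exactly one arc contributes to the sum; \<open>W_out\<close> makes the divisor
  positive.\<close>

lemma act_relators:
  fixes g :: "'v \<times> nat \<times> int \<Rightarrow> 'k::field"
  assumes "p \<in> lpa_relators G"
  shows "act p g = (\<lambda>x. 0)"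
  using assms
proof cases
  case (vertices v w)
  have "gen_act (Vertex v) (gen_act (Vertex w) g) = (if v = w then gen_act (Vertex v) g else (\<lambda>_. 0))"
    by (auto simp: fun_eq_iff)
  then show ?thesis by (simp add: vertices act_diff act_mult act_monomial act_zero)
next
  case (source_edge e)
  have "gen_act (Vertex (tail G e)) (gen_act (Edge e) g) = gen_act (Edge e) g"
    by (auto simp: fun_eq_iff dest: W_arcs_D)
  then show ?thesis by (simp add: source_edge act_diff act_mult act_monomial)
next
  case (edge_range e)
  have "gen_act (Edge e) (gen_act (Vertex (head G e)) g) = gen_act (Edge e) g"
    by (auto simp: fun_eq_iff dest: W_arcs_D)
  then show ?thesis by (simp add: edge_range act_diff act_mult act_monomial)
next
  case (range_ghost e)
  have "gen_act (Vertex (head G e)) (gen_act (Ghost e) g) = gen_act (Ghost e) g"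
    by (auto simp: fun_eq_iff)
  then show ?thesis by (simp add: range_ghost act_diff act_mult act_monomial)
next
  case (ghost_source e)
  have "gen_act (Ghost e) (gen_act (Vertex (tail G e)) g) = gen_act (Ghost e) g"
    using W_tail by (auto simp: fun_eq_iff)
  then show ?thesis by (simp add: ghost_source act_diff act_mult act_monomial)
next
  case (CK1 e f)
  have "gen_act (Ghost e) (gen_act (Edge f) g) (y, m, d) = (if e = f then gen_act (Vertex (head G e)) g (y, m, d) else 0)"
    for y m d
  proof (cases "y = head G e \<and> y \<in> W")
    case True
    then have e: "e \<in> W_arcs (tail G e)" using W_arcs_I CK1(2) by blast
    let ?D = "card (W_arcs (tail G e))"
    have "idx (tail G e) e < ?D" by (rule idx_less[OF e])
    then have dm: "(m * ?D + idx (tail G e) e) mod ?D = idx (tail G e) e" "(m * ?D + idx (tail G e) e) div ?D = m"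
      by simp_all
    have "gen_act (Edge f) g (tail G e, m * ?D + idx (tail G e) e, d - 1) = (if e = f then g (head G e, m, d) else 0)"
    proof (cases "e = f")
      case True
      then show ?thesis using e dm by simp
    next
      case False
      then show ?thesis using idx_inj[OF e, of f] unfolding gen_act.simps prod.case dm by metis
    qed
    moreover have "gen_act (Ghost e) h (y, m, d) = h (tail G e, m * ?D + idx (tail G e) e, d - 1)"
      for h :: "_ \<Rightarrow> 'k" using True CK1(2) by auto
    moreover have "gen_act (Vertex (head G e)) g (y, m, d) = g (head G e, m, d)" using True by auto
    ultimately show ?thesis by (simp only: if_cancel)
  next
    case False
    then have "gen_act (Ghost e) h (y, m, d) = 0" for h :: "_ \<Rightarrow> 'k" by auto
    moreover have "gen_act (Vertex (head G e)) g (y, m, d) = 0" using False by auto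
    ultimately show ?thesis by (simp only: if_cancel)
  qed
  then have "gen_act (Ghost e) (gen_act (Edge f) g) = (if e = f then gen_act (Vertex (head G e)) g else (\<lambda>_. 0))"
    by (intro ext) (simp only: split_paired_all if_distrib[of "\<lambda>h. h _"])
  then show ?thesis by (simp add: CK1(1) act_diff act_mult act_monomial act_zero del: gen_act.simps)
next
  case (CK2 v)
  have "gen_act (Vertex v) g (y, m, d) = (\<Sum>e\<in>out_arcs G v. gen_act (Edge e) (gen_act (Ghost e) g) (y, m, d))" for y m d
  proof (cases "y = v \<and> v \<in> W")
    case True
    then have "W_arcs v \<noteq> {}" using W_out[of v] CK2 by (auto simp: W_arcs_def)
    then have D: "card (W_arcs v) > 0" using finite_W_arcs by (simp add: card_gt_0_iff)
    then obtain e where e: "e \<in> W_arcs v" "idx v e = m mod card (W_arcs v)"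
      using idx_surj[of "m mod card (W_arcs v)" v] by auto
    have "(\<Sum>e\<in>out_arcs G v. gen_act (Edge e) (gen_act (Ghost e) g) (y, m, d))
       = (\<Sum>e'\<in>out_arcs G v. if e' = e then g (y, m, d) else 0)"
    proof (intro sum.cong refl)
      fix e' assume "e' \<in> out_arcs G v"
      show "gen_act (Edge e') (gen_act (Ghost e') g) (y, m, d) = (if e' = e then g (y, m, d) else 0)"
        using True e W_arcs_D[OF e(1)] idx_inj[OF e(1), of e']
        by (auto simp: W_arcs_D mult.commute[of "m div _"])
    qed
    also have "\<dots> = g (y, m, d)"
      using e CK2 by (simp add: W_arcs_def)
    finally show ?thesis using True by simp
  next
    case False
    then have "gen_act (Edge e) (gen_act (Ghost e) g) (y, m, d) = 0" if "e \<in> out_arcs G v" for e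
      using that W_arcs_D[of e y] by auto
    then show ?thesis using False by auto
  qed
  then have "gen_act (Vertex v) g = (\<lambda>x. \<Sum>e\<in>out_arcs G v. gen_act (Edge e) (gen_act (Ghost e) g) x)"
    by (auto simp: fun_eq_iff simp del: gen_act.simps)
  then show ?thesis by (simp only: CK2(1) act_diff act_sum act_mult act_monomial) simp
qed

lemma relator_ideal_le_act_kernel: "lpa_relator_ideal G \<subseteq> (act_kernel :: ('v, 'e, 'k::field) free_alg set)"
proof -
  have rel: "lpa_relators G \<subseteq> (act_kernel :: ('v, 'e, 'k) free_alg set)"
    using lpa_relators_subset[OF wf_digraph_axioms] act_relators by (auto simp: act_kernel_def)
  have "rng_ideal (act_kernel :: ('v, 'e, 'k) free_alg set) (lpa_free G)"
    unfolding rng_ideal_iff_lpa_free act_kernel_def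
  proof (intro conjI ballI subsetI)
    fix a x :: "('v, 'e, 'k) free_alg"
    assume a: "a \<in> {p \<in> carrier (lpa_free G). \<forall>g. act p g = (\<lambda>x. 0)}" and x: "x \<in> carrier (lpa_free G)"
    have "act x (\<lambda>_. 0) = (\<lambda>_. 0)" by (simp add: act_def word_act_zero fun_eq_iff)
    then show "x * a \<in> {p \<in> carrier (lpa_free G). \<forall>g. act p g = (\<lambda>x. 0)}"
      "a * x \<in> {p \<in> carrier (lpa_free G). \<forall>g. act p g = (\<lambda>x. 0)}"
      using a x by (simp_all add: carrier_lpa_free_closed act_mult)
  qed (auto simp: carrier_lpa_free_closed act_diff act_zero, simp add: lpa_free_def)
  moreover have "Poly_Mapping.single 0 c * p \<in> act_kernel" if "p \<in> act_kernel" for c and p :: "('v, 'e, 'k) free_alg"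
    using that by (simp add: act_kernel_def carrier_lpa_free_scale act_mult act_single word_act_zero)
  ultimately show ?thesis using rel unfolding lpa_relator_ideal_def by blast
qed

end

section \<open>Paths, ghost paths, spanning monomials and local units\<close>

context leavitt
begin

definition V :: "'v \<Rightarrow> 'r" where "V v = cls (monomial (Vertex v))"
definition X :: "'e \<Rightarrow> 'r" where "X e = cls (monomial (Edge e))"
definition Y :: "'e \<Rightarrow> 'r" where "Y e = cls (monomial (Ghost e))"
definition L :: "'r set" where "L = cls ` carrier (lpa_free G)"

lemma gen_carrier [simp]:
  "v \<in> verts G \<Longrightarrow> monomial (Vertex v) \<in> (carrier (lpa_free G) :: ('v, 'e, 'k) free_alg set)"
  "e \<in> arcs G \<Longrightarrow> monomial (Edge e) \<in> (carrier (lpa_free G) :: ('v, 'e, 'k) free_alg set)"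
  "e \<in> arcs G \<Longrightarrow> monomial (Ghost e) \<in> (carrier (lpa_free G) :: ('v, 'e, 'k) free_alg set)"
  by (rule monomial_carrier, simp add: lpa_gens_def)+

lemma zero_carrier [simp]: "0 \<in> (carrier (lpa_free G) :: ('v, 'e, 'k) free_alg set)"
  by (simp add: lpa_free_def)

lemma cls_zero: "cls 0 = 0"
  using cls_add[OF zero_carrier zero_carrier] by simp

lemma cls_diff: "\<lbrakk>p \<in> carrier (lpa_free G); q \<in> carrier (lpa_free G)\<rbrakk> \<Longrightarrow> cls (p - q) = cls p - cls q"
  using cls_add[of "p - q" q] carrier_lpa_free_closed(2)[of p G q] by (simp add: algebra_simps)

lemma cls_sum: "finite S \<Longrightarrow> (\<And>i. i \<in> S \<Longrightarrow> p i \<in> carrier (lpa_free G)) \<Longrightarrow>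
    (\<Sum>i\<in>S. p i) \<in> carrier (lpa_free G) \<and> cls (\<Sum>i\<in>S. p i) = (\<Sum>i\<in>S. cls (p i))"
  by (induction S rule: finite_induct) (simp_all add: zero_carrier cls_zero cls_add carrier_lpa_free_closed)

lemma cls_eq_iff:
  "\<lbrakk>p \<in> carrier (lpa_free G); q \<in> carrier (lpa_free G)\<rbrakk> \<Longrightarrow> cls p = cls q \<longleftrightarrow> p - q \<in> lpa_relator_ideal G"
  using cls_eq_0[of "p - q"] cls_diff[of p q] carrier_lpa_free_closed(2)[of p G q] by simp

lemma cls_relator:
  assumes "p - q \<in> lpa_relators G" "p \<in> carrier (lpa_free G)" "q \<in> carrier (lpa_free G)"
  shows "cls p = cls q"
  using rng_ideal_lpa_relator_ideal(2)[OF wf_digraph_axioms] assms cls_eq_iff by blast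

lemma subspace_L: "subspace L"
  unfolding subspace_def L_def
proof (intro conjI ballI allI)
  show "0 \<in> cls ` carrier (lpa_free G)" using cls_zero zero_carrier by (metis imageI)
  fix x y c assume "x \<in> cls ` carrier (lpa_free G)"
  then obtain p where p: "p \<in> carrier (lpa_free G)" "x = cls p" by blast
  then show "c *s x \<in> cls ` carrier (lpa_free G)"
    using cls_scale[OF p(1), of c] carrier_lpa_free_scale(2)[OF p(1), of c] by (metis imageI)
  assume "y \<in> cls ` carrier (lpa_free G)"
  then obtain q where q: "q \<in> carrier (lpa_free G)" "y = cls q" by blast
  show "x + y \<in> cls ` carrier (lpa_free G)"
    using cls_add[OF p(1) q(1)] carrier_lpa_free_closed(1)[OF p(1) q(1)] p q by (metis imageI)
qed

lemma L_mult [simp]: "x \<in> L \<Longrightarrow> y \<in> L \<Longrightarrow> x * y \<in> L"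
  unfolding L_def by (auto simp: cls_mult[symmetric] intro!: imageI carrier_lpa_free_closed)

lemma L_0 [simp]: "0 \<in> L" by (rule subspace_0[OF subspace_L])
lemma L_add [simp]: "x \<in> L \<Longrightarrow> y \<in> L \<Longrightarrow> x + y \<in> L" by (rule subspace_add[OF subspace_L])
lemma L_diff [simp]: "x \<in> L \<Longrightarrow> y \<in> L \<Longrightarrow> x - y \<in> L" by (rule subspace_diff[OF subspace_L])
lemma L_scale [simp]: "x \<in> L \<Longrightarrow> c *s x \<in> L" by (rule subspace_scale[OF subspace_L])
lemma gens_L [simp]:
  "v \<in> verts G \<Longrightarrow> V v \<in> L" "e \<in> arcs G \<Longrightarrow> X e \<in> L" "e \<in> arcs G \<Longrightarrow> Y e \<in> L"
  unfolding V_def X_def Y_def L_def using gen_carrier by blast+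

lemma V_V: "v \<in> verts G \<Longrightarrow> w \<in> verts G \<Longrightarrow> V v * V w = (if v = w then V v else 0)"
  using cls_relator[OF lpa_relators.vertices[of v G w]]
  by (cases "v = w") (simp_all add: V_def cls_mult[symmetric] cls_zero carrier_lpa_free_closed)

lemma V_X: "e \<in> arcs G \<Longrightarrow> V (tail G e) * X e = X e"
  using cls_relator[OF lpa_relators.source_edge[of e]]
  by (simp add: V_def X_def cls_mult[symmetric] carrier_lpa_free_closed)

lemma X_V: "e \<in> arcs G \<Longrightarrow> X e * V (head G e) = X e"
  using cls_relator[OF lpa_relators.edge_range[of e]]
  by (simp add: V_def X_def cls_mult[symmetric] carrier_lpa_free_closed)

lemma V_Y: "e \<in> arcs G \<Longrightarrow> V (head G e) * Y e = Y e"
  using cls_relator[OF lpa_relators.range_ghost[of e]]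
  by (simp add: V_def Y_def cls_mult[symmetric] carrier_lpa_free_closed)

lemma Y_V: "e \<in> arcs G \<Longrightarrow> Y e * V (tail G e) = Y e"
  using cls_relator[OF lpa_relators.ghost_source[of e]]
  by (simp add: V_def Y_def cls_mult[symmetric] carrier_lpa_free_closed)

lemma Y_X: "e \<in> arcs G \<Longrightarrow> f \<in> arcs G \<Longrightarrow> Y e * X f = (if e = f then V (head G e) else 0)"
  using cls_relator[OF lpa_relators.CK1[of e G f]]
  by (cases "e = f") (simp_all add: V_def X_def Y_def cls_mult[symmetric] cls_zero carrier_lpa_free_closed)

lemma CK2:
  assumes "v \<in> verts G" "out_arcs G v \<noteq> {}"
  shows "V v = (\<Sum>e\<in>out_arcs G v. X e * Y e)"
proof -
  have C: "monomial (Edge e) * monomial (Ghost e) \<in> (carrier (lpa_free G) :: ('v, 'e, 'k) free_alg set)"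
    if "e \<in> out_arcs G v" for e
    using that by (simp add: carrier_lpa_free_closed)
  note S = cls_sum[OF row_finite[OF assms(1)] C]
  have "cls (monomial (Vertex v)) = cls (\<Sum>e\<in>out_arcs G v. monomial (Edge e) * monomial (Ghost e))"
    using S assms row_finite by (intro cls_relator lpa_relators.CK2) simp_all
  also have "\<dots> = (\<Sum>e\<in>out_arcs G v. X e * Y e)"
    using S by (simp add: X_def Y_def cls_mult)
  finally show ?thesis by (simp add: V_def)
qed

text \<open>\<open>rp u p\<close> is the real path and \<open>gp u p\<close> its adjoint, whence the
  reversed order of factors. The start vertex is an argument because an empty list of arcs does not
  determine it.\<close>

primrec rp :: "'v \<Rightarrow> 'e list \<Rightarrow> 'r" where
  "rp u [] = V u"
| "rp u (e # p) = X e * rp (head G e) p"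

primrec gp :: "'v \<Rightarrow> 'e list \<Rightarrow> 'r" where
  "gp u [] = V u"
| "gp u (e # p) = gp (head G e) p * Y e"

lemma rp_L [simp]: "awalk u p v \<Longrightarrow> rp u p \<in> L"
  by (induction p arbitrary: u) (auto simp: awalk_Nil_iff awalk_Cons_iff)

lemma gp_L [simp]: "awalk u p v \<Longrightarrow> gp u p \<in> L"
  by (induction p arbitrary: u) (auto simp: awalk_Nil_iff awalk_Cons_iff)

lemma V_rp_same: "awalk u p v \<Longrightarrow> V u * rp u p = rp u p"
  by (cases p) (auto simp: awalk_Nil_iff awalk_Cons_iff V_V V_X simp flip: mult.assoc)

lemma gp_V_same: "awalk u p v \<Longrightarrow> gp u p * V u = gp u p"
  by (cases p) (auto simp: awalk_Nil_iff awalk_Cons_iff V_V Y_V mult.assoc)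

lemma rp_V_same: "awalk u p v \<Longrightarrow> rp u p * V v = rp u p"
  by (induction p arbitrary: u) (auto simp: awalk_Nil_iff awalk_Cons_iff V_V mult.assoc)

lemma V_gp_same: "awalk u p v \<Longrightarrow> V v * gp u p = gp u p"
  by (induction p arbitrary: u) (auto simp: awalk_Nil_iff awalk_Cons_iff V_V simp flip: mult.assoc)

lemma V_rp: "awalk u p v \<Longrightarrow> w \<in> verts G \<Longrightarrow> V w * rp u p = (if w = u then rp u p else 0)"
  using V_V[of w u] awalk_hd_in_verts[of u p v] V_rp_same[of u p v] by (metis mult.assoc mult_zero_left)

lemma gp_V: "awalk u p v \<Longrightarrow> w \<in> verts G \<Longrightarrow> gp u p * V w = (if w = u then gp u p else 0)"
  using V_V[of u w] awalk_hd_in_verts[of u p v] gp_V_same[of u p v] by (metis mult.assoc mult_zero_right)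

lemma rp_append: "awalk u p v \<Longrightarrow> awalk v q w \<Longrightarrow> rp u (p @ q) = rp u p * rp v q"
  by (induction p arbitrary: u) (auto simp: awalk_Nil_iff awalk_Cons_iff V_rp_same mult.assoc)

lemma gp_append: "awalk u p v \<Longrightarrow> awalk v q w \<Longrightarrow> gp u (p @ q) = gp v q * gp u p"
  by (induction p arbitrary: u) (auto simp: awalk_Nil_iff awalk_Cons_iff gp_V_same mult.assoc)

lemma gp_rp: "awalk u p v \<Longrightarrow> gp u p * rp u p = V v"
proof (induction p arbitrary: u)
  case (Cons e p)
  then have e: "e \<in> arcs G" "awalk (head G e) p v" by (auto simp: awalk_Cons_iff)
  have "gp u (e # p) * rp u (e # p) = gp (head G e) p * (Y e * X e) * rp (head G e) p"
    by (simp add: mult.assoc)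
  also have "\<dots> = V v"
    using e Cons.IH[OF e(2)] by (simp add: Y_X gp_V_same)
  finally show ?case .
qed (simp add: awalk_Nil_iff V_V)

lemma gp_rp_append: "awalk u p v \<Longrightarrow> awalk v q w \<Longrightarrow> gp u p * rp u (p @ q) = rp v q"
  by (simp add: rp_append gp_rp V_rp_same flip: mult.assoc)

lemma gp_append_rp: "awalk u p v \<Longrightarrow> awalk v q w \<Longrightarrow> gp u (p @ q) * rp u p = gp v q"
  by (simp add: gp_append gp_rp gp_V_same mult.assoc)

text \<open>A common initial segment cancels, and at the first place where the paths differ
  \<open>Y_X\<close> gives zero.\<close>

lemma gp_rp_parallel:
  "awalk u p v \<Longrightarrow> awalk u q w \<Longrightarrow> p \<parallel> q \<Longrightarrow> gp u p * rp u q = 0"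
proof (induction p arbitrary: u q)
  case (Cons e p)
  then obtain f q' where q: "q = f # q'" by (cases q) auto
  have e: "e \<in> arcs G" "awalk (head G e) p v" "f \<in> arcs G" "awalk (head G f) q' w"
    using Cons.prems q by (auto simp: awalk_Cons_iff)
  have eq: "gp u (e # p) * rp u q = gp (head G e) p * (Y e * X f) * rp (head G f) q'"
    by (simp add: mult.assoc q)
  show ?case
  proof (cases "e = f")
    case True
    then have "p \<parallel> q'" using Cons.prems(3) q by (auto simp: parallel_def)
    then show ?thesis using True e Cons.IH[OF e(2) _ \<open>p \<parallel> q'\<close>] eq by (simp add: Y_X gp_V_same)
  qed (use eq e in \<open>simp add: Y_X\<close>)
qed auto

lemma gp_rp_neq: "awalk u p v \<Longrightarrow> awalk u' q v' \<Longrightarrow> u \<noteq> u' \<Longrightarrow> gp u p * rp u' q = 0"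
proof -
  assume aw: "awalk u p v" "awalk u' q v'" "u \<noteq> u'"
  have "gp u p * rp u' q = gp u p * V u' * rp u' q" by (simp add: mult.assoc V_rp_same[OF aw(2)])
  also have "gp u p * V u' = 0" using gp_V[OF aw(1)] aw(3) awalk_hd_in_verts[OF aw(2)] by simp
  finally show ?thesis by simp
qed

definition monomials :: "'r set" where
  "monomials = {rp u p * gp u' q | u p u' q v. awalk u p v \<and> awalk u' q v}"

text \<open>The case with content is a ghost arc: it cancels or annihilates the first arc of the
  real part, and if the real part is empty it lengthens the ghost part. Hence words never leave the
  form real path times ghost path.\<close>

lemma gen_monomial:
  assumes "a \<in> lpa_gens G" "m \<in> insert 0 monomials"
  shows "cls (monomial a) * m \<in> insert 0 monomials"
proof (cases "m = 0")
  case False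
  then obtain u p u' q v where m: "m = rp u p * gp u' q" and w: "awalk u p v" "awalk u' q v"
    using assms(2) by (auto simp: monomials_def)
  consider (V) v where "a = Vertex v" "v \<in> verts G" | (X) e where "a = Edge e" "e \<in> arcs G"
    | (Y) e where "a = Ghost e" "e \<in> arcs G"
    using assms(1) by (auto simp: lpa_gens_def)
  then show ?thesis
  proof cases
    case V
    have "V v * m = (if v = u then m else 0)" if "v \<in> verts G" for v
      using V_rp[OF w(1) that] by (simp add: m flip: mult.assoc)
    then show ?thesis using V assms(2) by (auto simp flip: V_def)
  next
    case X
    show ?thesis
    proof (cases "head G e = u")
      case True
      then have "X e * m = rp (tail G e) (e # p) * gp u' q" and "awalk (tail G e) (e # p) v"
        using X w by (auto simp: m mult.assoc awalk_Cons_iff)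
      then have "X e * m \<in> monomials" using w unfolding monomials_def by blast
      then show ?thesis using X by (simp flip: X_def)
    next
      case False
      then have "V (head G e) * rp u p = 0" using V_rp[OF w(1), of "head G e"] X by simp
      moreover have "X e * m = X e * V (head G e) * (rp u p * gp u' q)" using X by (simp add: X_V m)
      moreover have "\<dots> = X e * (V (head G e) * rp u p) * gp u' q" by (simp only: mult.assoc)
      ultimately have "X e * m = 0" by simp
      then show ?thesis using X by (auto simp flip: X_def)
    qed
  next
    case Y
    show ?thesis
    proof (cases p)
      case Nil
      then have uv: "u = v" "u \<in> verts G" using w by (auto simp: awalk_Nil_iff)
      have "Y e * V u = (if tail G e = u then Y e else 0)"
        using Y Y_V[of e] V_V[of "tail G e" u] uv by (metis mult.assoc mult_zero_right tail_in_verts)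
      then have *: "Y e * m = (if tail G e = u then Y e * gp u' q else 0)"
        by (simp add: m Nil flip: mult.assoc)
      show ?thesis
      proof (cases "tail G e = u")
        case True
        then have aw: "awalk v [e] (head G e)" using Y uv by (simp add: awalk_Cons_iff awalk_Nil_iff)
        then have "awalk u' (q @ [e]) (head G e)" using w(2) by auto
        moreover have "Y e * gp u' q = V (head G e) * gp u' (q @ [e])"
          using gp_append[OF w(2) aw] Y by (simp add: V_Y flip: mult.assoc)
        moreover have "awalk (head G e) [] (head G e)" using Y by (simp add: awalk_Nil_iff)
        ultimately have "Y e * gp u' q \<in> monomials"
          unfolding monomials_def by (smt (verit) mem_Collect_eq rp.simps(1))
        then show ?thesis using Y * by (auto simp flip: Y_def)
      qed (use Y * in \<open>auto simp flip: Y_def\<close>)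
    next
      case (Cons f p')
      then have f: "f \<in> arcs G" "awalk (head G f) p' v" using w by (auto simp: awalk_Cons_iff)
      have "Y e * m = Y e * X f * (rp (head G f) p' * gp u' q)"
        by (simp add: m Cons mult.assoc)
      also have "\<dots> = (if e = f then rp (head G f) p' * gp u' q else 0)"
        using Y f V_rp_same[OF f(2)] by (simp add: Y_X flip: mult.assoc)
      finally show ?thesis using Y f w unfolding monomials_def by (auto simp flip: Y_def)
    qed
  qed
qed simp

lemma gen_in_monomials: "a \<in> lpa_gens G \<Longrightarrow> cls (monomial a) \<in> monomials"
proof -
  have V: "V v = rp v [] * gp v []" "awalk v [] v" if "v \<in> verts G" for v
    using that by (simp_all add: V_V awalk_Nil_iff)
  have X: "X e = rp (tail G e) [e] * gp (head G e) []" "Y e = rp (head G e) [] * gp (tail G e) [e]"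
      "awalk (tail G e) [e] (head G e)" "awalk (head G e) [] (head G e)" if "e \<in> arcs G" for e
    using that by (simp_all add: X_V V_Y V_V awalk_Nil_iff awalk_Cons_iff mult.assoc)
  show "a \<in> lpa_gens G \<Longrightarrow> cls (monomial a) \<in> monomials"
    unfolding lpa_gens_def monomials_def using V X unfolding V_def X_def Y_def by blast
qed

lemma word_in_monomials:
  assumes "l \<noteq> []" "set l \<subseteq> lpa_gens G"
  shows "cls (Poly_Mapping.single (Word l) 1) \<in> insert 0 monomials"
  using assms
proof (induction l rule: list_nonempty_induct)
  case (single a)
  then show ?case using gen_in_monomials by simp
next
  case (cons a l)
  have "Poly_Mapping.single (Word (a # l)) 1 = monomial a * (Poly_Mapping.single (Word l) 1 :: ('v, 'e, 'k) free_alg)"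
    by (simp add: mult_single plus_word_def)
  moreover have "monomial a \<in> (carrier (lpa_free G) :: ('v, 'e, 'k) free_alg set)"
     "Poly_Mapping.single (Word l) 1 \<in> (carrier (lpa_free G) :: ('v, 'e, 'k) free_alg set)"
    using cons by (simp_all add: lpa_free_def)
  ultimately show ?case using gen_monomial[of a] cons by (simp add: cls_mult)
qed

lemma monomials_L: "monomials \<subseteq> L"
  by (auto simp: monomials_def)

lemma L_eq_span: "L = span monomials"
proof
  show "span monomials \<subseteq> L" by (rule span_minimal[OF monomials_L subspace_L])
  show "L \<subseteq> span monomials"
  proof
    fix y assume "y \<in> L"
    then obtain p where p: "p \<in> carrier (lpa_free G)" "y = cls p" by (auto simp: L_def)
    have "p \<in> carrier (lpa_free G) \<and> cls p \<in> span monomials"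
    proof (induction p rule: poly_mapping_add_induct)
      case zero
      show ?case by (simp add: zero_carrier cls_zero span_zero)
    next
      case (single w c)
      have w: "letters w \<noteq> []" "set (letters w) \<subseteq> lpa_gens G" using single p(1) by (auto simp: lpa_free_def)
      have 1: "Poly_Mapping.single w 1 \<in> (carrier (lpa_free G) :: ('v, 'e, 'k) free_alg set)"
        using w by (simp add: lpa_free_def)
      have "Poly_Mapping.single w c = Poly_Mapping.single 0 c * Poly_Mapping.single w 1"
        by (simp add: mult_single)
      moreover have "cls (Poly_Mapping.single w 1) \<in> span monomials"
        using word_in_monomials[OF w] span_base span_zero by auto
      ultimately show ?case using 1 cls_scale[OF 1] carrier_lpa_free_scale(2)[OF 1]
        by (simp add: span_scale)
    qed (simp add: cls_add carrier_lpa_free_closed span_add)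
    then show "y \<in> span monomials" by (simp add: p)
  qed
qed

lemma L_induct [consumes 1, case_names zero monomial scale add]:
  assumes "y \<in> L" "P 0" "\<And>u p u' q v. awalk u p v \<Longrightarrow> awalk u' q v \<Longrightarrow> P (rp u p * gp u' q)"
    "\<And>c x. x \<in> L \<Longrightarrow> P x \<Longrightarrow> P (c *s x)" "\<And>x y. x \<in> L \<Longrightarrow> y \<in> L \<Longrightarrow> P x \<Longrightarrow> P y \<Longrightarrow> P (x + y)"
  shows "P y"
proof -
  have "y \<in> L \<and> P y" using assms(1) unfolding L_eq_span
  proof (induction rule: span_induct_alt)
    case (step c x y)
    then have "x \<in> L" "P x" using assms(3) monomials_L by (auto simp: monomials_def)
    then show ?case using step assms(4,5) unfolding L_eq_span[symmetric] by simp
  qed (simp add: assms(2) span_zero)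
  then show ?thesis by blast
qed

text \<open>The quantification over all larger \<open>U'\<close> is what makes the induction work:
  for a sum, the union of the two vertex sets serves both summands.\<close>

lemma local_units:
  assumes "y \<in> L"
  shows "\<exists>U. finite U \<and> U \<subseteq> verts G \<and>
    (\<forall>U'. finite U' \<and> U \<subseteq> U' \<and> U' \<subseteq> verts G \<longrightarrow> sum V U' * y = y \<and> y * sum V U' = y)"
  using assms
proof (induction rule: L_induct)
  case (monomial u p u' q v)
  have u: "u \<in> verts G" "u' \<in> verts G" using monomial awalk_hd_in_verts by blast+
  have 1: "sum V U' * rp u p = rp u p" if "finite U'" "u \<in> U'" "U' \<subseteq> verts G" for U'
  proof -
    have "sum V U' * rp u p = (\<Sum>w\<in>U'. if w = u then rp u p else 0)"
      unfolding sum_distrib_right using that V_rp[OF monomial(1)] by (intro sum.cong) auto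
    then show ?thesis using that by simp
  qed
  have 2: "gp u' q * sum V U' = gp u' q" if "finite U'" "u' \<in> U'" "U' \<subseteq> verts G" for U'
  proof -
    have "gp u' q * sum V U' = (\<Sum>w\<in>U'. if w = u' then gp u' q else 0)"
      unfolding sum_distrib_left using that gp_V[OF monomial(2)] by (intro sum.cong) auto
    then show ?thesis using that by simp
  qed
  show ?case
  proof (intro exI[of _ "{u, u'}"] conjI allI impI)
    fix U' assume U': "finite U' \<and> {u, u'} \<subseteq> U' \<and> U' \<subseteq> verts G"
    have "sum V U' * (rp u p * gp u' q) = (sum V U' * rp u p) * gp u' q" by (simp only: mult.assoc)
    then show "sum V U' * (rp u p * gp u' q) = rp u p * gp u' q" using 1[of U'] U' by simp
    have "rp u p * gp u' q * sum V U' = rp u p * (gp u' q * sum V U')" by (simp only: mult.assoc)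
    then show "rp u p * gp u' q * sum V U' = rp u p * gp u' q" using 2[of U'] U' by simp
  qed (use u in auto)
next
  case (scale c x)
  from scale(2) show ?case
  proof (rule ex_forward)
  qed (simp add: scale_mult_left scale_mult_right)
next
  case (add x y)
  from add(3) obtain U where U: "finite U \<and> U \<subseteq> verts G \<and>
    (\<forall>U'. finite U' \<and> U \<subseteq> U' \<and> U' \<subseteq> verts G \<longrightarrow> sum V U' * x = x \<and> x * sum V U' = x)" ..
  from add(4) obtain U2 where U2: "finite U2 \<and> U2 \<subseteq> verts G \<and>
    (\<forall>U'. finite U' \<and> U2 \<subseteq> U' \<and> U' \<subseteq> verts G \<longrightarrow> sum V U' * y = y \<and> y * sum V U' = y)" ..
  show ?case using U U2 by (intro exI[of _ "U \<union> U2"]) (simp add: distrib_left distrib_right)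
next
  case zero
  show ?case by (intro exI[of _ "{}"]) simp
qed

lemma corner_decomposition:
  assumes "y \<in> L"
  obtains U where "finite U" "U \<subseteq> verts G" "y = (\<Sum>v\<in>U. \<Sum>w\<in>U. V v * y * V w)"
proof -
  obtain U where U: "finite U" "U \<subseteq> verts G" "sum V U * y = y" "y * sum V U = y"
    using local_units[OF assms] by blast
  then have "y = sum V U * y * sum V U" by (simp add: mult.assoc)
  also have "\<dots> = (\<Sum>v\<in>U. \<Sum>w\<in>U. V v * y * V w)" by (simp add: sum_distrib_left sum_distrib_right) (rule sum.swap)
  finally show ?thesis using U that by blast
qed

end

lemma (in row_finite_digraph) branching_verts: "branching G (verts G)"
  by unfold_locales auto

lemma (in wf_digraph) awalk_suffix: "awalk u (p @ q) w \<Longrightarrow> awalk u p v \<Longrightarrow> awalk v q w"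
  by simp

section \<open>Vertex ideals, scalar forms and the cancellation of ghost parts\<close>

context leavitt
begin

definition LR :: "'r ring" where
  "LR = \<lparr>carrier = L, mult = (*), one = 0, zero = 0, add = (+)\<rparr>"

definition ide :: "'r set \<Rightarrow> bool" where
  "ide I \<longleftrightarrow> I \<subseteq> L \<and> 0 \<in> I \<and> (\<forall>a\<in>I. \<forall>b\<in>I. a - b \<in> I) \<and> (\<forall>a\<in>I. \<forall>x\<in>L. x * a \<in> I \<and> a * x \<in> I)"

lemma abelian_group_LR: "abelian_group LR"
proof (rule abelian_groupI)
  fix x assume "x \<in> carrier LR"
  then show "\<exists>y\<in>carrier LR. y \<oplus>\<^bsub>LR\<^esub> x = \<zero>\<^bsub>LR\<^esub>"
    using L_diff[OF L_0] by (intro bexI[of _ "- x"]) (auto simp: LR_def)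
qed (auto simp: LR_def algebra_simps)

lemma rng_ideal_LR: "rng_ideal I LR \<longleftrightarrow> ide I"
proof -
  interpret A: abelian_group LR by (rule abelian_group_LR)
  have inv: "inv\<^bsub>add_monoid LR\<^esub> a = - a" if "a \<in> L" for a
    using A.minus_equality[of "- a" a] that L_diff[OF L_0 that] by (simp add: LR_def a_inv_def)
  have "subgroup I (add_monoid LR) \<longleftrightarrow> I \<subseteq> L \<and> 0 \<in> I \<and> (\<forall>a\<in>I. \<forall>b\<in>I. a - b \<in> I)" (is "?s \<longleftrightarrow> ?t")
  proof
    assume s: ?s
    have I: "I \<subseteq> L" using subgroup.subset[OF s] by (simp add: LR_def)
    have "a - b \<in> I" if "a \<in> I" "b \<in> I" for a b
      using subgroup.m_closed[OF s that(1) subgroup.m_inv_closed[OF s that(2)]] inv[of b] that I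
      by (auto simp: LR_def)
    with I show ?t using subgroup.one_closed[OF s] by (simp add: LR_def)
  next
    assume t: ?t
    then have n: "- a \<in> I" if "a \<in> I" for a using that by (metis diff_0)
    show ?s
    proof
      fix x y assume "x \<in> I" "y \<in> I"
      then have "x - (- y) \<in> I" using t n by blast
      then show "x \<otimes>\<^bsub>add_monoid LR\<^esub> y \<in> I" by (simp add: LR_def)
    next
      fix x assume "x \<in> I"
      then show "inv\<^bsub>add_monoid LR\<^esub> x \<in> I" using n t inv by auto
    qed (use t in \<open>auto simp: LR_def\<close>)
  qed
  then show ?thesis unfolding rng_ideal_def additive_subgroup_def ide_def by (simp add: LR_def)
qed

definition vertex_ideal :: "'v set \<Rightarrow> 'r set" where
  "vertex_ideal A = rng_genideal LR (V ` A)"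

lemma vertex_ideal_least: "ide I \<Longrightarrow> V ` A \<subseteq> I \<Longrightarrow> vertex_ideal A \<subseteq> I"
  unfolding vertex_ideal_def rng_genideal_def rng_ideal_LR by blast

lemma ide_L: "ide L"
  by (simp add: ide_def)

lemma ide_vertex_ideal: "A \<subseteq> verts G \<Longrightarrow> ide (vertex_ideal A)"
proof -
  assume "A \<subseteq> verts G"
  then have "V ` A \<subseteq> L" by auto
  then have "vertex_ideal A \<subseteq> L" by (rule vertex_ideal_least[OF ide_L])
  then show ?thesis unfolding ide_def vertex_ideal_def rng_genideal_def rng_ideal_LR
    by (auto simp: ide_def)
qed

lemma V_vertex_ideal: "v \<in> A \<Longrightarrow> V v \<in> vertex_ideal A"
  unfolding vertex_ideal_def rng_genideal_def by blast

lemma ide_add: "ide I \<Longrightarrow> a \<in> I \<Longrightarrow> b \<in> I \<Longrightarrow> a + b \<in> I"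
  unfolding ide_def by (metis diff_0 diff_minus_eq_add)

lemma ide_sum: "ide I \<Longrightarrow> (\<And>i. i \<in> S \<Longrightarrow> f i \<in> I) \<Longrightarrow> sum f S \<in> I"
  by (induction S rule: infinite_finite_induct) (auto simp: ide_add, auto simp: ide_def)

lemma ide_mult: "ide I \<Longrightarrow> a \<in> I \<Longrightarrow> x \<in> L \<Longrightarrow> x * a \<in> I" "ide I \<Longrightarrow> a \<in> I \<Longrightarrow> x \<in> L \<Longrightarrow> a * x \<in> I"
  unfolding ide_def by blast+

definition closed_span :: "'v \<Rightarrow> 'r set" where
  "closed_span u = span {rp u t | t. t \<noteq> [] \<and> awalk u t u}"

text \<open>The scalar \<open>k\<close> is the component of lowest degree of \<open>z\<close>, which makes it multiplicative in \<open>z\<close>.\<close>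

definition scalar_form :: "'v \<Rightarrow> 'k \<Rightarrow> 'r \<Rightarrow> bool" where
  "scalar_form u k z \<longleftrightarrow> u \<in> verts G \<and> (\<exists>r\<in>closed_span u. z = k *s V u + r)"

lemma closed_spanI: "t \<noteq> [] \<Longrightarrow> awalk u t u \<Longrightarrow> rp u t \<in> closed_span u"
  unfolding closed_span_def by (intro span_base) blast

lemma scalar_form_V: "u \<in> verts G \<Longrightarrow> scalar_form u k (k *s V u)"
  unfolding scalar_form_def closed_span_def using span_zero by force

text \<open>A lift of \<open>rp\<close> to the free algebra, which is where the branching
  representation acts.\<close>

primrec free_path :: "'v \<Rightarrow> 'e list \<Rightarrow> ('v, 'e, 'k) free_alg" where
  "free_path u [] = monomial (Vertex u)"
| "free_path u (e # p) = monomial (Edge e) * free_path (head G e) p"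

lemma free_path: "awalk u p v \<Longrightarrow> free_path u p \<in> carrier (lpa_free G) \<and> cls (free_path u p) = rp u p"
  by (induction p arbitrary: u)
    (auto simp: awalk_Nil_iff awalk_Cons_iff cls_mult carrier_lpa_free_closed V_def X_def)

text \<open>The representation attached to \<open>W\<close> annihilates the vertices outside
  \<open>W\<close>, hence the whole ideal and in particular \<open>z\<close>. Its grading then
  isolates \<open>k\<close>: on a function of degree 0, evaluated in degree 0, the closed paths
  contribute nothing and \<open>k *s V u\<close> contributes \<open>k\<close>, since
  \<open>u\<close> lies in \<open>W\<close>.\<close>

lemma scalar_form_vertex_ideal:
  assumes br: "branching G W" and u: "u \<in> W" and form: "scalar_form u k z" and z: "z \<in> vertex_ideal (verts G - W)"
  shows "k = 0"
proof -
  interpret B: branching G W by fact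
  define K where "K = cls ` (B.act_kernel :: ('v, 'e, 'k) free_alg set)"
  have KC: "(B.act_kernel :: ('v, 'e, 'k) free_alg set) \<subseteq> carrier (lpa_free G)" by (auto simp: B.act_kernel_def)
  have act0: "B.act x (\<lambda>_. 0) = (\<lambda>_. 0 :: 'k)" for x by (simp add: B.act_def B.word_act_zero fun_eq_iff)
  have "ide K"
    unfolding ide_def
  proof (intro conjI ballI)
    show "K \<subseteq> L" using KC by (auto simp: K_def L_def)
    show "0 \<in> K" unfolding K_def by (rule image_eqI[of _ _ 0]) (simp_all add: cls_zero B.act_kernel_def B.act_zero)
  next
    fix a b assume "a \<in> K" "b \<in> K"
    then obtain p q where pq: "p \<in> B.act_kernel" "a = cls p" "q \<in> B.act_kernel" "b = cls q" by (auto simp: K_def)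
    then have "a - b = cls (p - q)" using KC cls_diff[of p q] by (simp add: subset_iff)
    moreover have "p - q \<in> B.act_kernel"
      using pq by (simp add: B.act_kernel_def B.act_diff carrier_lpa_free_closed)
    ultimately show "a - b \<in> K" by (simp add: K_def)
  next
    fix a x assume "a \<in> K" "x \<in> L"
    then obtain p q where pq: "p \<in> B.act_kernel" "a = cls p" "q \<in> carrier (lpa_free G)" "x = cls q"
      by (auto simp: K_def L_def)
    then have "x * a = cls (q * p)" "a * x = cls (p * q)" using KC cls_mult[of p q] cls_mult[of q p] by (simp_all add: subset_iff)
    moreover have "q * p \<in> B.act_kernel" "p * q \<in> B.act_kernel"
      using pq by (simp_all add: B.act_kernel_def B.act_mult carrier_lpa_free_closed act0)
    ultimately show "x * a \<in> K" "a * x \<in> K" by (simp_all add: K_def)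
  qed
  moreover have "V ` (verts G - W) \<subseteq> K"
  proof safe
    fix v assume "v \<in> verts G" "v \<notin> W"
    then have "monomial (Vertex v) \<in> (B.act_kernel :: ('v, 'e, 'k) free_alg set)"
      by (auto simp: B.act_kernel_def B.act_monomial fun_eq_iff)
    then show "V v \<in> K" by (auto simp: K_def V_def)
  qed
  ultimately have "z \<in> K" using vertex_ideal_least z by blast
  then obtain p where p: "p \<in> B.act_kernel" "z = cls p" by (auto simp: K_def)
  \<comment> \<open>The indicator of degree 0. A path of length \<open>n\<close> turns it into a
    function supported in degree \<open>- n\<close>.\<close>
  define g :: "'v \<times> nat \<times> int \<Rightarrow> 'k" where "g = (\<lambda>(y, m, d). if d = 0 then 1 else 0)"
  have deg: "B.act (free_path v t) g (y, m, d) = 0" if "d + int (length t) \<noteq> 0" for v t y m d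
    using that
  proof (induction t arbitrary: v y m d)
    case Nil
    then show ?case by (simp add: B.act_monomial g_def)
  next
    case (Cons e t)
    then have "d + 1 + int (length t) \<noteq> 0" by simp
    from Cons.IH[OF this] show ?case by (simp add: B.act_mult B.act_monomial)
  qed
  obtain r where r: "r \<in> closed_span u" "z = k *s V u + r" using form by (auto simp: scalar_form_def)
  have uv: "u \<in> verts G" using u B.W_verts by blast
  have act_scale: "B.act (Poly_Mapping.single 0 c * p) g x = c * B.act p g x"
    for c and p :: "('v, 'e, 'k) free_alg" and x
    by (simp add: B.act_mult B.act_single B.word_act_def zero_word_def)
  have "\<exists>q\<in>carrier (lpa_free G). cls q = r \<and> B.act q g (u, 0, 0) = 0"
    using r(1) unfolding closed_span_def
  proof (induction rule: span_induct_alt)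
    case base
    show ?case by (intro bexI[of _ 0]) (simp_all add: cls_zero B.act_zero)
  next
    case (step c x y)
    then obtain t q where t: "x = rp u t" "t \<noteq> []" "awalk u t u"
      and q: "q \<in> carrier (lpa_free G)" "cls q = y" "B.act q g (u, 0, 0) = 0" by auto
    have "B.act (free_path u t) g (u, 0, 0) = 0" by (rule deg) (use t in simp)
    then show ?case using free_path[OF t(3)] q t(1)
      by (intro bexI[of _ "Poly_Mapping.single 0 c * free_path u t + q"])
        (simp_all add: cls_add cls_scale carrier_lpa_free_closed carrier_lpa_free_scale B.act_add act_scale)
  qed
  then obtain q where q: "q \<in> carrier (lpa_free G)" "cls q = r" "B.act q g (u, 0, 0) = 0" by blast
  let ?s = "Poly_Mapping.single 0 k * monomial (Vertex u) :: ('v, 'e, 'k) free_alg"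
  have s: "?s \<in> carrier (lpa_free G)" using uv by (intro carrier_lpa_free_scale) simp
  have "cls p = cls (?s + q)"
    using p(2) r(2) q s uv by (simp add: cls_add cls_scale V_def)
  then have "p - (?s + q) \<in> lpa_relator_ideal G"
    using p(1) KC q(1) s by (subst (asm) cls_eq_iff) (auto intro: carrier_lpa_free_closed)
  then have "p - (?s + q) \<in> B.act_kernel" using B.relator_ideal_le_act_kernel by blast
  then have "B.act p g (u, 0, 0) - B.act (?s + q) g (u, 0, 0) = 0"
    unfolding B.act_kernel_def by (simp add: B.act_diff fun_eq_iff)
  moreover have "B.act p g (u, 0, 0) = 0" using p(1) by (simp add: B.act_kernel_def)
  moreover have "B.act ?s g (u, 0, 0) = k"
    using u by (simp add: B.act_mult B.act_single B.word_act_def zero_word_def g_def)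
  ultimately show "k = 0" using q(3) by (simp add: B.act_add)
qed

text \<open>The case \<open>W = verts G\<close>, where the vertex ideal is that of the empty set.
  From it follows that vertices, and then paths, are nonzero.\<close>

lemma scalar_form_zero: "scalar_form u k 0 \<Longrightarrow> k = 0"
  using scalar_form_vertex_ideal[OF branching_verts, of u k 0] ide_vertex_ideal[of "{}"]
  by (auto simp: scalar_form_def ide_def)

lemma scale_V_eq_0: "u \<in> verts G \<Longrightarrow> k *s V u = 0 \<longleftrightarrow> k = 0"
  using scalar_form_zero[of u k] scalar_form_V[of u k] by auto

lemma V_neq_0: "u \<in> verts G \<Longrightarrow> V u \<noteq> 0"
  using scale_V_eq_0[of u 1] by simp

lemma gp_neq_0: "awalk u p v \<Longrightarrow> gp u p \<noteq> 0"
  using gp_rp[of u p v] V_neq_0 awalk_last_in_verts by fastforce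

lemma V_closed_span: "r \<in> closed_span u \<Longrightarrow> u \<in> verts G \<Longrightarrow> V u * r = r \<and> r * V u = r"
  unfolding closed_span_def
proof (induction rule: span_induct_alt)
  case (step c x y)
  then show ?case
    by (auto simp: distrib_left distrib_right scale_mult_left scale_mult_right V_rp_same rp_V_same)
qed simp

lemma closed_span_add: "a \<in> closed_span u \<Longrightarrow> b \<in> closed_span u \<Longrightarrow> a + b \<in> closed_span u"
  unfolding closed_span_def by (rule span_add)

lemma closed_span_scale: "a \<in> closed_span u \<Longrightarrow> c *s a \<in> closed_span u"
  unfolding closed_span_def by (rule span_scale)

lemma closed_span_mult:
  assumes "a \<in> closed_span u" "b \<in> closed_span u"
  shows "a * b \<in> closed_span u"
proof -
  have 1: "rp u t * b \<in> closed_span u" if "t \<noteq> []" "awalk u t u" for t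
    using assms(2) unfolding closed_span_def
  proof (induction rule: span_induct_alt)
    case (step c x y)
    then obtain s where s: "x = rp u s" "s \<noteq> []" "awalk u s u" by blast
    then have "rp u t * x = rp u (t @ s)" "t @ s \<noteq> []" "awalk u (t @ s) u"
      using that by (auto simp: rp_append)
    then have "rp u t * x \<in> span {rp u t |t. t \<noteq> [] \<and> awalk u t u}" by (intro span_base) blast
    with step show ?case by (simp add: distrib_left scale_mult_right span_add span_scale)
  qed (simp add: span_zero)
  show ?thesis using assms(1) unfolding closed_span_def
  proof (induction rule: span_induct_alt)
    case (step c x y)
    then obtain s where s: "x = rp u s" "s \<noteq> []" "awalk u s u" by blast
    with 1 step show ?case
      unfolding closed_span_def by (simp add: distrib_right scale_mult_left span_add span_scale)
  qed (simp add: span_zero)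
qed

lemma scalar_form_mult:
  assumes "scalar_form u k z" "scalar_form u k' z'"
  shows "scalar_form u (k * k') (z * z')"
proof -
  obtain r r' where u: "u \<in> verts G" and r: "r \<in> closed_span u" "z = k *s V u + r"
    and r': "r' \<in> closed_span u" "z' = k' *s V u + r'"
    using assms by (auto simp: scalar_form_def)
  have "z * z' = (k * k') *s V u + (k *s r' + (k' *s r + r * r'))"
    using V_closed_span[OF r(1) u] V_closed_span[OF r'(1) u] u
    by (simp add: r r' distrib_left distrib_right scale_right_distrib scale_mult_left scale_mult_right V_V mult.commute add.assoc)
  moreover have "k *s r' + (k' *s r + r * r') \<in> closed_span u"
    using r r' by (intro closed_span_add closed_span_scale closed_span_mult)
  ultimately show ?thesis using u by (auto simp: scalar_form_def)
qed

text \<open>For a closed path \<open>t\<close>, either \<open>l\<close> is a prefix of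
  \<open>t @ l\<close>, and cancelling it leaves a closed path at \<open>x\<close> of the same
  length as \<open>t\<close>, or the two paths are incomparable and the product is zero.\<close>

lemma closed_span_conj:
  assumes "r \<in> closed_span u" "awalk u l x"
  shows "gp u l * r * rp u l \<in> closed_span x"
  using assms(1) unfolding closed_span_def[of u]
proof (induction rule: span_induct_alt)
  case base
  show ?case by (simp add: closed_span_def span_zero)
next
  case (step c a b)
  then obtain t where t: "a = rp u t" "t \<noteq> []" "awalk u t u" by blast
  have eq: "gp u l * a * rp u l = gp u l * rp u (t @ l)"
    using t assms(2) by (simp add: rp_append mult.assoc)
  have aw: "awalk u (t @ l) x" using t assms(2) by auto
  have "gp u l * a * rp u l \<in> closed_span x"
  proof (cases "prefix l (t @ l)")
    case True
    then obtain s where s: "t @ l = l @ s" by (auto simp: prefix_def)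
    then have "length s = length t" by (metis add.commute add_left_cancel length_append)
    then have "s \<noteq> []" using t(2) by auto
    moreover have "awalk x s x" using aw assms(2) unfolding s by (rule awalk_suffix)
    moreover have "gp u l * a * rp u l = rp x s"
      using gp_rp_append[OF assms(2) \<open>awalk x s x\<close>] eq s by simp
    ultimately show ?thesis by (metis closed_spanI)
  next
    case False
    moreover have "\<not> prefix (t @ l) l" using t(2) by (auto dest: prefix_length_le)
    ultimately have "gp u l * a * rp u l = 0"
      using gp_rp_parallel[OF assms(2) aw] eq by (simp add: parallel_def)
    then show ?thesis by (simp add: closed_span_def span_zero)
  qed
  then show ?case using step
    by (simp add: distrib_left distrib_right scale_mult_left scale_mult_right closed_span_add closed_span_scale)
qed

lemma scalar_form_conj:
  assumes "scalar_form u k z" "awalk u l x"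
  shows "scalar_form x k (gp u l * z * rp u l)"
proof -
  obtain r where r: "r \<in> closed_span u" "z = k *s V u + r" using assms by (auto simp: scalar_form_def)
  have "gp u l * z * rp u l = k *s V x + gp u l * r * rp u l"
    using assms(2) by (simp add: r distrib_left distrib_right scale_mult_left scale_mult_right gp_V_same gp_rp)
  then show ?thesis using closed_span_conj[OF r(1) assms(2)] awalk_last_in_verts[OF assms(2)]
    by (auto simp: scalar_form_def)
qed

definition real_span :: "'v \<Rightarrow> 'v \<Rightarrow> 'r set" where
  "real_span v u = span {rp v p | p. awalk v p u}"

lemma real_spanI: "awalk v p u \<Longrightarrow> rp v p \<in> real_span v u"
  unfolding real_span_def by (intro span_base) blast

text \<open>Take for \<open>p\<close> a shortest path occurring in \<open>z\<close>. Its own term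
  becomes a multiple of \<open>V u\<close>. Each other path either extends \<open>p\<close>, leaving
  a closed path of positive length, or is incomparable with \<open>p\<close> and vanishes; being a
  proper prefix of \<open>p\<close> is excluded by minimality.\<close>

lemma real_span_scalar_form:
  assumes z: "z \<in> real_span v u" "z \<noteq> 0"
  shows "\<exists>p k. awalk v p u \<and> k \<noteq> 0 \<and> scalar_form u k (gp v p * z)"
proof -
  obtain T c where T: "finite T" "T \<subseteq> {rp v p | p. awalk v p u}" "z = (\<Sum>a\<in>T. c a *s a)"
    using z(1) unfolding real_span_def span_explicit by auto
  define T' where "T' = {a \<in> T. c a \<noteq> 0}"
  have zT': "z = (\<Sum>a\<in>T'. c a *s a)"
    unfolding T(3) T'_def using T(1) by (intro sum.mono_neutral_right) auto
  have T'f: "finite T'" using T(1) by (simp add: T'_def)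
  have "T' \<noteq> {}" using z(2) zT' by auto
  have "\<forall>a\<in>T. \<exists>p. awalk v p u \<and> rp v p = a" using T(2) by blast
  then obtain P where P: "\<And>a. a \<in> T \<Longrightarrow> awalk v (P a) u" "\<And>a. a \<in> T \<Longrightarrow> rp v (P a) = a" by metis
  define b where "b = arg_min_on (\<lambda>a. length (P a)) T'"
  have b: "b \<in> T'" "\<And>a. a \<in> T' \<Longrightarrow> length (P b) \<le> length (P a)"
    unfolding b_def using arg_min_if_finite(1)[OF T'f \<open>T' \<noteq> {}\<close>] arg_min_least[OF T'f \<open>T' \<noteq> {}\<close>] by auto
  have bT: "b \<in> T" "c b \<noteq> 0" using b by (auto simp: T'_def)
  note Pb = P[OF bT(1)]
  have uv: "u \<in> verts G" using awalk_last_in_verts[OF Pb(1)] .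
  have higher: "gp v (P b) * a \<in> closed_span u" if a: "a \<in> T'" "a \<noteq> b" for a
  proof -
    note Pa = P[of a]
    have aT: "a \<in> T" using a by (simp add: T'_def)
    show ?thesis
    proof (cases "prefix (P b) (P a)")
      case True
      then obtain t where t: "P a = P b @ t" by (auto simp: prefix_def)
      have "t \<noteq> []" using t a P(2)[OF aT] Pb(2) by auto
      moreover have "awalk u t u" using P(1)[OF aT] Pb(1) unfolding t by (rule awalk_suffix)
      moreover have "gp v (P b) * a = rp u t"
        using gp_rp_append[OF Pb(1) \<open>awalk u t u\<close>] t P(2)[OF aT] by simp
      ultimately show ?thesis by (metis closed_spanI)
    next
      case False
      moreover have "\<not> prefix (P a) (P b)"
      proof
        assume "prefix (P a) (P b)"
        then obtain t where t: "P b = P a @ t" by (rule prefixE)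
        then have "t = []" using b(2)[OF a(1)] by simp
        then show False using False t by simp
      qed
      ultimately have "gp v (P b) * rp v (P a) = 0"
        using gp_rp_parallel[OF Pb(1) P(1)[OF aT]] by (simp add: parallel_def)
      then show ?thesis using P(2)[OF aT] by (simp add: closed_span_def span_zero)
    qed
  qed
  have "gp v (P b) * z = (\<Sum>a\<in>T'. c a *s (gp v (P b) * a))"
    by (simp add: zT' sum_distrib_left scale_mult_right)
  also have "\<dots> = c b *s (gp v (P b) * b) + (\<Sum>a\<in>T' - {b}. c a *s (gp v (P b) * a))"
    by (rule sum.remove[OF T'f b(1)])
  also have "gp v (P b) * b = V u" using gp_rp[OF Pb(1)] Pb(2) by simp
  finally have "gp v (P b) * z = c b *s V u + (\<Sum>a\<in>T' - {b}. c a *s (gp v (P b) * a))" .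
  moreover have "(\<Sum>a\<in>T' - {b}. c a *s (gp v (P b) * a)) \<in> closed_span u"
    unfolding closed_span_def by (intro span_sum span_scale) (use higher in \<open>auto simp: closed_span_def\<close>)
  ultimately show ?thesis using Pb(1) bT(2) uv by (auto simp: scalar_form_def)
qed

text \<open>The index set obtained by applying \<open>CK2\<close> \<open>n\<close> times to
  \<open>V u\<close>. Paths stop early only at sinks, where \<open>CK2\<close> does not
  apply.\<close>

primrec paths_upto :: "nat \<Rightarrow> 'v \<Rightarrow> 'e list set" where
  "paths_upto 0 u = {[]}"
| "paths_upto (Suc n) u = (if out_arcs G u = {} then {[]} else \<Union>e\<in>out_arcs G u. (#) e ` paths_upto n (head G e))"

lemma paths_upto_awalk:
  "u \<in> verts G \<Longrightarrow> q \<in> paths_upto n u \<Longrightarrow>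
    \<exists>w. awalk u q w \<and> (length q = n \<or> length q < n \<and> out_arcs G w = {})"
proof (induction n arbitrary: u q)
  case (Suc n)
  show ?case
  proof (cases "out_arcs G u = {}")
    case False
    then obtain e q' where e: "e \<in> out_arcs G u" "q = e # q'" "q' \<in> paths_upto n (head G e)"
      using Suc.prems by (auto simp del: in_out_arcs_conv)
    from Suc.IH[OF _ e(3)] e(1) obtain w where "awalk (head G e) q' w"
      "length q' = n \<or> length q' < n \<and> out_arcs G w = {}" by auto
    then show ?thesis using e by (intro exI[of _ w]) (auto simp: awalk_Cons_iff)
  qed (use Suc.prems in \<open>auto simp: awalk_Nil_iff\<close>)
qed (auto simp: awalk_Nil_iff)

lemma finite_paths_upto: "u \<in> verts G \<Longrightarrow> finite (paths_upto n u)"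
  by (induction n arbitrary: u) (auto intro!: finite_imageI row_finite)

text \<open>One application of \<open>CK2\<close> with expansions of the heads substituted. The
  family \<open>Z\<close> is left general because both \<open>paths_upto\<close> and
  \<open>exit_paths\<close> arise by this recursion.\<close>

lemma V_eq_sum_out_arcs:
  assumes u: "u \<in> verts G" "out_arcs G u \<noteq> {}"
    and Z: "\<And>e. e \<in> out_arcs G u \<Longrightarrow> finite (Z (head G e)) \<and> V (head G e) = (\<Sum>q\<in>Z (head G e). rp (head G e) q * gp (head G e) q)"
  shows "finite (\<Union>e\<in>out_arcs G u. (#) e ` Z (head G e))"
    "V u = (\<Sum>q\<in>(\<Union>e\<in>out_arcs G u. (#) e ` Z (head G e)). rp u q * gp u q)"
proof -
  show "finite (\<Union>e\<in>out_arcs G u. (#) e ` Z (head G e))" using Z row_finite[OF u(1)] by auto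
  have "(\<Sum>q\<in>(\<Union>e\<in>out_arcs G u. (#) e ` Z (head G e)). rp u q * gp u q)
      = (\<Sum>e\<in>out_arcs G u. \<Sum>q\<in>(#) e ` Z (head G e). rp u q * gp u q)"
    using Z row_finite[OF u(1)] by (intro sum.UNION_disjoint) auto
  also have "\<dots> = (\<Sum>e\<in>out_arcs G u. X e * Y e)"
  proof (rule sum.cong[OF refl])
    fix e assume e: "e \<in> out_arcs G u"
    have "(\<Sum>q\<in>(#) e ` Z (head G e). rp u q * gp u q)
        = (\<Sum>q\<in>Z (head G e). X e * (rp (head G e) q * gp (head G e) q) * Y e)"
      by (subst sum.reindex) (simp_all add: mult.assoc)
    also have "\<dots> = X e * (\<Sum>q\<in>Z (head G e). rp (head G e) q * gp (head G e) q) * Y e"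
      by (simp add: sum_distrib_left sum_distrib_right)
    also have "\<dots> = X e * Y e" using e Z[OF e] by (simp add: X_V flip: conjunct2[OF Z[OF e]])
    finally show "(\<Sum>q\<in>(#) e ` Z (head G e). rp u q * gp u q) = X e * Y e" .
  qed
  also have "\<dots> = V u" using CK2[OF u] by simp
  finally show "V u = (\<Sum>q\<in>(\<Union>e\<in>out_arcs G u. (#) e ` Z (head G e)). rp u q * gp u q)" by simp
qed

lemma V_eq_sum_paths_upto: "u \<in> verts G \<Longrightarrow> V u = (\<Sum>q\<in>paths_upto n u. rp u q * gp u q)"
proof (induction n arbitrary: u)
  case (Suc n)
  show ?case
  proof (cases "out_arcs G u = {}")
    case False
    have "finite (paths_upto n (head G e)) \<and> V (head G e) = (\<Sum>q\<in>paths_upto n (head G e). rp (head G e) q * gp (head G e) q)"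
      if "e \<in> out_arcs G u" for e
      using that Suc.IH[of "head G e"] finite_paths_upto by auto
    from V_eq_sum_out_arcs(2)[OF Suc.prems False, of "paths_upto n", OF this] False
    show ?thesis by simp
  qed (use Suc.prems in \<open>simp add: V_V\<close>)
qed (simp add: V_V)

text \<open>A path at least as long as the ghost part of a monomial cancels it or gives zero. A
  shorter path in \<open>paths_upto\<close> ends at a sink and therefore cannot be a proper prefix
  of the ghost part. The bound is existential and upward closed so that two summands can share one
  \<open>n\<close>.\<close>

lemma real_span_paths_upto:
  assumes "y \<in> L" "v \<in> verts G" "u' \<in> verts G"
  shows "\<exists>n0. \<forall>n\<ge>n0. \<forall>q\<in>paths_upto n u'. \<forall>u. awalk u' q u \<longrightarrow> V v * y * rp u' q \<in> real_span v u"
  using assms(1)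
proof (induction rule: L_induct)
  case zero
  show ?case by (simp add: real_span_def span_zero)
next
  case (monomial a p b q' c)
  have "V v * (rp a p * gp b q') * rp u' q \<in> real_span v u"
    if n: "length q' \<le> n" and q: "q \<in> paths_upto n u'" "awalk u' q u" for n q u
  proof -
    have eq: "V v * (rp a p * gp b q') * rp u' q = (V v * rp a p) * (gp b q' * rp u' q)" by (simp only: mult.assoc)
    consider "v \<noteq> a" | "b \<noteq> u'" | "b = u'" "q' \<parallel> q" | "v = a" "b = u'" "prefix q' q" | "b = u'" "strict_prefix q q'"
      by (metis parallelI prefix_order.le_less)
    then show ?thesis
    proof cases
      case 1
      then show ?thesis using V_rp[OF monomial(1) assms(2)] eq by (simp add: real_span_def span_zero)
    next
      case 2
      then show ?thesis using gp_rp_neq[OF monomial(2) q(2)] eq by (simp add: real_span_def span_zero)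
    next
      case 3
      then show ?thesis using gp_rp_parallel[OF _ q(2)] monomial(2) eq by (simp add: real_span_def span_zero)
    next
      case 4
      then obtain t where t: "q = q' @ t" by (auto simp: prefix_def)
      then have aw: "awalk c t u" using q(2) monomial(2) 4 awalk_suffix by blast
      have "V v * (rp a p * gp b q') * rp u' q = rp v (p @ t)"
        using eq 4 t gp_rp_append[OF _ aw, of u' q'] monomial rp_append[OF _ aw] V_rp_same by simp
      moreover have "awalk v (p @ t) u" using 4 monomial(1) aw by auto
      ultimately show ?thesis by (metis real_spanI)
    next
      case 5
      then obtain t where t: "q' = q @ t" "t \<noteq> []" by (auto simp: strict_prefix_def prefix_def)
      then have aw: "awalk u t c" using q(2) monomial(2) 5 awalk_suffix by blast
      have "length q < n" using n t by (cases t) auto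
      then have "out_arcs G u = {}"
        using paths_upto_awalk[OF assms(3) q(1)] q(2) by (auto dest: awalk_ends_eqD)
      then show ?thesis using aw t(2) by (cases t) (auto simp: awalk_Cons_iff out_arcs_def)
    qed
  qed
  then show ?case by blast
next
  case (scale c x)
  from scale(2) obtain n0 where n0: "\<forall>n\<ge>n0. \<forall>q\<in>paths_upto n u'. \<forall>u. awalk u' q u \<longrightarrow> V v * x * rp u' q \<in> real_span v u" ..
  then show ?case unfolding real_span_def
    by (intro exI[of _ n0]) (simp add: scale_mult_left scale_mult_right span_scale)
next
  case (add x y)
  from add(3) obtain n1 where n1: "\<forall>n\<ge>n1. \<forall>q\<in>paths_upto n u'. \<forall>u. awalk u' q u \<longrightarrow> V v * x * rp u' q \<in> real_span v u" ..
  from add(4) obtain n2 where n2: "\<forall>n\<ge>n2. \<forall>q\<in>paths_upto n u'. \<forall>u. awalk u' q u \<longrightarrow> V v * y * rp u' q \<in> real_span v u" ..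
  show ?case
  proof (intro exI[of _ "max n1 n2"] allI impI ballI)
    fix n q u assume n: "max n1 n2 \<le> n" and "q \<in> paths_upto n u'" "awalk u' q u"
    moreover have "n1 \<le> n" "n2 \<le> n" using n by simp_all
    ultimately have "V v * x * rp u' q \<in> real_span v u" "V v * y * rp u' q \<in> real_span v u"
      using n1 n2 by blast+
    then show "V v * (x + y) * rp u' q \<in> real_span v u"
      unfolding real_span_def distrib_left distrib_right by (rule span_add)
  qed
qed

text \<open>Expanding \<open>V u'\<close> over long paths shows that some
  \<open>V v * y * rp u' q\<close> is nonzero; having no ghost parts left, it is brought to scalar
  form by a shortest path.\<close>

lemma nonzero_scalar_form:
  assumes y: "y \<in> L" and u': "u' \<in> verts G" and nz: "y * V u' \<noteq> 0"
  shows "\<exists>v p q u k. awalk v p u \<and> awalk u' q u \<and> k \<noteq> 0 \<and> scalar_form u k (gp v p * y * rp u' q)"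
proof -
  obtain U where U: "finite U" "U \<subseteq> verts G" "sum V U * (y * V u') = y * V u'"
    using local_units[of "y * V u'"] y u' by auto
  then have "(\<Sum>v\<in>U. V v * (y * V u')) \<noteq> 0" using nz by (simp flip: sum_distrib_right)
  then obtain v where v: "v \<in> U" "V v * (y * V u') \<noteq> 0" by (meson sum.neutral)
  then have vv: "v \<in> verts G" using U by blast
  obtain n where n: "\<forall>q\<in>paths_upto n u'. \<forall>u. awalk u' q u \<longrightarrow> V v * y * rp u' q \<in> real_span v u"
    using real_span_paths_upto[OF y vv u'] by blast
  have "V v * y * V u' = (\<Sum>q\<in>paths_upto n u'. V v * y * rp u' q * gp u' q)"
    by (subst V_eq_sum_paths_upto[OF u', of n]) (simp add: sum_distrib_left mult.assoc)
  then have "(\<Sum>q\<in>paths_upto n u'. V v * y * rp u' q * gp u' q) \<noteq> 0" using v by (simp add: mult.assoc)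
  then obtain q where q: "q \<in> paths_upto n u'" "V v * y * rp u' q * gp u' q \<noteq> 0" by (meson sum.neutral)
  obtain u where u: "awalk u' q u" using paths_upto_awalk[OF u' q(1)] by blast
  have "V v * y * rp u' q \<noteq> 0" using q(2) by auto
  with n q(1) u obtain p k where pk: "awalk v p u" "k \<noteq> 0" "scalar_form u k (gp v p * (V v * y * rp u' q))"
    using real_span_scalar_form by blast
  have "gp v p * (V v * y * rp u' q) = gp v p * y * rp u' q"
    using gp_V_same[OF pk(1)] by (simp flip: mult.assoc)
  with pk u show ?thesis by metis
qed

end

section \<open>Bifurcations\<close>

context pre_digraph
begin

text \<open>Cycles are permitted, so line points and vertices on cycles without exits are treated by
  one argument.\<close>

definition nonbifurcating :: "'a set" where
  "nonbifurcating = {v \<in> verts G. \<forall>w\<in>tree v. \<not> bifurcation w}"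

text \<open>The common feature of vertices with pure infinite bifurcations and of vertices on
  extreme cycles: it supplies arbitrarily many incomparable paths, which are used to annihilate
  closed paths.\<close>

definition rebifurcating :: "'a set" where
  "rebifurcating = {v \<in> verts G. \<forall>w\<in>tree v. \<exists>b\<in>tree w. bifurcation b}"

end

context row_finite_digraph
begin

lemma bifurcation_iff:
  "bifurcation u \<longleftrightarrow> (\<exists>e\<in>arcs G. \<exists>f\<in>arcs G. tail G e = u \<and> tail G f = u \<and> e \<noteq> f)"
proof
  assume b: "bifurcation u"
  then have "2 \<le> card (out_arcs G u)" by (simp add: bifurcation_def out_degree_def)
  then obtain T where "T \<subseteq> out_arcs G u" "card T = 2" by (rule obtain_subset_with_card_n)
  then obtain e f where "e \<in> out_arcs G u" "f \<in> out_arcs G u" "e \<noteq> f"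
    unfolding card_2_iff by blast
  then show "\<exists>e\<in>arcs G. \<exists>f\<in>arcs G. tail G e = u \<and> tail G f = u \<and> e \<noteq> f" by auto
next
  assume "\<exists>e\<in>arcs G. \<exists>f\<in>arcs G. tail G e = u \<and> tail G f = u \<and> e \<noteq> f"
  then obtain e f where ef: "e \<in> out_arcs G u" "f \<in> out_arcs G u" "e \<noteq> f" "u \<in> verts G" by auto
  have "card {e, f} \<le> card (out_arcs G u)" using ef row_finite by (intro card_mono) auto
  then show "bifurcation u" using ef by (simp add: bifurcation_def out_degree_def)
qed

lemma tree_trans: "w \<in> tree v \<Longrightarrow> x \<in> tree w \<Longrightarrow> x \<in> tree v"
  unfolding tree_def by (auto intro: reachable_trans)

lemma tree_refl: "v \<in> verts G \<Longrightarrow> v \<in> tree v"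
  unfolding tree_def by (simp add: reachable_refl)

lemma tree_awalk: "w \<in> tree v \<longleftrightarrow> (\<exists>p. awalk v p w)"
  by (simp add: tree_def reachable_awalk)

lemma tree_verts: "w \<in> tree v \<Longrightarrow> w \<in> verts G"
  by (auto simp: tree_awalk dest: awalk_last_in_verts)

lemma nonbifurcating_tree: "v \<in> nonbifurcating \<Longrightarrow> w \<in> tree v \<Longrightarrow> w \<in> nonbifurcating"
  unfolding nonbifurcating_def using tree_trans tree_verts by blast

lemma rebifurcating_tree: "v \<in> rebifurcating \<Longrightarrow> w \<in> tree v \<Longrightarrow> w \<in> rebifurcating"
  unfolding rebifurcating_def using tree_trans tree_verts by blast

lemma pure_infinite_bifurcations_tree:
  "v \<in> pure_infinite_bifurcations \<Longrightarrow> w \<in> tree v \<Longrightarrow> w \<in> pure_infinite_bifurcations"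
  unfolding pure_infinite_bifurcations_def using tree_verts by (auto simp: tree_def intro: reachable_trans)

lemma cycle_tree:
  assumes "cycle c" "x \<in> path_sources c" "y \<in> path_sources c"
  shows "y \<in> tree x"
proof -
  obtain u where u: "awalk u c u" using assms(1) by (auto simp: cycle_def)
  have "z \<in> tree u \<and> u \<in> tree z" if "z \<in> path_sources c" for z
  proof -
    from that obtain e where e: "e \<in> set c" "z = tail G e" by (auto simp: path_sources_def)
    then obtain c1 c2 where c: "c = c1 @ e # c2" by (metis split_list)
    from u[unfolded c] obtain w where "awalk u c1 w" "awalk w (e # c2) u" by auto
    moreover from this have "w = z" using e by (simp add: awalk_Cons_iff)
    ultimately show ?thesis unfolding tree_awalk by blast
  qed
  then show ?thesis using assms tree_trans by blast
qed

lemma cycle_without_exit_tree: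
  assumes c: "cycle c" "\<not> (\<exists>e. path_exit c e)" and x: "x \<in> path_sources c"
  shows "tree x \<subseteq> path_sources c"
proof -
  obtain u where u: "awalk u c u" "c \<noteq> []" using c(1) by (auto simp: cycle_def)
  have "head G e \<in> path_sources c" if e: "e \<in> arcs G" "tail G e \<in> path_sources c" for e
  proof -
    obtain a where a: "a \<in> set c" "tail G e = tail G a" using e(2) by (auto simp: path_sources_def)
    then have "e = a" using c(2) e(1) by (auto simp: path_exit_def)
    obtain c1 c2 where c12: "c = c1 @ a # c2" using a(1) by (metis split_list)
    from u(1)[unfolded c12] have w: "awalk (head G a) c2 u" by (auto simp: awalk_Cons_iff)
    show ?thesis
    proof (cases c2)
      case Nil
      then have "head G a = u" using w by (simp add: awalk_Nil_iff)
      moreover have "u = tail G (hd c)" using u by (cases c) (auto simp: awalk_Cons_iff)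
      ultimately show ?thesis using \<open>e = a\<close> u(2) by (auto simp: path_sources_def)
    next
      case (Cons b c3)
      then have "head G a = tail G b" using w by (simp add: awalk_Cons_iff)
      then show ?thesis using \<open>e = a\<close> c12 Cons by (auto simp: path_sources_def)
    qed
  qed
  then have "w \<in> path_sources c" if "awalk v p w" "v \<in> path_sources c" for v p w
    using that by (induction p arbitrary: v) (auto simp: awalk_Nil_iff awalk_Cons_iff)
  then show ?thesis using x by (auto simp: tree_awalk)
qed

lemma line_points_subset: "line_points \<subseteq> nonbifurcating"
  by (auto simp: line_points_def nonbifurcating_def)

lemma cycle_points_subset: "cycle_points \<subseteq> nonbifurcating"
proof
  fix v assume "v \<in> cycle_points"
  then obtain c where v: "v \<in> verts G" and c: "cycle c" "\<not> (\<exists>e. path_exit c e)" "v \<in> path_sources c"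
    by (auto simp: cycle_points_def)
  have "\<not> bifurcation w" if w: "w \<in> tree v" for w
  proof
    assume "bifurcation w"
    then obtain e f where ef: "e \<in> arcs G" "f \<in> arcs G" "tail G e = w" "tail G f = w" "e \<noteq> f"
      by (auto simp: bifurcation_iff)
    obtain a where "a \<in> set c" "w = tail G a"
      using w cycle_without_exit_tree[OF c] unfolding path_sources_def by blast
    with ef have "path_exit c e \<or> path_exit c f" unfolding path_exit_def by metis
    with c(2) show False by blast
  qed
  with v show "v \<in> nonbifurcating" by (simp add: nonbifurcating_def)
qed

text \<open>Without a bifurcation below \<open>v\<close>, either \<open>v\<close> is a line point or
  a cycle lies below \<open>v\<close>, and that cycle cannot have an exit. Both are
  excluded.\<close>

lemma reaches_bifurcation:
  assumes "v \<in> pure_infinite_bifurcations"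
  shows "\<exists>b\<in>tree v. bifurcation b"
proof (rule ccontr)
  assume nb: "\<not> (\<exists>b\<in>tree v. bifurcation b)"
  have v: "v \<in> verts G" and nr: "\<And>x. x \<in> tree v \<Longrightarrow> x \<notin> line_points \<union> cycle_points"
    using assms by (auto simp: pure_infinite_bifurcations_def tree_def)
  have "v \<notin> line_points" using nr tree_refl[OF v] by blast
  then obtain z c where z: "z \<in> tree v" "cycle c" "z \<in> path_sources c"
    using v nb by (auto simp: line_points_def)
  have "\<not> path_exit c e" for e
  proof
    assume "path_exit c e"
    then obtain a where a: "e \<in> arcs G" "a \<in> set c" "tail G e = tail G a" "e \<noteq> a" by (auto simp: path_exit_def)
    then have "bifurcation (tail G a)" using cycle_arcs[OF z(2)] by (auto simp: bifurcation_iff)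
    moreover have "tail G a \<in> tree v"
      using tree_trans[OF z(1) cycle_tree[OF z(2,3)]] a(2) by (auto simp: path_sources_def)
    ultimately show False using nb by blast
  qed
  then have "z \<in> cycle_points" using z tree_verts by (auto simp: cycle_points_def)
  then show False using nr z(1) by blast
qed

lemma pure_infinite_bifurcations_subset: "pure_infinite_bifurcations \<subseteq> rebifurcating"
proof
  fix v assume v: "v \<in> pure_infinite_bifurcations"
  then have "v \<in> verts G" by (simp add: pure_infinite_bifurcations_def)
  with v show "v \<in> rebifurcating"
    unfolding rebifurcating_def using reaches_bifurcation pure_infinite_bifurcations_tree by blast
qed

text \<open>Extremality returns a path only to some vertex of the cycle; following the cycle from
  there leads back to \<open>x\<close> itself.\<close>

lemma extreme_cycle_points_return:
  assumes "x \<in> extreme_cycle_points" "w \<in> tree x"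
  shows "x \<in> tree w"
proof -
  obtain c where c: "extreme_cycle c" "x \<in> path_sources c" using assms by (auto simp: extreme_cycle_points_def)
  obtain p where p: "awalk x p w" using assms(2) by (auto simp: tree_awalk)
  from c p obtain q y where q: "y \<in> path_sources c" "awalk x (p @ q) y" unfolding extreme_cycle_def by blast
  have "awalk w q y" using q(2) p by (rule awalk_suffix)
  then have "y \<in> tree w" by (auto simp: tree_awalk)
  moreover have "x \<in> tree y" using c q(1) by (auto simp: extreme_cycle_def intro: cycle_tree)
  ultimately show ?thesis by (rule tree_trans)
qed

lemma extreme_cycle_points_subset: "extreme_cycle_points \<subseteq> rebifurcating"
proof
  fix x assume x: "x \<in> extreme_cycle_points"
  then obtain c where c: "extreme_cycle c" "x \<in> path_sources c" "x \<in> verts G"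
    by (auto simp: extreme_cycle_points_def)
  then obtain e a where a: "e \<in> arcs G" "a \<in> set c" "tail G e = tail G a" "e \<noteq> a" "cycle c"
    by (auto simp: extreme_cycle_def path_exit_def)
  then have "bifurcation (tail G a)" using cycle_arcs[of c] by (auto simp: bifurcation_iff)
  moreover have "tail G a \<in> tree x" using cycle_tree[OF a(5) c(2)] a(2) by (auto simp: path_sources_def)
  ultimately show "x \<in> rebifurcating"
    unfolding rebifurcating_def using c(3) extreme_cycle_points_return[OF x] tree_trans by blast
qed

lemma reaches_distinguished:
  assumes "v \<in> verts G" "v \<notin> pure_infinite_bifurcations"
  shows "\<exists>x\<in>nonbifurcating \<union> extreme_cycle_points. x \<in> tree v"
  using assms line_points_subset cycle_points_subset
  by (auto simp: pure_infinite_bifurcations_def tree_def)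

text \<open>The paths form a comb: go to a bifurcation, stop after one arc, and continue recursively
  after another.\<close>

lemma incomparable_awalks:
  "u \<in> rebifurcating \<Longrightarrow> \<exists>S. finite S \<and> card S = n \<and> (\<forall>g\<in>S. \<exists>w. awalk u g w) \<and>
     (\<forall>g\<in>S. \<forall>h\<in>S. prefix g h \<longrightarrow> g = h)"
proof (induction n arbitrary: u)
  case (Suc n)
  then have u: "u \<in> verts G" by (simp add: rebifurcating_def)
  obtain b where b: "b \<in> tree u" "bifurcation b"
    using Suc.prems tree_refl[OF u] by (auto simp: rebifurcating_def)
  obtain e f where ef: "e \<in> arcs G" "f \<in> arcs G" "tail G e = b" "tail G f = b" "e \<noteq> f"
    using b(2) by (auto simp: bifurcation_iff)
  obtain l where l: "awalk u l b" using b(1) by (auto simp: tree_awalk)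
  have le: "awalk u (l @ [e]) (head G e)" and lf: "awalk u (l @ [f]) (head G f)"
    using l ef by (auto simp: awalk_Cons_iff awalk_Nil_iff)
  have "head G f \<in> rebifurcating" using rebifurcating_tree[OF Suc.prems] lf tree_awalk by blast
  from Suc.IH[OF this] obtain S where S: "finite S" "card S = n" "\<forall>g\<in>S. \<exists>w. awalk (head G f) g w"
    "\<forall>g\<in>S. \<forall>h\<in>S. prefix g h \<longrightarrow> g = h" by blast
  let ?S = "insert (l @ [e]) ((\<lambda>g. l @ f # g) ` S)"
  have "l @ [e] \<notin> (\<lambda>g. l @ f # g) ` S" using ef(5) by auto
  moreover have "card ((\<lambda>g. l @ f # g) ` S) = n" using S(2) by (subst card_image) (auto simp: inj_on_def)
  ultimately have card: "card ?S = Suc n" using S(1) by simp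
  have aw: "\<exists>w. awalk u g w" if g: "g \<in> ?S" for g
  proof (cases "g = l @ [e]")
    case False
    then obtain h where h: "h \<in> S" "g = l @ f # h" using g by blast
    then obtain w where "awalk (head G f) h w" using S(3) by blast
    then have "awalk u g w" using h l ef by (auto simp: awalk_Cons_iff)
    then show ?thesis ..
  qed (use le in blast)
  have pre: "g = h" if "g \<in> ?S" "h \<in> ?S" "prefix g h" for g h
    using that S(4) ef(5) by auto
  show ?case
  proof (intro exI[of _ ?S] conjI ballI impI)
    show "finite ?S" using S(1) by simp
  qed (fact card, fact aw, fact pre)
qed (auto intro: exI[of _ "{}"])

end

lemma prefix_append_self_common:
  assumes "prefix g (t @ g)" "prefix h (t @ h)" "t \<noteq> []"
  shows "prefix g h \<or> prefix h g"
proof -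
  have pow: "prefix x ((concat (replicate n t)) @ x)" if "prefix x (t @ x)" for x n
  proof (induction n)
    case (Suc n)
    then have "prefix (t @ x) (t @ concat (replicate n t) @ x)" by simp
    with that show ?case by (simp add: prefix_order.trans[OF that])
  qed simp
  \<comment> \<open>Each copy of \<open>t\<close> has at least one letter, so this exponent makes
    \<open>T\<close> long enough to contain both \<open>g\<close> and \<open>h\<close> as
    prefixes.\<close>
  define T where "T = concat (replicate (length g + length h) t)"
  have len: "length T \<ge> length g + length h"
  proof -
    have "length T = (length g + length h) * length t" by (simp add: T_def length_concat sum_list_replicate)
    moreover have "length t \<ge> 1" using assms(3) by (cases t) auto
    ultimately show ?thesis by simp
  qed
  have "prefix g T" "prefix h T"
    using pow[OF assms(1), of "length g + length h"] pow[OF assms(2), of "length g + length h"] len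
    unfolding T_def[symmetric] by (auto intro: prefix_length_prefix)
  then show ?thesis using prefix_same_cases by blast
qed

section \<open>Reduction of nonzero elements to vertices\<close>

context leavitt
begin

text \<open>If a path \<open>g\<close> is a prefix of \<open>t @ g\<close> then it is a prefix of a power of \<open>t\<close>. So among more
  incomparable paths than there are closed paths in the sum, one annihilates them all.\<close>

lemma scalar_form_compress:
  assumes form: "scalar_form u k z" and u: "u \<in> rebifurcating"
  shows "\<exists>l x. awalk u l x \<and> gp u l * z * rp u l = k *s V x"
proof -
  obtain r where r: "r \<in> closed_span u" "z = k *s V u + r" using form by (auto simp: scalar_form_def)
  obtain T c where T: "finite T" "T \<subseteq> {rp u t | t. t \<noteq> [] \<and> awalk u t u}" "r = (\<Sum>a\<in>T. c a *s a)"
    using r(1) unfolding closed_span_def span_explicit by auto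
  have "\<forall>a\<in>T. \<exists>p. p \<noteq> [] \<and> awalk u p u \<and> rp u p = a" using T(2) by blast
  then obtain P where P: "\<And>a. a \<in> T \<Longrightarrow> P a \<noteq> []" "\<And>a. a \<in> T \<Longrightarrow> awalk u (P a) u"
    "\<And>a. a \<in> T \<Longrightarrow> rp u (P a) = a" by metis
  obtain S where S: "finite S" "card S = Suc (card T)" "\<forall>g\<in>S. \<exists>w. awalk u g w"
     "\<forall>g\<in>S. \<forall>h\<in>S. prefix g h \<longrightarrow> g = h" using incomparable_awalks[OF u] by blast
  have "\<exists>g\<in>S. \<forall>a\<in>T. \<not> prefix g (P a @ g)"
  proof (rule ccontr)
    assume "\<not> ?thesis"
    then have "\<forall>g\<in>S. \<exists>a\<in>T. prefix g (P a @ g)" by blast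
    then obtain h where h: "\<And>g. g \<in> S \<Longrightarrow> h g \<in> T" "\<And>g. g \<in> S \<Longrightarrow> prefix g (P (h g) @ g)" by metis
    have "\<not> inj_on h S" using card_inj_on_le[of h S T] h(1) T(1) S(2) by fastforce
    then obtain g g' where g: "g \<in> S" "g' \<in> S" "h g = h g'" "g \<noteq> g'" by (auto simp: inj_on_def)
    then have "prefix g g' \<or> prefix g' g"
      using prefix_append_self_common[OF h(2)[OF g(1)], of g'] h(2)[OF g(2)] P(1) h(1) by metis
    then show False using g S(4) by blast
  qed
  then obtain g where g: "g \<in> S" "\<And>a. a \<in> T \<Longrightarrow> \<not> prefix g (P a @ g)" by blast
  then obtain x where x: "awalk u g x" using S(3) by blast
  have zero: "gp u g * a * rp u g = 0" if a: "a \<in> T" for a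
  proof -
    have "gp u g * a * rp u g = gp u g * rp u (P a @ g)"
      using P(2,3)[OF a] x by (simp add: rp_append mult.assoc)
    moreover have "g \<parallel> P a @ g" using g(2)[OF a] P(1)[OF a] by (auto simp: parallel_def dest: prefix_length_le)
    moreover have "awalk u (P a @ g) x" using P(2)[OF a] x by auto
    ultimately show ?thesis using gp_rp_parallel[OF x] by metis
  qed
  have "gp u g * r * rp u g = (\<Sum>a\<in>T. c a *s (gp u g * a * rp u g))"
    by (simp add: T(3) sum_distrib_left sum_distrib_right scale_mult_left scale_mult_right)
  also have "\<dots> = 0" by (simp add: zero)
  finally have "gp u g * z * rp u g = k *s V x"
    using x by (simp add: r(2) distrib_left distrib_right scale_mult_left scale_mult_right gp_V_same gp_rp)
  with x show ?thesis by blast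
qed

text \<open>A scalar form below \<open>u\<close> is compressed to a nonzero multiple of a vertex and
  the scalar is inverted. The clause \<open>V u * b = b\<close> allows the factor \<open>V u\<close>
  to be put back between \<open>y\<close> and \<open>b\<close> when \<open>y\<close> is replaced by
  an element of the corner at \<open>u\<close>.\<close>

lemma reduction:
  assumes y: "y \<in> L" and u: "u \<in> rebifurcating" and nz: "y * V u \<noteq> 0"
  shows "\<exists>a\<in>L. \<exists>b\<in>L. \<exists>w\<in>tree u. a * y * b = V w \<and> V u * b = b"
proof -
  have uv: "u \<in> verts G" using u by (simp add: rebifurcating_def)
  obtain v p q x k where *: "awalk v p x" "awalk u q x" "k \<noteq> 0" "scalar_form x k (gp v p * y * rp u q)"
    using nonzero_scalar_form[OF y uv nz] by blast
  then have "x \<in> rebifurcating" using rebifurcating_tree[OF u] tree_awalk by blast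
  then obtain l w where l: "awalk x l w" "gp x l * (gp v p * y * rp u q) * rp x l = k *s V w"
    using scalar_form_compress[OF *(4)] by blast
  let ?a = "inverse k *s (gp x l * gp v p)" and ?b = "rp u q * rp x l"
  have "?a * y * ?b = inverse k *s (gp x l * (gp v p * y * rp u q) * rp x l)"
    by (simp add: scale_mult_left mult.assoc)
  also have "\<dots> = V w" using l(2) *(3) by simp
  finally have "?a * y * ?b = V w" .
  moreover have "V u * ?b = ?b" using V_rp_same[OF *(2)] by (simp flip: mult.assoc)
  moreover have "?a \<in> L" "?b \<in> L" using * l by simp_all
  moreover have "w \<in> tree u" using *(2) l(1) awalk_appendI tree_awalk by blast
  ultimately show ?thesis by blast
qed

end

section \<open>Ring-theoretic characterisation\<close>

text \<open>For an idempotent \<open>x\<close> this says that the corner at \<open>x\<close> has no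
  zero divisors. Written with products of five factors it makes sense for every \<open>x\<close>,
  and it mentions neither scalars nor an identity, so ring isomorphisms preserve it.\<close>

definition corner_domain :: "('a, 'm) ring_scheme \<Rightarrow> 'a \<Rightarrow> bool" where
  "corner_domain R x \<longleftrightarrow> (\<forall>a\<in>carrier R. \<forall>b\<in>carrier R.
     x \<otimes>\<^bsub>R\<^esub> a \<otimes>\<^bsub>R\<^esub> x \<otimes>\<^bsub>R\<^esub> b \<otimes>\<^bsub>R\<^esub> x = \<zero>\<^bsub>R\<^esub> \<longrightarrow> x \<otimes>\<^bsub>R\<^esub> a \<otimes>\<^bsub>R\<^esub> x = \<zero>\<^bsub>R\<^esub> \<or> x \<otimes>\<^bsub>R\<^esub> b \<otimes>\<^bsub>R\<^esub> x = \<zero>\<^bsub>R\<^esub>)"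

definition corner_divides :: "('a, 'm) ring_scheme \<Rightarrow> 'a \<Rightarrow> bool" where
  "corner_divides R x \<longleftrightarrow> (\<forall>a\<in>carrier R. x \<otimes>\<^bsub>R\<^esub> a \<otimes>\<^bsub>R\<^esub> x \<noteq> \<zero>\<^bsub>R\<^esub> \<longrightarrow>
     (\<exists>b\<in>carrier R. \<exists>c\<in>carrier R. b \<otimes>\<^bsub>R\<^esub> (x \<otimes>\<^bsub>R\<^esub> a \<otimes>\<^bsub>R\<^esub> x) \<otimes>\<^bsub>R\<^esub> c = x))"

definition distinguished :: "('a, 'm) ring_scheme \<Rightarrow> 'a set" where
  "distinguished R = {x \<in> carrier R. corner_domain R x \<or> corner_divides R x}"

text \<open>The middle factor ranges over the whole ring so that the set absorbs multiplication from
  the left as well as from the right.\<close>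

definition distinguished_annihilator :: "('a, 'm) ring_scheme \<Rightarrow> 'a set" where
  "distinguished_annihilator R =
     {y \<in> carrier R. \<forall>x\<in>distinguished R. \<forall>b\<in>carrier R. x \<otimes>\<^bsub>R\<^esub> b \<otimes>\<^bsub>R\<^esub> y = \<zero>\<^bsub>R\<^esub>}"

context row_finite_digraph
begin

lemma nonbifurcating_comparable:
  assumes "v \<in> nonbifurcating" "awalk v p a" "awalk v q b"
  shows "prefix p q \<or> prefix q p"
proof (rule ccontr)
  assume "\<not> ?thesis"
  then have "p \<parallel> q" by (simp add: parallel_def)
  then obtain as e p' f q' where pq: "e \<noteq> f" "p = as @ e # p'" "q = as @ f # q'"
    by (metis parallel_decomp)
  obtain w where w: "awalk v as w" using assms(2) pq by auto
  have "awalk w (e # p') a" "awalk w (f # q') b"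
    using assms(2,3) w pq awalk_suffix by blast+
  then have "bifurcation w" using pq(1) by (auto simp: bifurcation_iff awalk_Cons_iff)
  then show False using assms(1) w by (auto simp: nonbifurcating_def tree_awalk)
qed

end

context leavitt
begin

lemma LR_simps [simp]: "carrier LR = L" "x \<otimes>\<^bsub>LR\<^esub> y = x * y" "\<zero>\<^bsub>LR\<^esub> = 0" "x \<oplus>\<^bsub>LR\<^esub> y = x + y"
  by (simp_all add: LR_def)

text \<open>At every vertex of the path there is just one outgoing arc, so the sum in
  \<open>CK2\<close> has a single term.\<close>

lemma rp_gp_nonbifurcating: "v \<in> nonbifurcating \<Longrightarrow> awalk v p w \<Longrightarrow> rp v p * gp v p = V v"
proof (induction p arbitrary: v)
  case Nil
  then show ?case by (auto simp: awalk_Nil_iff V_V)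
next
  case (Cons e p)
  then have e: "e \<in> arcs G" "tail G e = v" "awalk (head G e) p w" by (auto simp: awalk_Cons_iff)
  have "head G e \<in> tree v" using e by (auto simp: tree_awalk awalk_Cons_iff awalk_Nil_iff intro!: exI[of _ "[e]"])
  then have IH: "rp (head G e) p * gp (head G e) p = V (head G e)"
    using Cons.IH[OF nonbifurcating_tree[OF Cons.prems(1)] e(3)] by blast
  have vv: "v \<in> verts G" using e by auto
  have "\<not> bifurcation v" using Cons.prems(1) tree_refl[OF vv] by (simp add: nonbifurcating_def)
  then have "out_arcs G v = {e}" using e by (auto simp: bifurcation_iff)
  then have "V v = X e * Y e" using CK2[OF vv] by simp
  also have "\<dots> = X e * V (head G e) * Y e" using e by (simp add: X_V)
  also have "\<dots> = rp v (e # p) * gp v (e # p)" by (simp add: mult.assoc flip: IH)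
  finally show ?case by simp
qed

lemma scalar_form_corner: "scalar_form u k z \<Longrightarrow> V u * z = z \<and> z * V u = z"
proof -
  assume "scalar_form u k z"
  then obtain r where u: "u \<in> verts G" and r: "r \<in> closed_span u" "z = k *s V u + r" by (auto simp: scalar_form_def)
  from V_closed_span[OF r(1) u] show ?thesis
    using u by (simp add: r distrib_left distrib_right scale_mult_left scale_mult_right V_V)
qed

text \<open>Without bifurcations the passage to a scalar form is invertible, because
  \<open>rp v p * gp v p\<close> and \<open>rp v q * gp v q\<close> are both
  \<open>V v\<close>.\<close>

lemma nonbifurcating_corner_form:
  assumes v: "v \<in> nonbifurcating" and y: "y \<in> L" "V v * y = y" "y * V v = y" "y \<noteq> 0"
  shows "\<exists>p q u k z. awalk v p u \<and> awalk v q u \<and> k \<noteq> 0 \<and> scalar_form u k z \<and> y = rp v p * z * gp v q"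
proof -
  have vv: "v \<in> verts G" using v by (simp add: nonbifurcating_def)
  obtain v' p q u k where *: "awalk v' p u" "awalk v q u" "k \<noteq> 0" "scalar_form u k (gp v' p * y * rp v q)"
    using nonzero_scalar_form[OF y(1) vv] y by auto
  have "v' = v"
  proof (rule ccontr)
    assume "v' \<noteq> v"
    then have "gp v' p * V v = 0" using gp_V[OF *(1) vv] by simp
    then have "gp v' p * y = 0" using y(2) by (metis mult.assoc mult_zero_left)
    then show False using *(3,4) scalar_form_zero by simp
  qed
  have "rp v p * (gp v p * y * rp v q) * gp v q = (rp v p * gp v p) * y * (rp v q * gp v q)"
    by (simp only: mult.assoc)
  also have "\<dots> = y" using rp_gp_nonbifurcating[OF v] * \<open>v' = v\<close> y by simp
  finally have eq: "y = rp v p * (gp v p * y * rp v q) * gp v q" by simp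
  show ?thesis
    using * \<open>v' = v\<close> eq by (intro exI[of _ p] exI[of _ q] exI[of _ u] exI[of _ k] exI[of _ "gp v p * y * rp v q"] conjI) simp_all
qed

text \<open>In the product of the two normal forms the paths \<open>q\<close> and \<open>p'\<close>
  are comparable, so \<open>gp v q * rp v p'\<close> is a real or a ghost path \<open>t\<close>.
  Multiplying by the adjoint of \<open>t\<close> on the outer side conjugates one of the scalar
  forms by \<open>t\<close>. What remains is a product of two scalar forms at one vertex, with
  nonzero scalar \<open>k * k'\<close>.\<close>

lemma nonbifurcating_corner_domain:
  assumes v: "v \<in> nonbifurcating" and y: "y \<in> L" "V v * y = y" "y * V v = y" "y \<noteq> 0"
    and y': "y' \<in> L" "V v * y' = y'" "y' * V v = y'" "y' \<noteq> 0"
  shows "y * y' \<noteq> 0"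
proof
  assume yy: "y * y' = 0"
  obtain p q u k z where z: "awalk v p u" "awalk v q u" "k \<noteq> 0" "scalar_form u k z" "y = rp v p * z * gp v q"
    using nonbifurcating_corner_form[OF v y] by blast
  obtain p' q' u' k' z' where z': "awalk v p' u'" "awalk v q' u'" "k' \<noteq> 0" "scalar_form u' k' z'" "y' = rp v p' * z' * gp v q'"
    using nonbifurcating_corner_form[OF v y'] by blast
  have "(gp v p * rp v p) * z * (gp v q * rp v p') * z' * (gp v q' * rp v q') = gp v p * (y * y') * rp v q'"
    by (simp only: z(5) z'(5) mult.assoc)
  also have "\<dots> = 0" by (simp add: yy)
  finally have "V u * z * (gp v q * rp v p') * (z' * V u') = 0"
    by (simp add: gp_rp[OF z(1)] gp_rp[OF z'(2)] mult.assoc)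
  then have 0: "z * (gp v q * rp v p') * z' = 0"
    using scalar_form_corner[OF z(4)] scalar_form_corner[OF z'(4)] by simp
  from nonbifurcating_comparable[OF v z(2) z'(1)] show False
  proof
    assume "prefix q p'"
    then obtain t where t: "p' = q @ t" by (auto simp: prefix_def)
    then have aw: "awalk u t u'" using z(2) z'(1) awalk_suffix by blast
    have "gp v q * rp v p' = rp u t" using gp_rp_append[OF z(2) aw] t by simp
    then have "(gp u t * z * rp u t) * z' = 0" using 0 by (simp add: mult.assoc)
    moreover have "scalar_form u' (k * k') ((gp u t * z * rp u t) * z')"
      by (rule scalar_form_mult[OF scalar_form_conj[OF z(4) aw] z'(4)])
    ultimately show False using scalar_form_zero z(3) z'(3) by fastforce
  next
    assume "prefix p' q"
    then obtain t where t: "q = p' @ t" by (auto simp: prefix_def)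
    then have aw: "awalk u' t u" using z(2) z'(1) awalk_suffix by blast
    have "gp v q * rp v p' = gp u' t" using gp_append_rp[OF z'(1) aw] t by simp
    then have "z * (gp u' t * z' * rp u' t) = 0" using 0 by (simp flip: mult.assoc)
    moreover have "scalar_form u (k * k') (z * (gp u' t * z' * rp u' t))"
      by (rule scalar_form_mult[OF z(4) scalar_form_conj[OF z'(4) aw]])
    ultimately show False using scalar_form_zero z(3) z'(3) by fastforce
  qed
qed

lemma nonbifurcating_distinguished:
  assumes "v \<in> nonbifurcating"
  shows "V v \<in> distinguished LR"
proof -
  have v: "v \<in> verts G" using assms by (simp add: nonbifurcating_def)
  have VV: "V v * V v = V v" "\<And>x. V v * (V v * x) = V v * x" using v by (simp_all add: V_V flip: mult.assoc)
  have "V v * a * V v = 0 \<or> V v * b * V v = 0"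
    if ab: "a \<in> L" "b \<in> L" "V v * a * V v * b * V v = 0" for a b
  proof (rule ccontr)
    assume "\<not> ?thesis"
    then have "(V v * a * V v) * (V v * b * V v) \<noteq> 0"
      using ab(1,2) v by (intro nonbifurcating_corner_domain[OF assms, of "V v * a * V v" "V v * b * V v"]) (simp_all add: mult.assoc VV)
    then show False using ab(3) by (simp add: mult.assoc VV)
  qed
  then show ?thesis using v by (simp add: distinguished_def corner_domain_def)
qed

text \<open>Reduction produces a vertex below \<open>x\<close> from any nonzero element of the
  corner, and a path from that vertex back to \<open>x\<close> turns it into
  \<open>V x\<close>.\<close>

lemma extreme_distinguished:
  assumes "x \<in> extreme_cycle_points"
  shows "V x \<in> distinguished LR"
proof -
  have x: "x \<in> verts G" "x \<in> rebifurcating"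
    using assms extreme_cycle_points_subset by (auto simp: extreme_cycle_points_def)
  have "\<exists>b\<in>L. \<exists>c\<in>L. b * (V x * a * V x) * c = V x" if a: "a \<in> L" "V x * a * V x \<noteq> 0" for a
  proof -
    have "V x * a \<in> L" "V x * a * V x \<noteq> 0" using a x by simp_all
    from reduction[OF this(1) x(2) this(2)] obtain b c w
      where w: "b \<in> L" "c \<in> L" "w \<in> tree x" "b * (V x * a) * c = V w" "V x * c = c" by blast
    then obtain l where l: "awalk w l x"
      using extreme_cycle_points_return[OF assms] by (auto simp: tree_awalk)
    have "(gp w l * b) * (V x * a * V x) * (c * rp w l) = gp w l * (b * (V x * a) * (V x * c)) * rp w l"
      by (simp only: mult.assoc)
    also have "\<dots> = V x" using w(4,5) gp_V_same[OF l] gp_rp[OF l] by simp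
    finally have "(gp w l * b) * (V x * a * V x) * (c * rp w l) = V x" .
    then show ?thesis using w l by (intro bexI[of _ "gp w l * b"] bexI[of _ "c * rp w l"]) simp_all
  qed
  then show ?thesis using x by (simp add: distinguished_def corner_divides_def)
qed

text \<open>A factorisation of \<open>V w\<close> through \<open>x\<close> is moved to one of a
  bifurcation \<open>u\<close>. There two distinct arcs \<open>e\<close> and \<open>f\<close> give
  nonzero orthogonal idempotents \<open>P e\<close> and \<open>P f\<close>, which are then
  transported into products \<open>x * b * x\<close>.\<close>

lemma corner_domain_not_rebifurcating:
  assumes x: "x \<in> L" "corner_domain LR x" and ad: "a \<in> L" "d \<in> L" "a * x * d = V w" and w: "w \<in> rebifurcating"
  shows False
proof -
  have wv: "w \<in> verts G" using w by (simp add: rebifurcating_def)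
  then obtain u where u: "u \<in> tree w" "bifurcation u" using w tree_refl by (auto simp: rebifurcating_def)
  then obtain l where l: "awalk w l u" by (auto simp: tree_awalk)
  obtain e f where ef: "e \<in> arcs G" "f \<in> arcs G" "tail G e = u" "tail G f = u" "e \<noteq> f"
    using u(2) by (auto simp: bifurcation_iff)
  define a' d' where "a' = gp w l * a" and "d' = d * rp w l"
  have "a' * x * d' = gp w l * (a * x * d) * rp w l" by (simp only: a'_def d'_def mult.assoc)
  also have "\<dots> = V u" using ad(3) l by (simp add: gp_V_same gp_rp)
  finally have axd: "a' * (x * d') = V u" by (simp add: mult.assoc)
  have a'L: "a' \<in> L" "d' \<in> L" using ad l by (simp_all add: a'_def d'_def)
  have axd': "a' * (x * (d' * y)) = V u * y" for y using axd by (simp flip: mult.assoc)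
  define P where "P e = X e * Y e" for e
  have uv: "u \<in> verts G" using ef by auto
  have VP: "V u * P e = P e" "P e * V u = P e" "V u * P f = P f" "P f * V u = P f"
    unfolding P_def using ef V_X[of e] V_X[of f] Y_V[of e] Y_V[of f]
    by (simp_all add: mult.assoc) (simp_all flip: mult.assoc)
  have VP': "V u * (P e * y) = P e * y" "V u * (P f * y) = P f * y" "V u * (V u * y) = V u * y" for y
    using VP uv by (simp_all add: V_V flip: mult.assoc)
  have PP: "P e * (P f * y) = 0" for y
  proof -
    have "P e * (P f * y) = X e * (Y e * X f) * (Y f * y)" by (simp only: P_def mult.assoc)
    then show ?thesis using ef by (simp add: Y_X)
  qed
  have P0: "P g \<noteq> 0" if "g \<in> arcs G" for g
  proof
    assume "P g = 0"
    then have "(Y g * X g) * (Y g * X g) = 0" by (metis P_def mult.assoc mult_zero_left mult_zero_right)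
    then show False using that V_neq_0 by (simp add: Y_X V_V)
  qed
  have PL: "P e \<in> L" "P f \<in> L" using ef by (simp_all add: P_def)
  \<comment> \<open>The map sending \<open>y\<close> to \<open>x * (d' * (y * a')) * x\<close> is
    undone on the corner at \<open>u\<close> by \<open>a'\<close> on the left and \<open>d'\<close>
    on the right. Thus \<open>A\<close>, \<open>B\<close>, \<open>C\<close> correspond to
    \<open>V u\<close>, \<open>P e\<close>, \<open>P f\<close>.\<close>
  define A B C where "A = d' * a'" and "B = d' * (P e * a')" and "C = d' * (P f * a')"
  have ABC: "A \<in> L" "B \<in> L" "C \<in> L" using a'L PL by (simp_all add: A_def B_def C_def)
  have dom: "x * b * x = 0 \<or> x * c * x = 0" if "b \<in> L" "c \<in> L" "x * b * x * c * x = 0" for b c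
    using x(2) that by (auto simp: corner_domain_def)
  \<comment> \<open>Between \<open>B\<close> and \<open>C\<close> the factor
    \<open>a' * x * d'\<close> becomes \<open>V u\<close>, which brings \<open>P e\<close> next to
    \<open>P f\<close>.\<close>
  have "x * A * x * (B * x * C * x * A) * x = 0"
    by (simp add: A_def B_def C_def mult.assoc axd' VP' PP)
  then have "x * A * x = 0 \<or> x * (B * x * C * x * A) * x = 0"
    using ABC x by (intro dom) simp_all
  moreover have "x * (B * x * C * x * A) * x = 0 \<Longrightarrow> x * B * x = 0 \<or> x * (C * x * A) * x = 0"
    using ABC x by (intro dom) (simp_all add: mult.assoc)
  moreover have "x * (C * x * A) * x = 0 \<Longrightarrow> x * C * x = 0 \<or> x * A * x = 0"
    using ABC x by (intro dom) (simp_all add: mult.assoc)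
  ultimately have "x * A * x = 0 \<or> x * B * x = 0 \<or> x * C * x = 0" by blast
  then have "a' * (x * A * x) * d' = 0 \<or> a' * (x * B * x) * d' = 0 \<or> a' * (x * C * x) * d' = 0" by auto
  moreover have "a' * (x * A * x) * d' = V u" "a' * (x * B * x) * d' = P e" "a' * (x * C * x) * d' = P f"
    using uv by (simp_all add: A_def B_def C_def mult.assoc axd axd' VP VP' V_V)
  ultimately show False using V_neq_0[OF uv] P0 ef by auto
qed

text \<open>The projection of \<open>g\<close> is carried into a product \<open>x * A * x\<close>
  and recovered from it by \<open>a\<close> and \<open>d\<close>, so this product is nonzero. Hence
  \<open>x\<close>, and with it \<open>a * x * d = V w\<close>, is a multiple of the
  projection.\<close>

lemma corner_divides_path:
  assumes x: "x \<in> L" "corner_divides LR x" and ad: "a \<in> L" "d \<in> L" "a * x * d = V w" and g: "awalk w g u"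
  shows "\<exists>b\<in>L. \<exists>c\<in>L. b * (rp w g * gp w g) * c = V w"
proof -
  define P where "P = rp w g * gp w g"
  have PL: "P \<in> L" using g by (simp add: P_def)
  have wv: "w \<in> verts G" using g by (rule awalk_hd_in_verts)
  have VP: "V w * P = P" "P * V w = P"
    using V_rp_same[OF g] gp_V_same[OF g] by (simp_all add: P_def mult.assoc) (simp flip: mult.assoc)
  have P0: "P \<noteq> 0"
  proof
    assume "P = 0"
    then have "(gp w g * rp w g) * (gp w g * rp w g) = 0" by (metis P_def mult.assoc mult_zero_left mult_zero_right)
    then show False using g V_neq_0 awalk_last_in_verts[OF g] by (simp add: gp_rp V_V)
  qed
  have axd: "a * (x * d) = V w" using ad(3) by (simp add: mult.assoc)
  have axd': "a * (x * (d * y)) = V w * y" for y using axd by (simp flip: mult.assoc)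
  have VP': "V w * (P * y) = P * y" "P * (V w * y) = P * y" "V w * (V w * y) = V w * y" for y
    using VP wv by (simp_all add: V_V flip: mult.assoc)
  define A where "A = d * (P * a)"
  have AL: "A \<in> L" using ad PL by (simp add: A_def)
  have "a * (x * A * x) * d = P" by (simp add: A_def mult.assoc axd axd' VP VP')
  then have "x * A * x \<noteq> 0" using P0 by auto
  then obtain b c where bc: "b \<in> L" "c \<in> L" "b * (x * A * x) * c = x"
    using x(2) AL by (auto simp: corner_divides_def)
  have "(a * b * x * d) * P * (a * x * c * d) = a * (b * (x * A * x) * c) * d"
    by (simp only: A_def mult.assoc)
  also have "\<dots> = V w" using bc(3) axd by (simp add: mult.assoc)
  finally show ?thesis unfolding P_def[symmetric] using bc ad x by (intro bexI[of _ "a * b * x * d"] bexI[of _ "a * x * c * d"]) simp_all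
qed

end

section \<open>Corners over acyclic trees\<close>

text \<open>Square matrices over a field that are right inverse are left inverse. The index set is
  arbitrary because paths will serve as indices.\<close>

lemma one_sided_inverse_sum:
  fixes A B :: "'i \<Rightarrow> 'i \<Rightarrow> 'k::field"
  assumes Z: "finite Z"
    and AB: "\<And>i k. i \<in> Z \<Longrightarrow> k \<in> Z \<Longrightarrow> (\<Sum>j\<in>Z. A i j * B j k) = (if i = k then 1 else 0)"
    and "i \<in> Z" "k \<in> Z"
  shows "(\<Sum>j\<in>Z. B i j * A j k) = (if i = k then 1 else 0)"
proof -
  define n where "n = card Z"
  obtain h where h: "bij_betw h {..<n} Z"
    using ex_bij_betw_nat_finite[OF Z] by (auto simp: n_def atLeast0LessThan)
  have reindex: "(\<Sum>j\<in>Z. g j) = (\<Sum>j = 0..<n. g (h j))" for g :: "'i \<Rightarrow> 'k"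
    using sum.reindex_bij_betw[OF h, of g] by (simp add: atLeast0LessThan)
  have hZ: "h a \<in> Z" if "a < n" for a using h that by (auto dest: bij_betwE)
  have inj: "h a = h b \<longleftrightarrow> a = b" if "a < n" "b < n" for a b
    using h that by (auto simp: bij_betw_def inj_on_def)
  define M where "M C = mat n n (\<lambda>(a, b). C (h a) (h b))" for C :: "'i \<Rightarrow> 'i \<Rightarrow> 'k"
  have M: "M C \<in> carrier_mat n n" for C by (simp add: M_def)
  have MM: "(M C * M D) $$ (a, b) = (\<Sum>j\<in>Z. C (h a) j * D j (h b))" if "a < n" "b < n" for C D a b
    using that by (simp add: M_def scalar_prod_def reindex)
  have "M A * M B = 1\<^sub>m n"
  proof (rule eq_matI)
    fix a b assume "a < dim_row (1\<^sub>m n :: 'k mat)" "b < dim_col (1\<^sub>m n :: 'k mat)"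
    then show "(M A * M B) $$ (a, b) = 1\<^sub>m n $$ (a, b)"
      by (simp add: MM AB hZ inj)
  qed (simp_all add: M_def)
  then have BA: "M B * M A = 1\<^sub>m n" by (rule mat_mult_left_right_inverse[OF M M])
  obtain a b where "a < n" "b < n" "i = h a" "k = h b"
    using h assms(3,4) unfolding bij_betw_def by blast
  then show ?thesis using MM[of a b B A] BA by (simp add: inj)
qed

context row_finite_digraph
begin

lemma return_imp_cycle:
  assumes e: "e \<in> arcs G" "tail G e \<in> tree (head G e)"
  shows "\<exists>c. cycle c \<and> tail G e \<in> path_sources c"
proof -
  obtain q where q: "apath (head G e) q (tail G e)"
    using e(2) by (auto simp: tree_def reachable_apath)
  then have "cycle (e # q)"
    using e(1) unfolding cycle_def apath_def
    by (intro exI[of _ "tail G e"]) (simp add: awalk_Cons_iff)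
  then show ?thesis by (intro exI[of _ "e # q"]) (simp add: path_sources_def)
qed

text \<open>Paths cut at their first vertex outside \<open>U\<close>. Cutting at a fixed length
  would not do: cancelling paths of different lengths from both sides may leave a nontrivial path,
  whereas all remainders here are again exit paths of a common vertex, hence equal or
  incomparable.\<close>

definition exit_paths :: "'a set \<Rightarrow> 'a \<Rightarrow> 'b list set" where
  "exit_paths U u = {q. \<exists>x. awalk u q x \<and> x \<notin> U \<and> path_sources q \<subseteq> U}"

lemma exit_paths_prefix:
  assumes "p \<in> exit_paths U u" "awalk u q x" "path_sources q \<subseteq> U" "prefix p q"
  shows "p = q"
proof -
  obtain t where t: "q = p @ t" using assms(4) by (auto simp: prefix_def)
  obtain y where y: "awalk u p y" "y \<notin> U" using assms(1) by (auto simp: exit_paths_def)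
  have "awalk y t x" using assms(2) y(1) unfolding t by (rule awalk_suffix)
  then show ?thesis using t y(2) assms(3) by (cases t) (auto simp: awalk_Cons_iff path_sources_def)
qed

lemma exit_paths_suffix:
  assumes "p @ t \<in> exit_paths U u" "awalk u p v"
  shows "t \<in> exit_paths U v"
proof -
  obtain x where x: "awalk u (p @ t) x" "x \<notin> U" "path_sources (p @ t) \<subseteq> U"
    using assms(1) by (auto simp: exit_paths_def)
  have "awalk v t x" using x(1) assms(2) by (rule awalk_suffix)
  moreover have "path_sources t \<subseteq> U" using x(3) by (auto simp: path_sources_def)
  ultimately show ?thesis using x(2) unfolding exit_paths_def by blast
qed

lemma exit_paths_outside:
  assumes "u \<in> verts G" "u \<notin> U"
  shows "exit_paths U u = {[]}"
proof -
  have "q = []" if "q \<in> exit_paths U u" for q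
    using that assms by (cases q) (auto simp: exit_paths_def path_sources_def awalk_Cons_iff)
  moreover have "[] \<in> exit_paths U u" using assms by (auto simp: exit_paths_def path_sources_def awalk_Nil_iff)
  ultimately show ?thesis by blast
qed

lemma exit_paths_inside:
  assumes "u \<in> U"
  shows "exit_paths U u = (\<Union>e\<in>out_arcs G u. (#) e ` exit_paths U (head G e))"
proof (intro equalityI subsetI)
  fix q assume q: "q \<in> exit_paths U u"
  then obtain e t where "q = e # t" using assms by (cases q) (auto simp: exit_paths_def awalk_Nil_iff)
  moreover from this have "e \<in> out_arcs G u" "t \<in> exit_paths U (head G e)"
    using q by (auto simp: exit_paths_def path_sources_def awalk_Cons_iff)
  ultimately show "q \<in> (\<Union>e\<in>out_arcs G u. (#) e ` exit_paths U (head G e))" by blast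
next
  fix q assume "q \<in> (\<Union>e\<in>out_arcs G u. (#) e ` exit_paths U (head G e))"
  then show "q \<in> exit_paths U u"
    using assms by (auto simp: exit_paths_def path_sources_def awalk_Cons_iff)
qed

end

context leavitt
begin

text \<open>The induction terminates since an arc leaving \<open>u\<close> in \<open>U\<close>
  removes \<open>u\<close> from the tree, by acyclicity. A sink inside \<open>U\<close> would have
  no exit path at all, so sinks have to be excluded.\<close>

lemma V_eq_sum_exit_paths:
  assumes "finite U" "u \<in> tree w" and sink: "\<And>x. x \<in> tree w \<Longrightarrow> out_arcs G x \<noteq> {}"
    and acyclic: "\<And>c x. x \<in> tree w \<Longrightarrow> cycle c \<Longrightarrow> x \<notin> path_sources c"
  shows "finite (exit_paths U u) \<and> V u = (\<Sum>q\<in>exit_paths U u. rp u q * gp u q)"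
  using assms(2)
proof (induction "card (U \<inter> tree u)" arbitrary: u rule: less_induct)
  case less
  have uv: "u \<in> verts G" using less.prems by (rule tree_verts)
  show ?case
  proof (cases "u \<in> U")
    case False
    then show ?thesis using uv by (simp add: exit_paths_outside V_V)
  next
    case True
    have IH: "finite (exit_paths U (head G e)) \<and>
        V (head G e) = (\<Sum>q\<in>exit_paths U (head G e). rp (head G e) q * gp (head G e) q)"
      if e: "e \<in> out_arcs G u" for e
    proof -
      have he: "head G e \<in> tree u" using e by (auto simp: tree_awalk awalk_Cons_iff awalk_Nil_iff intro!: exI[of _ "[e]"])
      have "u \<notin> tree (head G e)" using return_imp_cycle[of e] acyclic[OF less.prems] e by auto
      then have "U \<inter> tree (head G e) \<subset> U \<inter> tree u"
        using tree_trans[OF he] tree_refl[OF uv] True by blast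
      then have "card (U \<inter> tree (head G e)) < card (U \<inter> tree u)"
        using assms(1) by (intro psubset_card_mono) auto
      from less.hyps[OF this tree_trans[OF less.prems he]] show ?thesis .
    qed
    from V_eq_sum_out_arcs[OF uv sink[OF less.prems], of "exit_paths U", OF this]
    show ?thesis unfolding exit_paths_inside[OF True] by blast
  qed
qed

text \<open>If both inner paths are prefixes of the outer ones, the remainders \<open>s\<close> and
  \<open>t\<close> are exit paths of the same vertex; equal remainders give a vertex, different ones
  zero. Otherwise one of the two outer products already vanishes.\<close>

lemma exit_paths_matrix_unit:
  assumes p: "awalk w p v" "path_sources p \<subseteq> U" and p': "p' \<in> exit_paths U w" "awalk w p' x"
    and q: "awalk w q v" "path_sources q \<subseteq> U" and q': "q' \<in> exit_paths U w" "awalk w q' y"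
  shows "\<exists>k. gp w p' * (rp w p * gp w q) * rp w q' = k *s V x \<and> (x \<noteq> y \<longrightarrow> k = 0)"
proof (cases "prefix p p' \<and> prefix q q'")
  case True
  then obtain s t where st: "p' = p @ s" "q' = q @ t" by (auto simp: prefix_def)
  have s: "awalk v s x" and t: "awalk v t y"
    using p'(2) q'(2) p(1) q(1) awalk_suffix unfolding st by blast+
  have eq: "gp w p' * (rp w p * gp w q) * rp w q' = gp v s * rp v t"
    using gp_append_rp[OF p(1) s] gp_rp_append[OF q(1) t] unfolding st by (simp add: mult.assoc) (simp flip: mult.assoc)
  show ?thesis
  proof (cases "s = t")
    case True
    then have "x = y" using s t by (auto dest: awalk_ends_eqD)
    then show ?thesis using eq gp_rp[OF s] True by (intro exI[of _ 1]) simp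
  next
    case False
    have es: "s \<in> exit_paths U v" "t \<in> exit_paths U v"
      using exit_paths_suffix p'(1) q'(1) p(1) q(1) unfolding st by blast+
    then have "\<not> prefix s t" "\<not> prefix t s"
      using exit_paths_prefix[OF es(1) t] exit_paths_prefix[OF es(2) s] False
      by (auto simp: exit_paths_def)
    then have "gp v s * rp v t = 0" using gp_rp_parallel[OF s t] by (simp add: parallel_def)
    then show ?thesis using eq by (intro exI[of _ 0]) simp
  qed
next
  case False
  have "gp w p' * rp w p = 0 \<or> gp w q * rp w q' = 0"
  proof (cases "prefix p p'")
    case True
    then have "\<not> prefix q q'" using False by blast
    moreover have "\<not> prefix q' q" using exit_paths_prefix[OF q'(1) q] \<open>\<not> prefix q q'\<close> by auto
    ultimately show ?thesis using gp_rp_parallel[OF q(1) q'(2)] by (simp add: parallel_def)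
  next
    case False
    moreover have "\<not> prefix p' p" using exit_paths_prefix[OF p'(1) p] False by auto
    ultimately show ?thesis using gp_rp_parallel[OF p'(2) p(1)] by (simp add: parallel_def)
  qed
  moreover have "gp w p' * (rp w p * gp w q) * rp w q' = (gp w p' * rp w p) * (gp w q * rp w q')"
    by (simp only: mult.assoc)
  ultimately have "gp w p' * (rp w p * gp w q) * rp w q' = 0" by auto
  then show ?thesis by (intro exI[of _ 0]) simp
qed

text \<open>With \<open>V w\<close> expanded over exit paths, \<open>gp w p * t * rp w q\<close> is
  the matrix entry of \<open>t\<close> at \<open>p\<close> and \<open>q\<close>. The clause on
  \<open>x\<close> and \<open>y\<close> says that the matrix has one block for each end
  vertex.\<close>

definition scalar_entries :: "'v \<Rightarrow> 'v set \<Rightarrow> 'r \<Rightarrow> bool" where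
  "scalar_entries w U t \<longleftrightarrow> (\<forall>p\<in>exit_paths U w. \<forall>q\<in>exit_paths U w. \<forall>x y.
     awalk w p x \<longrightarrow> awalk w q y \<longrightarrow> (\<exists>k. gp w p * t * rp w q = k *s V x \<and> (x \<noteq> y \<longrightarrow> k = 0)))"

lemma scalar_entries_zero: "scalar_entries w U 0"
  unfolding scalar_entries_def by (intro ballI allI impI exI[of _ 0]) simp

lemma scalar_entries_scale: "scalar_entries w U t \<Longrightarrow> scalar_entries w U (c *s t)"
  unfolding scalar_entries_def
proof (intro ballI allI impI)
  fix p q x y
  assume *: "\<forall>p\<in>exit_paths U w. \<forall>q\<in>exit_paths U w. \<forall>x y.
     awalk w p x \<longrightarrow> awalk w q y \<longrightarrow> (\<exists>k. gp w p * t * rp w q = k *s V x \<and> (x \<noteq> y \<longrightarrow> k = 0))"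
    and "p \<in> exit_paths U w" "q \<in> exit_paths U w" "awalk w p x" "awalk w q y"
  then obtain k where "gp w p * t * rp w q = k *s V x" "x \<noteq> y \<longrightarrow> k = 0" by blast
  then show "\<exists>k. gp w p * (c *s t) * rp w q = k *s V x \<and> (x \<noteq> y \<longrightarrow> k = 0)"
    by (intro exI[of _ "c * k"]) (simp add: scale_mult_left scale_mult_right)
qed

lemma scalar_entries_add:
  assumes "scalar_entries w U s" "scalar_entries w U t"
  shows "scalar_entries w U (s + t)"
  unfolding scalar_entries_def
proof (intro ballI allI impI)
  fix p q x y assume *: "p \<in> exit_paths U w" "q \<in> exit_paths U w" "awalk w p x" "awalk w q y"
  then obtain k where "gp w p * s * rp w q = k *s V x" "x \<noteq> y \<longrightarrow> k = 0"
    using assms(1) unfolding scalar_entries_def by blast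
  moreover obtain k' where "gp w p * t * rp w q = k' *s V x" "x \<noteq> y \<longrightarrow> k' = 0"
    using assms(2) * unfolding scalar_entries_def by blast
  ultimately show "\<exists>k. gp w p * (s + t) * rp w q = k *s V x \<and> (x \<noteq> y \<longrightarrow> k = 0)"
    by (intro exI[of _ "k + k'"]) (simp add: distrib_left distrib_right scale_left_distrib)
qed

lemma scalar_entries_monomial:
  assumes pq: "awalk a p c" "awalk b q c" and U: "path_sources p \<union> path_sources q \<subseteq> U"
  shows "scalar_entries w U (rp a p * gp b q)"
  unfolding scalar_entries_def
proof (intro ballI allI impI)
  fix p' q' x y assume 1: "p' \<in> exit_paths U w" and 2: "q' \<in> exit_paths U w"
    and aw: "awalk w p' x" "awalk w q' y"
  show "\<exists>k. gp w p' * (rp a p * gp b q) * rp w q' = k *s V x \<and> (x \<noteq> y \<longrightarrow> k = 0)"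
  proof (cases "a = w \<and> b = w")
    case True
    then show ?thesis using exit_paths_matrix_unit[OF _ _ 1 aw(1) _ _ 2 aw(2)] pq U by simp
  next
    case False
    have "gp w p' * (rp a p * gp b q) * rp w q' = (gp w p' * rp a p) * (gp b q * rp w q')"
      by (simp only: mult.assoc)
    also have "\<dots> = 0" using False gp_rp_neq[OF aw(1) pq(1)] gp_rp_neq[OF pq(2) aw(2)] by auto
    finally show ?thesis by (intro exI[of _ 0]) simp
  qed
qed

text \<open>Holding for every larger \<open>U\<close>, this lets two elements be represented by
  matrices over the same set of paths.\<close>

lemma eventually_scalar_entries:
  assumes "t \<in> L"
  shows "\<exists>U0. finite U0 \<and> (\<forall>U. finite U \<and> U0 \<subseteq> U \<longrightarrow> scalar_entries w U t)"
  using assms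
proof (induction rule: L_induct)
  case zero
  show ?case by (intro exI[of _ "{}"]) (simp add: scalar_entries_zero)
next
  case (monomial a p b q c)
  show ?case
  proof (intro exI[of _ "path_sources p \<union> path_sources q"] conjI allI impI)
    show "finite (path_sources p \<union> path_sources q)" by (simp add: path_sources_def)
  qed (rule scalar_entries_monomial[OF monomial], simp)
next
  case (scale c t)
  from scale(2) show ?case by (elim ex_forward) (simp add: scalar_entries_scale)
next
  case (add s t)
  from add(3) obtain U1 where U1: "finite U1 \<and> (\<forall>U. finite U \<and> U1 \<subseteq> U \<longrightarrow> scalar_entries w U s)" ..
  from add(4) obtain U2 where U2: "finite U2 \<and> (\<forall>U. finite U \<and> U2 \<subseteq> U \<longrightarrow> scalar_entries w U t)" ..
  show ?case
  proof (intro exI[of _ "U1 \<union> U2"] conjI allI impI)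
    show "finite (U1 \<union> U2)" using U1 U2 by simp
  qed (rule scalar_entries_add, simp_all add: U1 U2)
qed

text \<open>Over a tree without cycles the corner at \<open>w\<close> is locally a product of matrix algebras, so one-sided
  inverses are two-sided.\<close>

lemma acyclic_corner_directly_finite:
  assumes w: "w \<in> verts G" and sink: "\<And>x. x \<in> tree w \<Longrightarrow> out_arcs G x \<noteq> {}"
    and acyclic: "\<And>c x. x \<in> tree w \<Longrightarrow> cycle c \<Longrightarrow> x \<notin> path_sources c"
    and s: "s \<in> L" "V w * s = s" "s * V w = s" and t: "t \<in> L" "V w * t = t" "t * V w = t"
    and ts: "t * s = V w"
  shows "s * t = V w"
proof -
  obtain U1 where U1: "finite U1" "\<And>U. finite U \<Longrightarrow> U1 \<subseteq> U \<Longrightarrow> scalar_entries w U s"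
    using eventually_scalar_entries[OF s(1), of w] by blast
  obtain U2 where U2: "finite U2" "\<And>U. finite U \<Longrightarrow> U2 \<subseteq> U \<Longrightarrow> scalar_entries w U t"
    using eventually_scalar_entries[OF t(1), of w] by blast
  define U where "U = U1 \<union> U2"
  have U: "finite U" "scalar_entries w U s" "scalar_entries w U t" using U1 U2 by (simp_all add: U_def)
  define Z where "Z = exit_paths U w"
  have Z: "finite Z" "V w = (\<Sum>q\<in>Z. rp w q * gp w q)"
    using V_eq_sum_exit_paths[OF U(1) tree_refl[OF w] sink acyclic] unfolding Z_def by blast+
  have "\<forall>p\<in>Z. \<exists>x. awalk w p x" by (auto simp: Z_def exit_paths_def)
  then obtain r where r: "\<And>p. p \<in> Z \<Longrightarrow> awalk w p (r p)" by metis
  have rv: "r p \<in> verts G" if "p \<in> Z" for p using r[OF that] by (rule awalk_last_in_verts)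
  have coef: "\<exists>A. \<forall>p\<in>Z. \<forall>q\<in>Z. gp w p * y * rp w q = A p q *s V (r p) \<and> (r p \<noteq> r q \<longrightarrow> A p q = 0)"
    if y: "scalar_entries w U y" for y
  proof -
    have "\<forall>p\<in>Z. \<forall>q\<in>Z. \<exists>k. gp w p * y * rp w q = k *s V (r p) \<and> (r p \<noteq> r q \<longrightarrow> k = 0)"
      using y r unfolding scalar_entries_def Z_def[symmetric] by blast
    then show ?thesis by metis
  qed
  obtain S where S: "\<And>p q. p \<in> Z \<Longrightarrow> q \<in> Z \<Longrightarrow> gp w p * s * rp w q = S p q *s V (r p)"
    "\<And>p q. p \<in> Z \<Longrightarrow> q \<in> Z \<Longrightarrow> r p \<noteq> r q \<Longrightarrow> S p q = 0" using coef[OF U(2)] by blast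
  obtain T where T: "\<And>p q. p \<in> Z \<Longrightarrow> q \<in> Z \<Longrightarrow> gp w p * t * rp w q = T p q *s V (r p)"
    "\<And>p q. p \<in> Z \<Longrightarrow> q \<in> Z \<Longrightarrow> r p \<noteq> r q \<Longrightarrow> T p q = 0" using coef[OF U(3)] by blast
  \<comment> \<open>Inserting the expansion of \<open>V w\<close> between the factors gives matrix
    multiplication; summands whose paths end at different vertices vanish on both sides.\<close>
  have prod: "gp w p * (a * b) * rp w q = (\<Sum>j\<in>Z. A p j * B j q) *s V (r p)"
    if pq: "p \<in> Z" "q \<in> Z" and ab: "a * V w = a"
      and A: "\<And>p q. p \<in> Z \<Longrightarrow> q \<in> Z \<Longrightarrow> gp w p * a * rp w q = A p q *s V (r p)"
      "\<And>p q. p \<in> Z \<Longrightarrow> q \<in> Z \<Longrightarrow> r p \<noteq> r q \<Longrightarrow> A p q = 0"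
      and B: "\<And>p q. p \<in> Z \<Longrightarrow> q \<in> Z \<Longrightarrow> gp w p * b * rp w q = B p q *s V (r p)"
    for p q a b A B
  proof -
    have "gp w p * (a * b) * rp w q = gp w p * (a * V w * b) * rp w q" by (simp only: ab)
    also have "\<dots> = (\<Sum>j\<in>Z. (gp w p * a * rp w j) * (gp w j * b * rp w q))"
      unfolding Z(2) by (simp add: sum_distrib_left sum_distrib_right mult.assoc)
    also have "\<dots> = (\<Sum>j\<in>Z. (A p j * B j q) *s V (r p))"
    proof (rule sum.cong[OF refl])
      fix j assume j: "j \<in> Z"
      have "(gp w p * a * rp w j) * (gp w j * b * rp w q) = (A p j * B j q) *s (V (r p) * V (r j))"
        using A(1)[OF pq(1) j] B[OF j pq(2)] by (simp add: scale_mult_left scale_mult_right mult.commute)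
      also have "\<dots> = (A p j * B j q) *s V (r p)"
        using A(2)[OF pq(1) j] rv[OF pq(1)] by (cases "r p = r j") (simp_all add: V_V)
      finally show "(gp w p * a * rp w j) * (gp w j * b * rp w q) = (A p j * B j q) *s V (r p)" .
    qed
    finally show ?thesis by (simp add: scale_sum_left)
  qed
  have unit: "gp w p * V w * rp w q = (if p = q then 1 else 0) *s V (r p)" if pq: "p \<in> Z" "q \<in> Z" for p q
  proof (cases "p = q")
    case False
    have "\<not> prefix p q" "\<not> prefix q p"
      using exit_paths_prefix[of p U w q "r q"] exit_paths_prefix[of q U w p "r p"] r pq False
      unfolding Z_def by (auto simp: exit_paths_def)
    then have "gp w p * rp w q = 0" using gp_rp_parallel[OF r[OF pq(1)] r[OF pq(2)]] by (simp add: parallel_def)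
    then show ?thesis using False gp_V_same[OF r[OF pq(1)]] by simp
  qed (use r[OF pq(1)] in \<open>simp add: gp_V_same gp_rp\<close>)
  have "(\<Sum>j\<in>Z. T p j * S j q) = (if p = q then 1 else 0)" if pq: "p \<in> Z" "q \<in> Z" for p q
  proof -
    have "(\<Sum>j\<in>Z. T p j * S j q) *s V (r p) = gp w p * (t * s) * rp w q"
      by (rule prod[OF pq t(3) T S(1), symmetric])
    also have "\<dots> = (if p = q then 1 else 0) *s V (r p)" unfolding ts by (rule unit[OF pq])
    finally have "((\<Sum>j\<in>Z. T p j * S j q) - (if p = q then 1 else 0)) *s V (r p) = 0"
      by (simp only: scale_left_diff_distrib) simp
    then have "(\<Sum>j\<in>Z. T p j * S j q) - (if p = q then 1 else 0) = 0"
      using scale_V_eq_0[OF rv[OF pq(1)]] by (simp only:)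
    then show ?thesis by (rule eq_iff_diff_eq_0[THEN iffD2])
  qed
  from one_sided_inverse_sum[OF Z(1) this]
  have ST: "(\<Sum>j\<in>Z. S p j * T j q) = (if p = q then 1 else 0)" if "p \<in> Z" "q \<in> Z" for p q
    using that by blast
  have st: "gp w p * (s * t) * rp w q = gp w p * V w * rp w q" if pq: "p \<in> Z" "q \<in> Z" for p q
    using prod[OF pq s(3) S T(1)] unfolding ST[OF pq] unit[OF pq] .
  \<comment> \<open>An element of the corner is recovered from its matrix entries, so equal entries
    give equal elements.\<close>
  have expand: "V w * y * V w = (\<Sum>p\<in>Z. \<Sum>q\<in>Z. rp w p * (gp w p * y * rp w q) * gp w q)" for y
    by (simp add: Z(2) sum_distrib_left sum_distrib_right mult.assoc) (rule sum.swap)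
  have "s * t = V w * (s * t) * V w" using s(2) t(3) by (simp add: mult.assoc) (simp flip: mult.assoc)
  also have "\<dots> = (\<Sum>p\<in>Z. \<Sum>q\<in>Z. rp w p * (gp w p * V w * rp w q) * gp w q)"
    unfolding expand by (intro sum.cong refl) (simp only: st)
  also have "\<dots> = V w * V w * V w" by (rule expand[symmetric])
  also have "\<dots> = V w" using w by (simp add: V_V)
  finally show ?thesis .
qed

text \<open>The divisibility has two uses. It puts \<open>V w\<close> into the ideal of every vertex
  below \<open>w\<close>, which is contradictory when there is a cycle below \<open>w\<close>. It
  also compares \<open>V w\<close> with the projection of a path, which is contradictory when there
  is none.\<close>

lemma pure_infinite_not_path_divisible:
  assumes w: "w \<in> pure_infinite_bifurcations"
    and div: "\<And>g u. awalk w g u \<Longrightarrow> \<exists>b\<in>L. \<exists>c\<in>L. b * (rp w g * gp w g) * c = V w"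
  shows False
proof -
  have wv: "w \<in> verts G" using w by (simp add: pure_infinite_bifurcations_def)
  have wr: "w \<in> rebifurcating" using w pure_infinite_bifurcations_subset by blast
  show False
  proof (cases "\<exists>c v. v \<in> tree w \<and> cycle c \<and> v \<in> path_sources c")
    case True
    then obtain c v where v: "v \<in> tree w" and c: "cycle c" "v \<in> path_sources c" by blast
    have vv: "v \<in> verts G" using v by (rule tree_verts)
    have nx: "x \<notin> cycle_points \<union> extreme_cycle_points" if "x \<in> tree w" for x
      using w that by (auto simp: pure_infinite_bifurcations_def tree_def)
    have ex: "\<exists>e. path_exit c e" using nx[OF v] c vv by (auto simp: cycle_points_def)
    have "\<not> extreme_cycle c" using nx[OF v] c vv by (auto simp: extreme_cycle_points_def)
    then obtain u p w1 where u: "u \<in> path_sources c" "awalk u p w1"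
      and no: "\<And>q x. x \<in> path_sources c \<Longrightarrow> \<not> awalk u (p @ q) x"
      using c(1) ex unfolding extreme_cycle_def by blast
    have "u \<in> tree w" using tree_trans[OF v cycle_tree[OF c u(1)]] .
    then have w1: "w1 \<in> tree w" using tree_trans u(2) tree_awalk by blast
    have nv: "v \<notin> tree w1"
    proof
      assume "v \<in> tree w1"
      then obtain q where "awalk w1 q v" by (auto simp: tree_awalk)
      then have "awalk u (p @ q) v" using u(2) by auto
      then show False using no c(2) by blast
    qed
    \<comment> \<open>The vertices that reach the cycle. The path leaving the cycle for good ends at
      \<open>w1\<close> outside \<open>W\<close>, while \<open>w\<close> lies inside.\<close>
    define W where "W = {y \<in> verts G. v \<in> tree y}"
    have arc: "head G e \<in> tree (tail G e)" if "e \<in> arcs G" for e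
      using that by (auto simp: tree_awalk awalk_Cons_iff awalk_Nil_iff intro!: exI[of _ "[e]"])
    \<comment> \<open>Another vertex of \<open>W\<close> continues along a path to \<open>v\<close>;
      \<open>v\<close> itself continues along the cycle, and this is why \<open>v\<close> was taken
      on one.\<close>
    have out: "\<exists>e\<in>out_arcs G y. head G e \<in> W" if y: "y \<in> W" for y
    proof (cases "y = v")
      case True
      obtain a where a: "a \<in> set c" "tail G a = v" using c(2) by (auto simp: path_sources_def)
      obtain c1 c2 where c12: "c = c1 @ a # c2" using a(1) by (metis split_list)
      obtain z where "awalk z c z" using c(1) by (auto simp: cycle_def)
      then have aw: "awalk (head G a) c2 z" "awalk z c1 v" "a \<in> arcs G"
        using a(2) unfolding c12 by (auto simp: awalk_Cons_iff)
      then have "awalk (head G a) (c2 @ c1) v" by auto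
      then have "v \<in> tree (head G a)" unfolding tree_awalk by blast
      then have "head G a \<in> W" using aw by (auto simp: W_def)
      then show ?thesis using aw a True by auto
    next
      case False
      obtain p where p: "awalk y p v" using y by (auto simp: W_def tree_awalk)
      then obtain e p' where "p = e # p'" using False by (cases p) (auto simp: awalk_Nil_iff)
      then have "e \<in> out_arcs G y" "awalk (head G e) p' v" using p by (auto simp: awalk_Cons_iff)
      then show ?thesis by (intro bexI[of _ e]) (auto simp: W_def tree_awalk)
    qed
    have br: "branching G W"
    proof unfold_locales
      show "W \<subseteq> verts G" by (auto simp: W_def)
      show "tail G e \<in> W" if "e \<in> arcs G" "head G e \<in> W" for e
        using that tree_trans[OF arc[OF that(1)]] by (auto simp: W_def)
      show "\<exists>e\<in>out_arcs G y. head G e \<in> W" if "y \<in> W" "out_arcs G y \<noteq> {}" for y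
        using out[OF that(1)] .
    qed
    obtain g where g: "awalk w g w1" using w1 by (auto simp: tree_awalk)
    obtain b d where bd: "b \<in> L" "d \<in> L" "b * (rp w g * gp w g) * d = V w" using div[OF g] by blast
    have "V w = (b * rp w g) * V w1 * (gp w g * d)"
      using bd(3) V_gp_same[OF g] by (metis mult.assoc)
    moreover have "V w1 \<in> vertex_ideal (verts G - W)"
      using nv tree_verts[OF w1] by (intro V_vertex_ideal) (simp add: W_def)
    moreover have "ide (vertex_ideal (verts G - W))" by (rule ide_vertex_ideal) blast
    ultimately have "V w \<in> vertex_ideal (verts G - W)"
      using bd g by (metis L_mult gp_L ide_mult rp_L)
    moreover have "w \<in> W" using v wv by (simp add: W_def)
    moreover have "scalar_form w 1 (V w)" using scalar_form_V[OF wv, of 1] by simp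
    ultimately show False using scalar_form_vertex_ideal[OF br] by (metis zero_neq_one)
  next
    case False
    have sink: "out_arcs G x \<noteq> {}" if x: "x \<in> tree w" for x
    proof -
      obtain b where b: "b \<in> tree x" "bifurcation b" using wr x by (auto simp: rebifurcating_def)
      then obtain p where p: "awalk x p b" by (auto simp: tree_awalk)
      obtain e where e: "e \<in> arcs G" "tail G e = b" using b(2) by (auto simp: bifurcation_iff)
      show ?thesis using p e by (cases p) (auto simp: awalk_Nil_iff awalk_Cons_iff)
    qed
    obtain u where u: "u \<in> tree w" "bifurcation u" using wr tree_refl[OF wv] by (auto simp: rebifurcating_def)
    then obtain l where l: "awalk w l u" by (auto simp: tree_awalk)
    obtain e f where ef: "e \<in> arcs G" "f \<in> arcs G" "tail G e = u" "tail G f = u" "e \<noteq> f"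
      using u(2) by (auto simp: bifurcation_iff)
    define g h where "g = l @ [e]" and "h = l @ [f]"
    have g: "awalk w g (head G e)" and h: "awalk w h (head G f)"
      using l ef by (auto simp: g_def h_def awalk_Cons_iff awalk_Nil_iff)
    have "h \<parallel> g" using ef(5) by (auto simp: g_def h_def parallel_def)
    then have hg: "gp w h * rp w g = 0" using gp_rp_parallel[OF h g] by blast
    obtain b d where bd: "b \<in> L" "d \<in> L" "b * (rp w g * gp w g) * d = V w" using div[OF g] by blast
    \<comment> \<open>Chosen such that \<open>t * s = V w\<close>, while \<open>s\<close> begins
      with the path \<open>g\<close> and is therefore annihilated by the ghost of the incomparable
      path \<open>h\<close>. Then \<open>s * t = V w\<close> would force \<open>gp w h\<close> to be
      zero.\<close>
    define t s where "t = V w * b * rp w g * gp w g" and "s = rp w g * gp w g * d * V w"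
    have VV: "V w * V w = V w" "\<And>x. V w * (V w * x) = V w * x" using wv by (simp_all add: V_V flip: mult.assoc)
    have gg: "gp w g * (rp w g * x) = V (head G e) * x" for x using gp_rp[OF g] by (simp flip: mult.assoc)
    have Vg: "V (head G e) * (gp w g * x) = gp w g * x" for x using V_gp_same[OF g] by (simp flip: mult.assoc)
    have "t * s = V w * (b * (rp w g * gp w g) * d) * V w"
      by (simp add: t_def s_def mult.assoc gg Vg)
    also have "\<dots> = V w" using bd(3) VV by simp
    finally have ts: "t * s = V w" .
    have "s * t = V w"
    proof (rule acyclic_corner_directly_finite[OF wv sink _ _ _ _ _ _ _ ts])
      show "x \<notin> path_sources c" if "x \<in> tree w" "cycle c" for x c using False that by blast
      show "s \<in> L" "t \<in> L" using bd g wv by (simp_all add: t_def s_def)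
      show "V w * s = s" using V_rp_same[OF g] by (simp add: s_def flip: mult.assoc)
      show "s * V w = s" using VV by (simp add: s_def mult.assoc)
      show "V w * t = t" using VV by (simp add: t_def mult.assoc)
      show "t * V w = t" using gp_V_same[OF g] by (simp add: t_def mult.assoc)
    qed
    then have "gp w h * (s * t) = gp w h" using gp_V_same[OF h] by simp
    moreover have "gp w h * (s * t) = (gp w h * rp w g) * (gp w g * d * V w * t)"
      by (simp only: s_def mult.assoc)
    ultimately show False using hg gp_neq_0[OF h] by simp
  qed
qed

text \<open>By reduction, a nonzero \<open>x * b * V w\<close> would make some vertex below
  \<open>w\<close> factor through \<open>x\<close>, and that vertex again has pure infinite
  bifurcations.\<close>

lemma distinguished_annihilates:
  assumes x: "x \<in> distinguished LR" and b: "b \<in> L" and w: "w \<in> pure_infinite_bifurcations"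
  shows "x * b * V w = 0"
proof (rule ccontr)
  assume nz: "x * b * V w \<noteq> 0"
  have xL: "x \<in> L" using x by (simp add: distinguished_def)
  have wr: "w \<in> rebifurcating" using w pure_infinite_bifurcations_subset by blast
  obtain a d u where ad: "a \<in> L" "d \<in> L" "u \<in> tree w" "a * (x * b) * d = V u"
    using reduction[OF L_mult[OF xL b] wr nz] by blast
  have bd: "b * d \<in> L" "a * x * (b * d) = V u" using ad b by (simp_all add: mult.assoc)
  have u: "u \<in> pure_infinite_bifurcations" by (rule pure_infinite_bifurcations_tree[OF w ad(3)])
  show False
  proof (cases "corner_domain LR x")
    case True
    then show False
      using corner_domain_not_rebifurcating[OF xL True ad(1) bd] rebifurcating_tree[OF wr ad(3)] by blast
  next
    case False
    then have "corner_divides LR x" using x by (simp add: distinguished_def)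
    from corner_divides_path[OF xL this ad(1) bd] show False
      using pure_infinite_not_path_divisible[OF u] by blast
  qed
qed

text \<open>Each corner of \<open>y\<close> is expanded over paths so long that ghost parts
  disappear. A term whose path ends at a vertex with pure infinite bifurcations lies in the ideal;
  every other term turns out to be zero.\<close>

lemma annihilator_subset:
  assumes y: "y \<in> distinguished_annihilator LR"
  shows "y \<in> vertex_ideal pure_infinite_bifurcations"
proof -
  let ?I = "vertex_ideal pure_infinite_bifurcations"
  have I: "ide ?I" by (rule ide_vertex_ideal) (auto simp: pure_infinite_bifurcations_def)
  have yL: "y \<in> L" using y by (simp add: distinguished_annihilator_def)
  have ann: "V x * b * y = 0" if "x \<in> nonbifurcating \<union> extreme_cycle_points" "b \<in> L" for x b
    using y that nonbifurcating_distinguished extreme_distinguished by (auto simp: distinguished_annihilator_def)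
  have corner: "V v * y * V u' \<in> ?I" if v: "v \<in> verts G" and u': "u' \<in> verts G" for v u'
  proof -
    obtain n where n: "\<forall>q\<in>paths_upto n u'. \<forall>u. awalk u' q u \<longrightarrow> V v * y * rp u' q \<in> real_span v u"
      using real_span_paths_upto[OF yL v u'] by blast
    have "V v * y * rp u' q * gp u' q \<in> ?I" if q: "q \<in> paths_upto n u'" for q
    proof -
      obtain u where u: "awalk u' q u" using paths_upto_awalk[OF u' q] by blast
      let ?z = "V v * y * rp u' q"
      have z: "?z \<in> real_span v u" using n q u by blast
      have zL: "?z \<in> L" using v yL u by simp
      show ?thesis
      proof (cases "u \<in> pure_infinite_bifurcations")
        case True
        have "?z * gp u' q = ?z * V u * gp u' q" using V_gp_same[OF u] by (simp add: mult.assoc)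
        then show ?thesis using ide_mult[OF I] V_vertex_ideal[OF True] zL u by simp
      next
        case False
        have "?z = 0"
        proof (rule ccontr)
          assume "?z \<noteq> 0"
          then obtain p k where p: "awalk v p u" "k \<noteq> 0" "scalar_form u k (gp v p * ?z)"
            using real_span_scalar_form[OF z] by blast
          \<comment> \<open>Conjugating the scalar form along a path to \<open>x\<close> keeps the
            scalar \<open>k\<close>, but the result contains \<open>V x\<close> to the left of
            \<open>y\<close>, so it vanishes.\<close>
          obtain x where x: "x \<in> nonbifurcating \<union> extreme_cycle_points" "x \<in> tree u"
            using reaches_distinguished[OF awalk_last_in_verts[OF u] False] by blast
          then obtain l where l: "awalk u l x" by (auto simp: tree_awalk)
          have "gp u l * (gp v p * ?z) * rp u l = (V x * (gp u l * gp v p * V v) * y) * rp u' q * rp u l"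
            using V_gp_same[OF l] by (simp flip: mult.assoc)
          also have "\<dots> = 0" using ann[OF x(1)] l p(1) v by simp
          finally show False using scalar_form_conj[OF p(3) l] scalar_form_zero p(2) by simp
        qed
        then show ?thesis using I by (simp add: ide_def)
      qed
    qed
    moreover have "V v * y * V u' = (\<Sum>q\<in>paths_upto n u'. V v * y * rp u' q * gp u' q)"
      by (subst V_eq_sum_paths_upto[OF u', of n]) (simp add: sum_distrib_left mult.assoc)
    ultimately show ?thesis by (simp only: ide_sum[OF I])
  qed
  obtain U where U: "finite U" "U \<subseteq> verts G" "y = (\<Sum>v\<in>U. \<Sum>w\<in>U. V v * y * V w)"
    using corner_decomposition[OF yL] by blast
  have "(\<Sum>v\<in>U. \<Sum>w\<in>U. V v * y * V w) \<in> ?I"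
    using U(2) corner by (intro ide_sum[OF I]) blast
  then show ?thesis using U(3) by simp
qed

lemma vertex_ideal_pure_infinite:
  "vertex_ideal pure_infinite_bifurcations = distinguished_annihilator LR"
proof
  show "distinguished_annihilator LR \<subseteq> vertex_ideal pure_infinite_bifurcations"
    using annihilator_subset by blast
  have "ide (distinguished_annihilator LR)"
    unfolding ide_def
  proof (intro conjI ballI)
    show "distinguished_annihilator LR \<subseteq> L" "0 \<in> distinguished_annihilator LR"
      by (auto simp: distinguished_annihilator_def)
  next
    fix a b assume "a \<in> distinguished_annihilator LR" "b \<in> distinguished_annihilator LR"
    then show "a - b \<in> distinguished_annihilator LR"
      by (simp add: distinguished_annihilator_def right_diff_distrib)
  next
    fix a c assume a: "a \<in> distinguished_annihilator LR" and c: "c \<in> L"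
    have "x * b * (c * a) = 0" if "x \<in> distinguished LR" "b \<in> L" for x b
      using a c that by (simp add: distinguished_annihilator_def mult.assoc[symmetric, of b]) (metis L_mult mult.assoc)
    then show "c * a \<in> distinguished_annihilator LR"
      using a c by (simp add: distinguished_annihilator_def)
    show "a * c \<in> distinguished_annihilator LR"
      using a c by (simp add: distinguished_annihilator_def flip: mult.assoc)
  qed
  moreover have "V ` pure_infinite_bifurcations \<subseteq> distinguished_annihilator LR"
    using distinguished_annihilates by (auto simp: distinguished_annihilator_def pure_infinite_bifurcations_def)
  ultimately show "vertex_ideal pure_infinite_bifurcations \<subseteq> distinguished_annihilator LR"
    by (rule vertex_ideal_least)
qed

end

section \<open>Isomorphism invariance\<close>

lemma rng_genideal_least: "rng_ideal I R \<Longrightarrow> A \<subseteq> I \<Longrightarrow> rng_genideal R A \<subseteq> I"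
  unfolding rng_genideal_def by blast

text \<open>The assumptions are symmetric in the two rings, so the inverse map is another instance
  and every inclusion of images yields its converse.\<close>

locale rng_isomorphism = R: abelian_group R + S: abelian_group S
  for R :: "('a, 'm) ring_scheme" (structure) and S :: "('b, 'n) ring_scheme" (structure) +
  fixes f
  assumes iso: "f \<in> rng_iso R S"
    and R_m_closed: "\<lbrakk>x \<in> carrier R; y \<in> carrier R\<rbrakk> \<Longrightarrow> x \<otimes>\<^bsub>R\<^esub> y \<in> carrier R"
    and S_m_closed: "\<lbrakk>x' \<in> carrier S; y' \<in> carrier S\<rbrakk> \<Longrightarrow> x' \<otimes>\<^bsub>S\<^esub> y' \<in> carrier S"
begin

lemma bij: "bij_betw f (carrier R) (carrier S)"
  using iso by (simp add: rng_iso_iff)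

lemma f_closed [simp]: "x \<in> carrier R \<Longrightarrow> f x \<in> carrier S"
  using bij by (auto dest: bij_betwE)

lemma f_mult: "x \<in> carrier R \<Longrightarrow> y \<in> carrier R \<Longrightarrow> f (x \<otimes>\<^bsub>R\<^esub> y) = f x \<otimes>\<^bsub>S\<^esub> f y"
  using iso by (simp add: rng_iso_iff)

lemma f_add: "x \<in> carrier R \<Longrightarrow> y \<in> carrier R \<Longrightarrow> f (x \<oplus>\<^bsub>R\<^esub> y) = f x \<oplus>\<^bsub>S\<^esub> f y"
  using iso by (simp add: rng_iso_iff)

lemma f_inj: "x \<in> carrier R \<Longrightarrow> y \<in> carrier R \<Longrightarrow> f x = f y \<longleftrightarrow> x = y"
  using bij by (auto simp: bij_betw_def inj_on_def)

lemma f_surj: "y \<in> carrier S \<Longrightarrow> \<exists>x\<in>carrier R. y = f x"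
  using bij by (auto simp: bij_betw_def)

lemma f_zero: "f \<zero>\<^bsub>R\<^esub> = \<zero>\<^bsub>S\<^esub>"
proof -
  have "f \<zero>\<^bsub>R\<^esub> \<oplus>\<^bsub>S\<^esub> f \<zero>\<^bsub>R\<^esub> = f \<zero>\<^bsub>R\<^esub>"
    using f_add[of "\<zero>\<^bsub>R\<^esub>" "\<zero>\<^bsub>R\<^esub>"] by simp
  then show ?thesis using S.add.l_cancel_one[of "f \<zero>\<^bsub>R\<^esub>" "f \<zero>\<^bsub>R\<^esub>"] by simp
qed

lemma f_eq_zero: "x \<in> carrier R \<Longrightarrow> f x = \<zero>\<^bsub>S\<^esub> \<longleftrightarrow> x = \<zero>\<^bsub>R\<^esub>"
  using f_inj[of x "\<zero>\<^bsub>R\<^esub>"] f_zero by simp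

lemma inverse: "rng_isomorphism S R (inv_into (carrier R) f)"
proof -
  let ?g = "inv_into (carrier R) f"
  have g: "?g y \<in> carrier R" "f (?g y) = y" if "y \<in> carrier S" for y
    using that bij by (auto simp: bij_betw_def inv_into_into f_inv_into_f)
  have "?g (x \<oplus>\<^bsub>S\<^esub> y) = ?g x \<oplus>\<^bsub>R\<^esub> ?g y" "?g (x \<otimes>\<^bsub>S\<^esub> y) = ?g x \<otimes>\<^bsub>R\<^esub> ?g y"
    if "x \<in> carrier S" "y \<in> carrier S" for x y
    using that g by (subst f_inj[symmetric]; simp add: f_add f_mult R_m_closed S_m_closed)+
  then have "?g \<in> rng_iso S R" using bij_betw_inv_into[OF bij] by (simp add: rng_iso_iff)
  then show ?thesis by unfold_locales (simp_all add: R_m_closed S_m_closed)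
qed

lemma rng_ideal_image:
  assumes "rng_ideal I R"
  shows "rng_ideal (f ` I) S"
proof -
  interpret I: additive_subgroup I R using assms by (simp add: rng_ideal_def)
  interpret h: group_hom "add_monoid R" "add_monoid S" f
    by unfold_locales (auto simp: hom_def f_add)
  have "subgroup (f ` I) (add_monoid S)"
    by (rule h.subgroup_img_is_subgroup) (rule I.a_subgroup)
  moreover have "y \<otimes>\<^bsub>S\<^esub> f a \<in> f ` I \<and> f a \<otimes>\<^bsub>S\<^esub> y \<in> f ` I" if ay: "a \<in> I" "y \<in> carrier S" for a y
  proof -
    obtain x where x: "x \<in> carrier R" "y = f x" using f_surj[OF ay(2)] by blast
    have aR: "a \<in> carrier R" using ay(1) I.a_subset by blast
    have "x \<otimes>\<^bsub>R\<^esub> a \<in> I" "a \<otimes>\<^bsub>R\<^esub> x \<in> I" using assms ay(1) x(1) by (simp_all add: rng_ideal_def)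
    then show ?thesis using x(2) f_mult[OF x(1) aR] f_mult[OF aR x(1)] by (metis imageI)
  qed
  ultimately show ?thesis by (auto simp: rng_ideal_def additive_subgroup_def)
qed

lemma rng_ideal_carrier: "rng_ideal (carrier S) S"
  unfolding rng_ideal_def using S.add.subgroup_self S_m_closed
  by (simp add: additive_subgroup_def)

lemma rng_ideal_subset: "rng_ideal I R' \<Longrightarrow> I \<subseteq> carrier R'"
  by (auto simp: rng_ideal_def dest: additive_subgroup.a_subset)

lemma rng_genideal_image:
  assumes A: "A \<subseteq> carrier R"
  shows "f ` rng_genideal R A = rng_genideal S (f ` A)"
proof (intro equalityI subsetI)
  interpret g: rng_isomorphism S R "inv_into (carrier R) f" by (rule inverse)
  have gf: "inv_into (carrier R) f (f x) = x" if "x \<in> carrier R" for x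
    using that bij by (simp add: bij_betw_def)
  have fg: "f (inv_into (carrier R) f y) = y" if "y \<in> carrier S" for y
    using that bij by (simp add: bij_betw_def f_inv_into_f)
  {
    fix y assume "y \<in> f ` rng_genideal R A"
    then obtain x where x: "x \<in> rng_genideal R A" "y = f x" by blast
    show "y \<in> rng_genideal S (f ` A)"
      unfolding rng_genideal_def
    proof (rule InterI)
      fix I assume "I \<in> {I. rng_ideal I S \<and> f ` A \<subseteq> I}"
      then have I: "rng_ideal I S" "f ` A \<subseteq> I" by simp_all
      have "A \<subseteq> inv_into (carrier R) f ` I"
      proof
        fix a assume "a \<in> A"
        then have "f a \<in> I" "inv_into (carrier R) f (f a) = a" using I(2) A gf by blast+
        then show "a \<in> inv_into (carrier R) f ` I" by (metis imageI)
      qed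
      then have "rng_genideal R A \<subseteq> inv_into (carrier R) f ` I"
        using rng_genideal_least[OF g.rng_ideal_image[OF I(1)]] by blast
      then obtain i where i: "i \<in> I" "x = inv_into (carrier R) f i" using x(1) by blast
      then show "y \<in> I" using x(2) fg rng_ideal_subset[OF I(1)] by auto
    qed
  next
    fix y assume y: "y \<in> rng_genideal S (f ` A)"
    have "f ` A \<subseteq> carrier S" using A by auto
    then have yS: "y \<in> carrier S" using y rng_genideal_least[OF rng_ideal_carrier] by blast
    have "inv_into (carrier R) f y \<in> rng_genideal R A"
      unfolding rng_genideal_def
    proof (rule InterI)
      fix I assume "I \<in> {I. rng_ideal I R \<and> A \<subseteq> I}"
      then have I: "rng_ideal I R" "A \<subseteq> I" by simp_all
      have "y \<in> f ` I" using y rng_genideal_least[OF rng_ideal_image[OF I(1)], of "f ` A"] I(2) by blast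
      then obtain i where i: "i \<in> I" "y = f i" by blast
      then show "inv_into (carrier R) f y \<in> I" using gf rng_ideal_subset[OF I(1)] by auto
    qed
    then show "y \<in> f ` rng_genideal R A" using fg[OF yS] by (metis imageI)
  }
qed

lemma distinguished_image: "x \<in> distinguished R \<Longrightarrow> f x \<in> distinguished S"
proof -
  assume x: "x \<in> distinguished R"
  then have xR: "x \<in> carrier R" by (simp add: distinguished_def)
  have 3: "f (x \<otimes>\<^bsub>R\<^esub> a \<otimes>\<^bsub>R\<^esub> x) = f x \<otimes>\<^bsub>S\<^esub> f a \<otimes>\<^bsub>S\<^esub> f x" if "a \<in> carrier R" for a
    using that xR by (simp add: f_mult R_m_closed)
  have 5: "f (x \<otimes>\<^bsub>R\<^esub> a \<otimes>\<^bsub>R\<^esub> x \<otimes>\<^bsub>R\<^esub> b \<otimes>\<^bsub>R\<^esub> x) = f x \<otimes>\<^bsub>S\<^esub> f a \<otimes>\<^bsub>S\<^esub> f x \<otimes>\<^bsub>S\<^esub> f b \<otimes>\<^bsub>S\<^esub> f x"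
    if "a \<in> carrier R" "b \<in> carrier R" for a b
    using that xR by (simp add: f_mult R_m_closed)
  have 7: "f (b \<otimes>\<^bsub>R\<^esub> (x \<otimes>\<^bsub>R\<^esub> a \<otimes>\<^bsub>R\<^esub> x) \<otimes>\<^bsub>R\<^esub> c) = f b \<otimes>\<^bsub>S\<^esub> (f x \<otimes>\<^bsub>S\<^esub> f a \<otimes>\<^bsub>S\<^esub> f x) \<otimes>\<^bsub>S\<^esub> f c"
    if "a \<in> carrier R" "b \<in> carrier R" "c \<in> carrier R" for a b c
    using that xR by (simp add: f_mult R_m_closed)
  have "corner_domain S (f x)" if dom: "corner_domain R x"
    unfolding corner_domain_def
  proof (intro ballI impI)
    fix a' b' assume "a' \<in> carrier S" "b' \<in> carrier S"
      and 0: "f x \<otimes>\<^bsub>S\<^esub> a' \<otimes>\<^bsub>S\<^esub> f x \<otimes>\<^bsub>S\<^esub> b' \<otimes>\<^bsub>S\<^esub> f x = \<zero>\<^bsub>S\<^esub>"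
    then obtain a b where ab: "a \<in> carrier R" "a' = f a" "b \<in> carrier R" "b' = f b" using f_surj by blast
    have "x \<otimes>\<^bsub>R\<^esub> a \<otimes>\<^bsub>R\<^esub> x \<otimes>\<^bsub>R\<^esub> b \<otimes>\<^bsub>R\<^esub> x = \<zero>\<^bsub>R\<^esub>"
      using 0 ab 5[of a b] f_eq_zero xR by (simp add: R_m_closed)
    then have "x \<otimes>\<^bsub>R\<^esub> a \<otimes>\<^bsub>R\<^esub> x = \<zero>\<^bsub>R\<^esub> \<or> x \<otimes>\<^bsub>R\<^esub> b \<otimes>\<^bsub>R\<^esub> x = \<zero>\<^bsub>R\<^esub>"
      using dom ab by (simp add: corner_domain_def)
    then show "f x \<otimes>\<^bsub>S\<^esub> a' \<otimes>\<^bsub>S\<^esub> f x = \<zero>\<^bsub>S\<^esub> \<or> f x \<otimes>\<^bsub>S\<^esub> b' \<otimes>\<^bsub>S\<^esub> f x = \<zero>\<^bsub>S\<^esub>"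
      using 3[OF ab(1)] 3[OF ab(3)] ab f_zero by metis
  qed
  moreover have "corner_divides S (f x)" if div: "corner_divides R x"
    unfolding corner_divides_def
  proof (intro ballI impI)
    fix a' assume "a' \<in> carrier S" and nz: "f x \<otimes>\<^bsub>S\<^esub> a' \<otimes>\<^bsub>S\<^esub> f x \<noteq> \<zero>\<^bsub>S\<^esub>"
    then obtain a where a: "a \<in> carrier R" "a' = f a" using f_surj by blast
    then have "x \<otimes>\<^bsub>R\<^esub> a \<otimes>\<^bsub>R\<^esub> x \<noteq> \<zero>\<^bsub>R\<^esub>" using nz 3[OF a(1)] f_zero by auto
    then obtain b c where bc: "b \<in> carrier R" "c \<in> carrier R" "b \<otimes>\<^bsub>R\<^esub> (x \<otimes>\<^bsub>R\<^esub> a \<otimes>\<^bsub>R\<^esub> x) \<otimes>\<^bsub>R\<^esub> c = x"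
      using div a by (auto simp: corner_divides_def)
    then show "\<exists>b\<in>carrier S. \<exists>c\<in>carrier S. b \<otimes>\<^bsub>S\<^esub> (f x \<otimes>\<^bsub>S\<^esub> a' \<otimes>\<^bsub>S\<^esub> f x) \<otimes>\<^bsub>S\<^esub> c = f x"
      using 7[OF a(1) bc(1,2)] a by (intro bexI[of _ "f b"] bexI[of _ "f c"]) simp_all
  qed
  ultimately show ?thesis using x by (auto simp: distinguished_def)
qed

lemma distinguished_annihilator_image_subset:
  "f ` distinguished_annihilator R \<subseteq> distinguished_annihilator S"
proof safe
  interpret g: rng_isomorphism S R "inv_into (carrier R) f" by (rule inverse)
  fix y assume y: "y \<in> distinguished_annihilator R"
  then have yR: "y \<in> carrier R" by (simp add: distinguished_annihilator_def)
  have "x' \<otimes>\<^bsub>S\<^esub> b' \<otimes>\<^bsub>S\<^esub> f y = \<zero>\<^bsub>S\<^esub>" if x': "x' \<in> distinguished S" and b': "b' \<in> carrier S" for x' b'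
  proof -
    have x'S: "x' \<in> carrier S" using x' by (simp add: distinguished_def)
    define x where "x = inv_into (carrier R) f x'"
    have x: "x \<in> distinguished R" "x \<in> carrier R" "f x = x'"
      using g.distinguished_image[OF x'] x'S bij g.f_closed[OF x'S]
      by (simp_all add: x_def bij_betw_def f_inv_into_f)
    obtain b where b: "b \<in> carrier R" "b' = f b" using f_surj[OF b'] by blast
    have "x \<otimes>\<^bsub>R\<^esub> b \<otimes>\<^bsub>R\<^esub> y = \<zero>\<^bsub>R\<^esub>" using y x(1) b(1) by (simp add: distinguished_annihilator_def)
    moreover have "f (x \<otimes>\<^bsub>R\<^esub> b \<otimes>\<^bsub>R\<^esub> y) = x' \<otimes>\<^bsub>S\<^esub> b' \<otimes>\<^bsub>S\<^esub> f y"
      using x b yR by (simp add: f_mult R_m_closed)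
    ultimately show ?thesis using f_zero by simp
  qed
  then show "f y \<in> distinguished_annihilator S" using yR by (simp add: distinguished_annihilator_def)
qed

lemma distinguished_annihilator_image:
  "f ` distinguished_annihilator R = distinguished_annihilator S"
proof
  interpret g: rng_isomorphism S R "inv_into (carrier R) f" by (rule inverse)
  show "distinguished_annihilator S \<subseteq> f ` distinguished_annihilator R"
  proof
    fix y assume y: "y \<in> distinguished_annihilator S"
    then have "y \<in> carrier S" by (simp add: distinguished_annihilator_def)
    then have "f (inv_into (carrier R) f y) = y" using bij by (simp add: bij_betw_def f_inv_into_f)
    moreover have "inv_into (carrier R) f y \<in> distinguished_annihilator R"
      using g.distinguished_annihilator_image_subset y by blast
    ultimately show "y \<in> f ` distinguished_annihilator R" by (metis imageI)
  qed
qed (rule distinguished_annihilator_image_subset)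

end

section \<open>Transport from operators back to the quotient ring\<close>

lemma carrier_leavitt_path_algebra:
  "carrier (leavitt_path_algebra E) = lpa_class E ` carrier (lpa_free E)"
  by (auto simp: leavitt_path_algebra_def FactRing_def A_RCOSETS_def' lpa_class_def)

lemma zero_leavitt_path_algebra:
  "\<zero>\<^bsub>leavitt_path_algebra E\<^esub> = lpa_class E (0 :: ('v, 'e, 'k::field) free_alg)"
  by (auto simp: leavitt_path_algebra_def FactRing_def lpa_class_def a_r_coset_def' lpa_free_def)

lemma leavitt_path_algebra_m_closed:
  assumes "wf_digraph E" "x \<in> carrier (leavitt_path_algebra E)" "y \<in> carrier (leavitt_path_algebra E)"
  shows "x \<otimes>\<^bsub>leavitt_path_algebra E\<^esub> y \<in> carrier (leavitt_path_algebra E)"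
  using assms(2,3) unfolding carrier_leavitt_path_algebra
  by (auto simp: leavitt_path_algebra_ops(3)[OF assms(1)] carrier_lpa_free_closed)

lemma abelian_group_leavitt_path_algebra:
  assumes "wf_digraph E"
  shows "abelian_group (leavitt_path_algebra E :: ('v, 'e, 'k::field) free_alg set ring)"
proof -
  note ops = leavitt_path_algebra_ops(2)[OF assms]
  have 0: "(0 :: ('v, 'e, 'k) free_alg) \<in> carrier (lpa_free E)" by (simp add: lpa_free_def)
  show ?thesis
  proof (rule abelian_groupI)
    fix x :: "('v, 'e, 'k) free_alg set" assume "x \<in> carrier (leavitt_path_algebra E)"
    then obtain p where p: "p \<in> carrier (lpa_free E)" "x = lpa_class E p"
      unfolding carrier_leavitt_path_algebra by blast
    show "\<zero>\<^bsub>leavitt_path_algebra E\<^esub> \<oplus>\<^bsub>leavitt_path_algebra E\<^esub> x = x"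
      using p 0 by (simp add: zero_leavitt_path_algebra ops)
    show "\<exists>y\<in>carrier (leavitt_path_algebra E). y \<oplus>\<^bsub>leavitt_path_algebra E\<^esub> x = \<zero>\<^bsub>leavitt_path_algebra E\<^esub>"
      using p carrier_lpa_free_scale(1)[OF p(1)] unfolding carrier_leavitt_path_algebra
      by (intro bexI[of _ "lpa_class E (- p)"]) (simp_all add: zero_leavitt_path_algebra ops)
  qed (use 0 in \<open>auto simp: carrier_leavitt_path_algebra zero_leavitt_path_algebra ops
      carrier_lpa_free_closed add_ac\<close>)
qed

context leavitt
begin

text \<open>The description obtained in the operator ring is pulled back along the isomorphism
  between the quotient and \<open>LR\<close>; it is then a statement about the quotient ring
  alone.\<close>

lemma lpa_ideal_pure_infinite:
  "lpa_ideal G pure_infinite_bifurcations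
     = distinguished_annihilator (leavitt_path_algebra G :: ('v, 'e, 'k) free_alg set ring)"
proof -
  let ?A = "leavitt_path_algebra G :: ('v, 'e, 'k) free_alg set ring"
  note ops = leavitt_path_algebra_ops[OF wf_digraph_axioms]
  \<comment> \<open>Since \<open>cls\<close> has the relator ideal as its kernel, the value does not
    depend on the chosen representative of the coset.\<close>
  define h where "h Y = cls (SOME p. p \<in> carrier (lpa_free G) \<and> lpa_class G p = Y)" for Y
  have h: "h (lpa_class G p) = cls p" if p: "p \<in> carrier (lpa_free G)" for p
  proof -
    have "(SOME q. q \<in> carrier (lpa_free G) \<and> lpa_class G q = lpa_class G p) \<in> carrier (lpa_free G) \<and>
       lpa_class G (SOME q. q \<in> carrier (lpa_free G) \<and> lpa_class G q = lpa_class G p) = lpa_class G p"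
      by (rule someI[of _ p]) (simp add: p)
    then show ?thesis unfolding h_def using p by (subst cls_eq_iff) (auto simp: ops(4)[symmetric])
  qed
  have "bij_betw h (carrier ?A) (carrier LR)"
    unfolding bij_betw_def
  proof
    show "inj_on h (carrier ?A)"
      unfolding carrier_leavitt_path_algebra inj_on_def
      by (auto simp: h cls_eq_iff ops(4))
    show "h ` carrier ?A = carrier LR"
      unfolding carrier_leavitt_path_algebra by (auto simp: L_def h image_image)
  qed
  then have "h \<in> rng_iso ?A LR"
    by (auto simp: rng_iso_iff carrier_leavitt_path_algebra ops h cls_add cls_mult carrier_lpa_free_closed)
  then interpret h: rng_isomorphism ?A LR h
    by (intro rng_isomorphism.intro rng_isomorphism_axioms.intro abelian_group_leavitt_path_algebra
        abelian_group_LR leavitt_path_algebra_m_closed) (simp_all add: wf_digraph_axioms)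
  have sub: "(\<lambda>v. lpa_class G (monomial (Vertex v))) ` pure_infinite_bifurcations \<subseteq> carrier ?A"
    by (auto simp: carrier_leavitt_path_algebra pure_infinite_bifurcations_def)
  have "h ` lpa_ideal G pure_infinite_bifurcations = vertex_ideal pure_infinite_bifurcations"
    unfolding lpa_ideal_def h.rng_genideal_image[OF sub] vertex_ideal_def image_image
    by (intro arg_cong[of _ _ "rng_genideal LR"] image_cong refl)
      (simp add: h V_def pure_infinite_bifurcations_def)
  also have "\<dots> = h ` distinguished_annihilator ?A"
    unfolding vertex_ideal_pure_infinite h.distinguished_annihilator_image ..
  finally have "h ` lpa_ideal G pure_infinite_bifurcations = h ` distinguished_annihilator ?A" .
  moreover have "lpa_ideal G pure_infinite_bifurcations \<subseteq> carrier ?A"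
  proof -
    interpret g: rng_isomorphism LR ?A "inv_into (carrier ?A) h" by (rule h.inverse)
    show ?thesis using g.rng_ideal_carrier sub unfolding lpa_ideal_def rng_genideal_def by blast
  qed
  moreover have "distinguished_annihilator ?A \<subseteq> carrier ?A" by (auto simp: distinguished_annihilator_def)
  ultimately show ?thesis using h.bij unfolding bij_betw_def by (meson inj_on_image_eq_iff)
qed

end

theorem theorem3p8:
  fixes E :: "('v, 'e) pre_digraph"
    and F :: "('w, 'g) pre_digraph"
    and f :: "('v, 'e, 'k::field) free_alg set \<Rightarrow> ('w, 'g, 'k) free_alg set"
  assumes "row_finite_digraph E"
    and "row_finite_digraph F"
    and "f \<in> rng_iso (leavitt_path_algebra E) (leavitt_path_algebra F)"
  shows "f ` lpa_ideal E (pre_digraph.pure_infinite_bifurcations E)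
       = lpa_ideal F (pre_digraph.pure_infinite_bifurcations F)"
proof -
  interpret E: row_finite_digraph E by fact
  interpret F: row_finite_digraph F by fact
  obtain clsE :: "('v, 'e, 'k) free_alg \<Rightarrow> (('v, 'e) lpa_gen, 'k) free_op" where "leavitt E scale_op clsE"
    using leavitt_ex[OF assms(1)] by blast
  then interpret LE: leavitt E scale_op clsE .
  obtain clsF :: "('w, 'g, 'k) free_alg \<Rightarrow> (('w, 'g) lpa_gen, 'k) free_op" where "leavitt F scale_op clsF"
    using leavitt_ex[OF assms(2)] by blast
  then interpret LF: leavitt F scale_op clsF .
  interpret f: rng_isomorphism "leavitt_path_algebra E" "leavitt_path_algebra F" f
    by (intro rng_isomorphism.intro rng_isomorphism_axioms.intro abelian_group_leavitt_path_algebra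
        leavitt_path_algebra_m_closed assms) unfold_locales
  show ?thesis
    unfolding LE.lpa_ideal_pure_infinite LF.lpa_ideal_pure_infinite by (rule f.distinguished_annihilator_image)
qed

end
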